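(* Let $P(T)\in K[T]$ with $P(0)=0$ and $\deg P\le D$ be $p$-typical, i.e. $P(T)\in\bigoplus_{i\ge0}K\cdot T^{p^i}$. Assume the equation $y'=P'(T)\,y$ is soluble and not trivial. Then its index is $$\chi=1-\frac{p^d}{v_T(\widehat e(T)-1)},$$ where $v_T(\widehat e-1)$ denotes the multiplicity of $0$ as a root of the truncated series $\widehat e(T)-1\in\kappa[T]/(T^{D+1})$.
   Context: $p$ is a prime, $K$ an ultrametric (complete) field extension of $\mathbb{Q}_p$, $R$ its ring of integers, $\kappa$ its residue field. For $L=P'$ with $P(0)=0$, $e(T)=\exp(P(T))\in K[[T]]$. $\mathcal{O}^\dagger\subseteq K[[T]]$ is the algebra of power series with radius of convergence $>1$. The equation $y'=Ly$ is soluble if $e$ has radius $\ge1$, trivial if $e$ has radius $>1$. For a soluble equation, the index $\chi$ is $\dim_K H^0-\dim_K H^1$ of the complex $0\to\mathcal{O}^\dagger\xrightarrow{f\mapsto f'-Lf}\mathcal{O}^\dagger\to0$ (i.e. the index of this operator). Fix an integer $D\ge1$, $d=\lfloor\log_p D\rfloor$, $d_i=\lfloor\log_p(D/i)\rfloor$; assume $K$ contains a primitive $p^{d+1}$-th root of unity $\zeta$ and set $\pi_k=\zeta^{p^{d-k}}-1$ ($0\le k\le d$). For $P=\sum_{i=1}^Da_iT^i$, $\tilde P=\sum_i a_iT^i/\pi_{d_i}$, $\tilde e=\exp(\tilde P)\bmod T^{D+1}$; for soluble equations $\tilde e$ has coefficients in $R$ (known), and $\widehat e\in\kappa[T]/(T^{D+1})$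 is its reduction. *)

theory Defs
  imports "HOL-Analysis.Analysis" "HOL-Computational_Algebra.Computational_Algebra"
begin

text \<open>
  A field \<open>K\<close> (the type \<open>'a\<close>), complete for an ultrametric absolute value that extends the
  \<open>p\<close>-adic absolute value of the rationals. The closure of the rationals in \<open>K\<close> is then their
  \<open>p\<close>-adic completion, so this says that \<open>K\<close> is a complete ultrametric extension of the field
  of \<open>p\<close>-adic numbers.
\<close>
locale padic_extension =
  fixes p :: nat and nrm :: "'a::field_char_0 \<Rightarrow> real"
  assumes prime_p: "prime p"
    and nrm_nonneg: "0 \<le> nrm x"
    and nrm_eq_0_iff: "nrm x = 0 \<longleftrightarrow> x = 0"
    and nrm_mult: "nrm (x * y) = nrm x * nrm y"
    and nrm_ultrametric: "nrm (x + y) \<le> max (nrm x) (nrm y)"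
    and nrm_of_int: "m \<noteq> 0 \<Longrightarrow> nrm (of_int m) = 1 / real p ^ multiplicity (int p) m"
    and nrm_complete:
      "(\<And>\<epsilon>. \<epsilon> > 0 \<Longrightarrow> \<exists>N. \<forall>i\<ge>N. \<forall>j\<ge>N. nrm (s i - s j) < \<epsilon>) \<Longrightarrow>
         \<exists>l. (\<lambda>i. nrm (s i - l)) \<longlonglongrightarrow> 0"

definition integer_ring :: "('a::field_char_0 \<Rightarrow> real) \<Rightarrow> 'a set" where
  "integer_ring nrm = {x. nrm x \<le> 1}"

text \<open>
  The residue field, as a field \<open>'k\<close> with a surjective ring homomorphism \<open>red\<close> from the ring of
  integers onto it whose kernel is the maximal ideal. The values of \<open>red\<close> outside the ring of
  integers are unconstrained.
\<close>
locale residue_field =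
  fixes nrm :: "'a::field_char_0 \<Rightarrow> real" and red :: "'a \<Rightarrow> 'k::field"
  assumes red_one: "red 1 = 1"
    and red_add: "x \<in> integer_ring nrm \<Longrightarrow> y \<in> integer_ring nrm \<Longrightarrow> red (x + y) = red x + red y"
    and red_mult: "x \<in> integer_ring nrm \<Longrightarrow> y \<in> integer_ring nrm \<Longrightarrow> red (x * y) = red x * red y"
    and red_surj: "red ` integer_ring nrm = UNIV"
    and red_eq_0_iff: "x \<in> integer_ring nrm \<Longrightarrow> red x = 0 \<longleftrightarrow> nrm x < 1"

text \<open>
  The library's \<open>fps_conv_radius\<close> needs a real normed algebra. The Cauchy-Hadamard radius
  \<open>conv_radius\<close> depends only on the norms of the coefficients and is applied to those here.
\<close>
definition radius :: "('a::field_char_0 \<Rightarrow> real) \<Rightarrow> 'a fps \<Rightarrow> ereal" where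
  "radius nrm f = conv_radius (\<lambda>n. nrm (fps_nth f n))"

definition overconvergent :: "('a::field_char_0 \<Rightarrow> real) \<Rightarrow> 'a fps set" where
  "overconvergent nrm = {f. radius nrm f > 1}"

definition exp_poly :: "'a::field_char_0 poly \<Rightarrow> 'a fps" where
  "exp_poly P = fps_exp 1 oo fps_of_poly P"

text \<open>Solubility and triviality of \<open>y' = P' y\<close>, for \<open>P\<close> with zero constant term.\<close>
definition soluble :: "('a::field_char_0 \<Rightarrow> real) \<Rightarrow> 'a poly \<Rightarrow> bool" where
  "soluble nrm P \<longleftrightarrow> radius nrm (exp_poly P) \<ge> 1"

definition trivial_eq :: "('a::field_char_0 \<Rightarrow> real) \<Rightarrow> 'a poly \<Rightarrow> bool" where
  "trivial_eq nrm P \<longleftrightarrow> radius nrm (exp_poly P) > 1"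

definition fps_scale :: "'a::field_char_0 \<Rightarrow> 'a fps \<Rightarrow> 'a fps" where
  "fps_scale c f = fps_const c * f"

interpretation fps_vs: vector_space fps_scale
  by unfold_locales
    (auto simp: fps_scale_def algebra_simps simp flip: fps_const_add fps_const_mult)

text \<open>
  \<open>B\<close> is a finite set of elements of \<open>V\<close> whose classes are (pairwise distinct and form) a basis
  of the quotient space \<open>V / W\<close>.
\<close>
definition quotient_basis :: "'a::field_char_0 fps set \<Rightarrow> 'a fps set \<Rightarrow> 'a fps set \<Rightarrow> bool" where
  "quotient_basis V W B \<longleftrightarrow> finite B \<and> B \<subseteq> V \<and>
     (\<forall>v\<in>V. \<exists>c. v - (\<Sum>b\<in>B. fps_scale (c b) b) \<in> W) \<and>
     (\<forall>c. (\<Sum>b\<in>B. fps_scale (c b) b) \<in> W \<longrightarrow> (\<forall>b\<in>B. c b = 0))"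

definition quotient_dim :: "'a::field_char_0 fps set \<Rightarrow> 'a fps set \<Rightarrow> nat" where
  "quotient_dim V W = (THE n. \<exists>B. quotient_basis V W B \<and> card B = n)"

definition diff_op :: "'a::field_char_0 fps \<Rightarrow> 'a fps \<Rightarrow> 'a fps" where
  "diff_op L f = fps_deriv f - L * f"

definition H0 :: "('a::field_char_0 \<Rightarrow> real) \<Rightarrow> 'a fps \<Rightarrow> 'a fps set" where
  "H0 nrm L = {f \<in> overconvergent nrm. diff_op L f = 0}"

definition boundaries :: "('a::field_char_0 \<Rightarrow> real) \<Rightarrow> 'a fps \<Rightarrow> 'a fps set" where
  "boundaries nrm L = diff_op L ` overconvergent nrm"

text \<open>
  The index is meaningful only when both cohomology spaces are finite-dimensional: the dimensions
  used in \<open>index\<close> are arbitrary otherwise.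
\<close>
definition has_index :: "('a::field_char_0 \<Rightarrow> real) \<Rightarrow> 'a fps \<Rightarrow> bool" where
  "has_index nrm L \<longleftrightarrow>
     (\<exists>B. finite B \<and> H0 nrm L \<subseteq> fps_vs.span B) \<and>
     (\<exists>B. quotient_basis (overconvergent nrm) (boundaries nrm L) B)"

definition index :: "('a::field_char_0 \<Rightarrow> real) \<Rightarrow> 'a fps \<Rightarrow> int" where
  "index nrm L =
     int (fps_vs.dim (H0 nrm L)) - int (quotient_dim (overconvergent nrm) (boundaries nrm L))"

definition primitive_root_of_unity :: "nat \<Rightarrow> 'a::field_char_0 \<Rightarrow> bool" where
  "primitive_root_of_unity n z \<longleftrightarrow> n > 0 \<and> z ^ n = 1 \<and> (\<forall>k. 0 < k \<and> k < n \<longrightarrow> z ^ k \<noteq> 1)"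

text \<open>
  \<open>floor_log_div p D i\<close> is the number \<open>d\<^sub>i\<close>, the integer part of the base \<open>p\<close> logarithm of the real
  quotient \<open>D / i\<close>, used for \<open>1 \<le> i \<le> D\<close> only; \<open>d\<close> is the case \<open>i = 1\<close>.
\<close>
definition floor_log_div :: "nat \<Rightarrow> nat \<Rightarrow> nat \<Rightarrow> nat" where
  "floor_log_div p D i = nat \<lfloor>log (real p) (real D / real i)\<rfloor>"

definition pi_elt :: "nat \<Rightarrow> nat \<Rightarrow> 'a::field_char_0 \<Rightarrow> nat \<Rightarrow> 'a" where
  "pi_elt p D \<zeta> k = \<zeta> ^ (p ^ (floor_log_div p D 1 - k)) - 1"

definition P_tilde :: "nat \<Rightarrow> nat \<Rightarrow> 'a::field_char_0 \<Rightarrow> 'a poly \<Rightarrow> 'a poly" where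
  "P_tilde p D \<zeta> P = (\<Sum>i=1..D. monom (coeff P i / pi_elt p D \<zeta> (floor_log_div p D i)) i)"

text \<open>Classes modulo \<open>T\<^bsup>D+1\<^esup>\<close> are represented by polynomials of degree at most \<open>D\<close>.\<close>
definition e_tilde :: "nat \<Rightarrow> nat \<Rightarrow> 'a::field_char_0 \<Rightarrow> 'a poly \<Rightarrow> 'a poly" where
  "e_tilde p D \<zeta> P = truncate_fps (D + 1) (exp_poly (P_tilde p D \<zeta> P))"

definition e_hat ::
  "nat \<Rightarrow> nat \<Rightarrow> 'a::field_char_0 \<Rightarrow> ('a \<Rightarrow> 'k::field) \<Rightarrow> 'a poly \<Rightarrow> 'k poly" where
  "e_hat p D \<zeta> red P = map_poly red (e_tilde p D \<zeta> P)"

definition p_typical :: "nat \<Rightarrow> 'a::field_char_0 poly \<Rightarrow> bool" where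
  "p_typical p P \<longleftrightarrow> (\<forall>n. coeff P n \<noteq> 0 \<longrightarrow> (\<exists>i. n = p ^ i))"

end

theory Submission
  imports Defs "HOL-Number_Theory.Cong"
begin

text \<open>
  Since \<open>\<pi>\<^bsub>d-i\<^esub> = \<zeta>\<^bsup>p\<^sup>i\<^esup> - 1\<close>, a \<open>p\<close>-typical \<open>P\<close> satisfies \<open>P(T) = P~(\<zeta>T) - P~(T)\<close>. Let \<open>E\<close> be the Artin-Hasse
  exponential. Up to degree \<open>D\<close> one has \<open>exp P~ = \<Prod>\<^sub>i E(\<mu>\<^sub>i T\<^bsup>p\<^sup>i\<^esup>)\<close> for the Witt vector \<open>\<mu>\<close> whose ghost
  components are given by \<open>P~\<close>, and \<open>exp P\<close> is the product of the \<open>\<theta>\<^sub>i(\<mu>\<^sub>i T\<^bsup>p\<^sup>i\<^esup>)\<close>, \<open>\<theta>\<^sub>i(X) = E(\<zeta>\<^bsup>p\<^sup>i\<^esup>X) / E(X)\<close>.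
  Solubility means \<open>|\<mu>\<^sub>i| \<le> 1\<close> for all \<open>i \<le> d\<close>, triviality \<open>|\<mu>\<^sub>i| < 1\<close> for all \<open>i \<le> d\<close>. If \<open>j\<close> is the
  least index with \<open>|\<mu>\<^sub>j| = 1\<close> then \<open>p\<^sup>j\<close> is the multiplicity of \<open>0\<close> in the reduction, and it remains to show
  that the cokernel of the operator has dimension \<open>p\<^bsup>d-j\<^esup> - 1\<close>.

  The factors with \<open>i < j\<close> are overconvergent units and the other ones form \<open>g(T\<^sup>q)\<close>, \<open>q = p\<^sup>j\<close>. On the
  overconvergent series with exponents \<open>M - 1\<close>, \<open>q\<close> not dividing \<open>M\<close>, the Euler operator dominates and the
  equation is solved by recursion. On the rest, the operator is that of \<open>g\<close>, where \<open>|\<mu>\<^sub>0| = 1\<close>, whose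
  exponent has degree \<open>N = p\<^bsup>d-j\<^esup>\<close>. There \<open>T\<^sup>M\<close> reduces modulo the image to degree less than \<open>N - 1\<close>, and the point is
  that the reduction is bounded for Gauss norms of radius arbitrarily close to \<open>1\<close>. This comes from the
  divided powers \<open>\<nabla>\<^sup>k / k!\<close> with \<open>k\<close> a power of \<open>p\<close>: writing the twist \<open>g(T) / g(T + y)\<close> as a product of series
  \<open>\<theta>\<^sub>t(\<tau>\<^sub>t)\<^sup>-\<^sup>1\<close>, with \<open>\<tau>\<close> the components of the Witt vector \<open>[T + y] - [T]\<close>, bounds its coefficients so
  sharply that the leading term of \<open>\<nabla>\<^sup>k / k!\<close> dominates on a circle whose radius tends to \<open>1\<close> with \<open>k\<close>.
\<close>


section \<open>The absolute value\<close>

text \<open>Put w = |z^(p^n) - 1|, so that w^(p-1) = 1/p. Dividing by the leading coefficient of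
  \<nabla> itself costs a factor 1/w for every N - 1 degrees and is controlled only at the radius
  w^(-1/N), a fixed number above 1, whereas an overconvergent series may have any radius above 1.
  For k a power of p, Legendre's formula gives |k!| = w^(k-1), so k! absorbs all but one of the k
  factors w in the leading coefficient of \<nabla>^k / k!. The same loss 1/w now covers k times as
  many degrees, and the critical radius becomes w^(-1/(N k)). The lower coefficients keep pace
  because |z^(p^m) - 1| is at most the p^(n-m)-th root of w. The same leading coefficients settle
  solubility: if an exponential is bounded on a circle, multiplicativity of the Gauss norm bounds
  all of them there, and this forces |\<mu>_i| <= 1 once the factors that converge beyond the circle
  are divided out.\<close>

context padic_extension
begin

lemma p_ge_2: "p \<ge> 2"
  using prime_p by (rule prime_ge_2_nat)

lemma nrm_zero [simp]: "nrm 0 = 0"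
  by (simp add: nrm_eq_0_iff)

lemma nrm_one [simp]: "nrm 1 = 1"
  using nrm_of_int[of 1] by simp

lemma nrm_pos: "x \<noteq> 0 \<Longrightarrow> 0 < nrm x"
  using nrm_nonneg[of x] nrm_eq_0_iff[of x] by linarith

lemma nrm_minus [simp]: "nrm (- x) = nrm x"
proof -
  have "nrm (-1) = 1"
    using nrm_of_int[of "-1"] by simp
  then show ?thesis
    using nrm_mult[of "-1" x] by simp
qed

lemma nrm_power: "nrm (x ^ n) = nrm x ^ n"
  by (induction n) (simp_all add: nrm_mult)

lemma nrm_inverse: "nrm (inverse x) = inverse (nrm x)"
proof (cases "x = 0")
  case False
  then have "nrm x * nrm (inverse x) = 1"
    by (simp flip: nrm_mult)
  then show ?thesis
    by (simp add: inverse_unique)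
qed simp

lemma nrm_divide: "nrm (x / y) = nrm x / nrm y"
  by (simp add: divide_inverse nrm_mult nrm_inverse)

lemma nrm_add_le: "nrm x \<le> B \<Longrightarrow> nrm y \<le> B \<Longrightarrow> nrm (x + y) \<le> B"
  using nrm_ultrametric[of x y] by linarith

lemma nrm_diff_le: "nrm x \<le> B \<Longrightarrow> nrm y \<le> B \<Longrightarrow> nrm (x - y) \<le> B"
  using nrm_add_le[of x B "- y"] by simp

lemma nrm_add_less: "nrm x < B \<Longrightarrow> nrm y < B \<Longrightarrow> nrm (x + y) < B"
  using nrm_ultrametric[of x y] by linarith

lemma nrm_sum_le:
  assumes "0 \<le> B" and "\<And>i. i \<in> A \<Longrightarrow> nrm (f i) \<le> B"
  shows "nrm (sum f A) \<le> B"
  using assms by (induction A rule: infinite_finite_induct) (auto intro: nrm_add_le)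

lemma nrm_sum_less:
  assumes "0 < B" and "\<And>i. i \<in> A \<Longrightarrow> nrm (f i) < B"
  shows "nrm (sum f A) < B"
  using assms by (induction A rule: infinite_finite_induct) (auto intro: nrm_add_less)

lemma nrm_add_dominant:
  assumes "nrm y < nrm x"
  shows "nrm (x + y) = nrm x"
proof (rule antisym)
  show "nrm (x + y) \<le> nrm x"
    using assms by (intro nrm_add_le) auto
  have "nrm x \<le> max (nrm (x + y)) (nrm y)"
    using nrm_ultrametric[of "x + y" "- y"] by simp
  with assms show "nrm x \<le> nrm (x + y)"
    by linarith
qed

lemma nrm_mult_le: "nrm x \<le> A \<Longrightarrow> nrm y \<le> B \<Longrightarrow> nrm (x * y) \<le> A * B"
  using nrm_nonneg[of x] nrm_nonneg[of y] by (auto simp: nrm_mult intro: mult_mono)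

lemma nrm_mult_le_one: "nrm x \<le> 1 \<Longrightarrow> nrm y \<le> 1 \<Longrightarrow> nrm (x * y) \<le> 1"
  using nrm_mult_le[of x 1 y 1] by simp

lemma nrm_power_le_one: "nrm x \<le> 1 \<Longrightarrow> nrm (x ^ n) \<le> 1"
  by (simp add: nrm_power nrm_nonneg power_le_one)

lemma nrm_int_le_one: "nrm (of_int m) \<le> 1"
proof (cases "m = 0")
  case False
  have "1 \<le> real p ^ multiplicity (int p) m"
    using p_ge_2 by (intro one_le_power) auto
  with False p_ge_2 show ?thesis
    by (simp add: nrm_of_int divide_le_eq_1)
qed simp

lemma nrm_nat_le_one: "nrm (of_nat m) \<le> 1"
  using nrm_int_le_one[of "int m"] by simp

lemma nrm_int_not_dvd: "\<not> int p dvd m \<Longrightarrow> nrm (of_int m) = 1"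
  by (cases "m = 0") (simp_all add: nrm_of_int not_dvd_imp_multiplicity_0)

lemma nrm_nat_not_dvd: "\<not> p dvd m \<Longrightarrow> nrm (of_nat m) = 1"
  using nrm_int_not_dvd[of "int m"] by simp

lemma nrm_p: "nrm (of_nat p) = 1 / real p"
proof -
  have "\<not> is_unit (int p)" "int p \<noteq> 0"
    using p_ge_2 by auto
  then have "multiplicity (int p) (int p) = 1"
    by (rule multiplicity_self[rotated])
  then show ?thesis
    using nrm_of_int[of "int p"] p_ge_2 by simp
qed

lemma nrm_int_dvd:
  assumes "int p dvd m"
  shows "nrm (of_int m) \<le> 1 / real p"
proof -
  obtain l where "m = int p * l"
    using assms by blast
  then show ?thesis
    using nrm_mult_le[OF order_refl nrm_int_le_one, of "of_nat p" l] by (simp add: nrm_p)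
qed

lemma nrm_nat_dvd: "p dvd m \<Longrightarrow> nrm (of_nat m) \<le> 1 / real p"
  using nrm_int_dvd[of "int m"] by simp

lemma nrm_p_less_1: "1 / real p < 1"
  using p_ge_2 by simp

text \<open>Legendre's recursion: only the multiples of p among the factors of (p m)! are not units,
  and their product is p^m m!.\<close>

lemma nrm_fact_mult_p: "nrm (fact (p * m)) = (1 / real p) ^ m * nrm (fact m)"
  and nrm_fact_mult_p_add: "r < p \<Longrightarrow> nrm (fact (p * m + r)) = nrm (fact (p * m))"
proof -
  have *: "nrm (fact (p * m + r)) = nrm (fact (p * m))" if "r < p" for m r
    using that
  proof (induction r)
    case (Suc r)
    have "nrm (of_nat (p * m + Suc r)) = 1"
    proof (rule nrm_nat_not_dvd)
      show "\<not> p dvd p * m + Suc r"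
        using Suc.prems by (auto simp add: dvd_add_right_iff dest: dvd_imp_le simp del: add_Suc_right)
    qed
    moreover have "nrm (fact (p * m + Suc r))
        = nrm (of_nat (p * m + Suc r)) * nrm (fact (p * m + r))"
      unfolding add_Suc_right fact_Suc nrm_mult by simp
    ultimately show ?case
      using Suc by simp
  qed simp
  show "nrm (fact (p * m)) = (1 / real p) ^ m * nrm (fact m)"
  proof (induction m)
    case (Suc m)
    have eq: "p * Suc m = Suc (p * m + (p - 1))"
      using p_ge_2 by simp
    have "nrm (fact (p * Suc m)) = nrm (of_nat (p * Suc m)) * nrm (fact (p * m + (p - 1)))"
      unfolding eq fact_Suc nrm_mult by simp
    also have "nrm (fact (p * m + (p - 1))) = nrm (fact (p * m))"
      by (rule *) (use p_ge_2 in simp)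
    also have "nrm (of_nat (p * Suc m)) = nrm (of_nat p) * nrm (of_nat (Suc m))"
      unfolding of_nat_mult by (rule nrm_mult)
    finally show ?case
      using Suc by (simp only: fact_Suc nrm_mult nrm_p of_nat_id) simp
  qed simp
  show "r < p \<Longrightarrow> nrm (fact (p * m + r)) = nrm (fact (p * m))"
    by (rule *)
qed

text \<open>The crude form v_p(n!) <= n - 1 of Legendre's formula; it is just what makes the
  coefficients p^n / n! of exp(pX) divisible by p for n > 0.\<close>

lemma nrm_fact_ge: "n \<ge> 1 \<Longrightarrow> (1 / real p) ^ (n - 1) \<le> nrm (fact n)"
proof (induction n rule: less_induct)
  case (less n)
  define m r where "m = n div p" and "r = n mod p"
  have n: "n = p * m + r" and r: "r < p"
    using p_ge_2 by (simp_all add: m_def r_def)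
  have nrm_n: "nrm (fact n) = (1 / real p) ^ m * nrm (fact m)"
    unfolding n nrm_fact_mult_p_add[OF r] by (rule nrm_fact_mult_p)
  show ?case
  proof (cases "m = 0")
    case True
    then show ?thesis
      using nrm_n p_ge_2 by (simp add: power_le_one)
  next
    case False
    have m: "m \<ge> 1" "2 * m \<le> n"
      using False mult_le_mono1[OF p_ge_2, of m] n by linarith+
    then have "m < n"
      by linarith
    then have "(1 / real p) ^ (m - 1) \<le> nrm (fact m)"
      using less.IH m by blast
    then have "(1 / real p) ^ m * (1 / real p) ^ (m - 1) \<le> nrm (fact n)"
      unfolding nrm_n by (intro mult_left_mono) auto
    moreover have "(1 / real p) ^ (n - 1) \<le> (1 / real p) ^ (m + (m - 1))"
      using m p_ge_2 by (intro power_decreasing) auto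
    ultimately show ?thesis
      by (simp add: power_add)
  qed
qed

text \<open>For k = p^h the digit sum in base p is 1, so v_p(k!) = (k - 1) / (p - 1), the largest
  value that Legendre's formula permits. This is why divided powers are taken at powers of
  p.\<close>

lemma nrm_fact_prime_power_le:
  assumes "0 \<le> w" and "w ^ (p - 1) = 1 / real p"
  shows "nrm (fact (p ^ h)) \<le> w ^ (p ^ h - 1)"
proof (induction h)
  case (Suc h)
  have "p ^ Suc h - 1 = (p - 1) * p ^ h + (p ^ h - 1)"
    using p_ge_2 by (simp add: diff_mult_distrib)
  then have "w ^ (p ^ Suc h - 1) = (1 / real p) ^ (p ^ h) * w ^ (p ^ h - 1)"
    by (simp only: power_add power_mult assms)
  with Suc show ?case
    unfolding power_Suc nrm_fact_mult_p by (simp add: mult_left_mono)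
qed simp

text \<open>Fermat's little theorem for p-integral rationals, by clearing a denominator prime to p.
  Rationality matters: if K is ramified or has a larger residue field, x^p - x need not be that
  small.\<close>

lemma nrm_rat_power_p_diff:
  assumes "x \<in> \<rat>" and "nrm x \<le> 1"
  shows "nrm (x ^ p - x) \<le> 1 / real p"
proof -
  obtain a b where b: "b > 0" and cop: "coprime a b" and x: "x = of_int a / of_int b"
    using assms(1) by (rule Rats_cases')
  have "\<not> int p dvd b"
  proof
    assume pb: "int p dvd b"
    then have "\<not> int p dvd a"
      using cop p_ge_2 coprime_common_divisor[of a b "int p"] by auto
    then have "nrm (of_int a) = 1"
      by (rule nrm_int_not_dvd)
    moreover have "nrm (of_int b) < 1"
      using nrm_int_dvd[OF pb] nrm_p_less_1 by linarith
    moreover have "nrm (of_int b) > 0"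
      using b by (intro nrm_pos) simp
    ultimately have "nrm x > 1"
      by (simp add: x nrm_divide)
    with assms(2) show False
      by simp
  qed
  then have nb: "nrm (of_int b) = 1"
    by (rule nrm_int_not_dvd)
  have fermat_nat: "[c ^ p = c] (mod p)" for c :: nat
  proof (induction c)
    case (Suc c)
    have "{..p} = insert 0 (insert p {0<..<p})"
      using p_ge_2 by auto
    then have "Suc c ^ p = (\<Sum>i\<in>{0<..<p}. (p choose i) * c ^ i) + (c ^ p + 1)"
      using binomial_ring[of c 1 p] p_ge_2 by simp
    moreover have "p dvd (\<Sum>i\<in>{0<..<p}. (p choose i) * c ^ i)"
      using prime_p by (intro dvd_sum dvd_mult2) (simp add: dvd_choose_prime)
    then have "[(\<Sum>i\<in>{0<..<p}. (p choose i) * c ^ i) = 0] (mod p)"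
      by (simp add: cong_0_iff)
    ultimately show ?case
      using cong_add[OF _ cong_add[OF Suc cong_refl[of 1]]] by fastforce
  qed (use p_ge_2 in \<open>simp add: cong_def power_0_left\<close>)
  have fermat: "[c ^ p = c] (mod int p)" for c :: int
  proof -
    define n where "n = nat (c mod int p)"
    have "[c = int n] (mod int p)"
      using p_ge_2 by (simp add: n_def cong_def)
    moreover from this have "[c ^ p = int (n ^ p)] (mod int p)"
      by (simp add: cong_pow)
    moreover have "[int (n ^ p) = int n] (mod int p)"
      using fermat_nat[of n] by (simp only: cong_int_iff)
    ultimately show ?thesis
      by (meson cong_trans cong_sym)
  qed
  have "int p dvd a ^ p * b - a * b ^ p"
    using cong_diff[OF cong_scalar_right[OF fermat[of a]] cong_scalar_left[OF fermat[of b]], of b a]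
    by (simp add: cong_iff_dvd_diff)
  then have "nrm (of_int (a ^ p * b - a * b ^ p)) \<le> 1 / real p"
    by (rule nrm_int_dvd)
  moreover have "x ^ p - x = of_int (a ^ p * b - a * b ^ p) / (of_int b * of_int b ^ p)"
    using b by (simp add: x field_simps)
  ultimately show ?thesis
    by (simp add: nrm_divide nrm_mult nrm_power nb)
qed

end

section \<open>Exponentials of power series over a ring\<close>

text \<open>The derivation T d/dT. It does not shift coefficients, and it commutes with the
  substitution T -> c T^W up to the factor W.\<close>

definition euler :: "'r::comm_ring_1 fps \<Rightarrow> 'r fps" where
  "euler f = fps_X * fps_deriv f"

lemma euler_nth [simp]: "fps_nth (euler f) n = of_nat n * fps_nth f n"
  by (cases n) (simp_all add: euler_def)

lemma euler_add: "euler (f + g) = euler f + euler g"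
  by (simp add: fps_eq_iff algebra_simps)

lemma euler_minus: "euler (- f) = - euler f"
  by (simp add: fps_eq_iff)

lemma euler_mult: "euler (f * g) = euler f * g + f * euler g"
  by (simp add: euler_def algebra_simps)

text \<open>F = exp f, expressed by the differential equation of F instead of the exponential
  series. No denominators occur, so the notion makes sense over the coefficient ring K[[v]] as well
  and is stable under substitutions.\<close>

definition is_exp :: "'r::comm_ring_1 fps \<Rightarrow> 'r fps \<Rightarrow> bool" where
  "is_exp F f \<longleftrightarrow> fps_nth F 0 = 1 \<and> euler F = euler f * F"

lemma is_exp_nth_0: "is_exp F f \<Longrightarrow> fps_nth F 0 = 1"
  by (simp add: is_exp_def)

lemma is_exp_rec:
  assumes "is_exp F f"
  shows "of_nat n * fps_nth F n = (\<Sum>i=1..n. of_nat i * fps_nth f i * fps_nth F (n - i))"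
proof -
  have "of_nat n * fps_nth F n = (\<Sum>i=0..n. of_nat i * fps_nth f i * fps_nth F (n - i))"
    using assms unfolding is_exp_def fps_eq_iff by (simp add: fps_mult_nth)
  then show ?thesis
    by (simp add: sum.atLeast_Suc_atMost)
qed

lemma is_exp_zero: "is_exp 1 0"
  by (simp add: is_exp_def fps_eq_iff)

lemma is_exp_add: "is_exp F f \<Longrightarrow> is_exp G g \<Longrightarrow> is_exp (F * G) (f + g)"
  by (simp add: is_exp_def euler_add euler_mult algebra_simps)

lemma is_exp_sum:
  "(\<And>i. i \<in> A \<Longrightarrow> is_exp (F i) (f i)) \<Longrightarrow> is_exp (prod F A) (sum f A)"
  by (induction A rule: infinite_finite_induct) (auto intro: is_exp_zero is_exp_add)

lemma is_exp_power: "is_exp F f \<Longrightarrow> is_exp (F ^ n) (of_nat n * f)"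
  using is_exp_sum[of "{..<n}" "\<lambda>_. F" "\<lambda>_. f"] by simp

text \<open>By \<open>is_exp_rec\<close>, coefficient n of F depends only on the coefficients 1,
  ..., n of f. The truncation at m serves the comparison of \<open>P_tilde\<close> with the
  logarithm of an Artin-Hasse product, which is possible up to degree D.\<close>

lemma is_exp_nth_cong:
  fixes F G :: "'r::{idom, semiring_char_0} fps"
  assumes "is_exp F f" and "is_exp G g" and "\<And>i. i \<le> m \<Longrightarrow> 0 < i \<Longrightarrow> fps_nth f i = fps_nth g i"
  shows "n \<le> m \<Longrightarrow> fps_nth F n = fps_nth G n"
proof (induction n rule: less_induct)
  case (less n)
  show ?case
  proof (cases "n = 0")
    case True
    then show ?thesis
      using assms(1,2) by (simp add: is_exp_nth_0)
  next
    case False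
    have "of_nat n * fps_nth F n = of_nat n * fps_nth G n"
      unfolding is_exp_rec[OF assms(1)] is_exp_rec[OF assms(2)]
      by (rule sum.cong) (use less assms(3) in auto)
    with False show ?thesis
      by simp
  qed
qed

lemma is_exp_unique:
  fixes F G :: "'r::{idom, semiring_char_0} fps"
  assumes "is_exp F f" and "is_exp G f"
  shows "F = G"
  using is_exp_nth_cong[OF assms] by (auto simp: fps_eq_iff)

text \<open>The recursion has a single nonzero term at index m. A bound on an exponential thus
  bounds the first coefficient of its logarithm, which is how Witt components are shown to be
  integral.\<close>

lemma is_exp_lowest:
  fixes F :: "'r::{idom, semiring_char_0} fps"
  assumes "is_exp F f" and "\<And>i. 0 < i \<Longrightarrow> i < m \<Longrightarrow> fps_nth f i = 0" and "m > 0"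
  shows "fps_nth F m = fps_nth f m"
proof -
  have "of_nat m * fps_nth F m = (\<Sum>i=1..m. if i = m then of_nat m * fps_nth f m else 0)"
    unfolding is_exp_rec[OF assms(1)]
    by (rule sum.cong) (use assms in \<open>auto simp: is_exp_nth_0[OF assms(1)]\<close>)
  also have "\<dots> = of_nat m * fps_nth f m"
    using assms(3) by simp
  finally show ?thesis
    using assms(3) by simp
qed

lemma is_exp_fps_exp_compose:
  fixes f :: "'r::field_char_0 fps"
  assumes "fps_nth f 0 = 0"
  shows "is_exp (fps_exp 1 oo f) f"
proof -
  have "fps_deriv (fps_exp 1 oo f) = fps_deriv f * (fps_exp 1 oo f)"
    using assms by (simp add: fps_compose_deriv)
  then show ?thesis
    using assms by (simp add: is_exp_def euler_def mult.assoc)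
qed

lemma is_exp_minus:
  fixes F :: "'r::{idom, semiring_char_0} fps"
  assumes "is_exp F f" and "is_exp G (- f)"
  shows "F * G = 1"
proof -
  have "is_exp (F * G) 0"
    using is_exp_add[OF assms] by simp
  then show ?thesis
    using is_exp_zero by (rule is_exp_unique)
qed

lemma is_exp_fps_deriv:
  fixes F :: "'r::{idom, semiring_char_0} fps"
  assumes "is_exp F f"
  shows "fps_deriv F = fps_deriv f * F"
  using assms by (simp add: is_exp_def euler_def mult.assoc)

lemma fps_of_nat_mult_nth: "fps_nth (of_nat k * f) n = of_nat k * fps_nth f n"
  by (metis fps_mult_left_const_nth fps_of_nat)

section \<open>Substitution of monomials\<close>

text \<open>Two instances matter: the identity of K, and the embedding of K as constants into
  K[[v]], over which the twist by T -> T(1 + v) lives.\<close>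

locale ring_map =
  fixes \<kappa> :: "'a::field_char_0 \<Rightarrow> 'r::{idom, semiring_char_0}"
  assumes map_add: "\<kappa> (x + y) = \<kappa> x + \<kappa> y"
    and map_mult: "\<kappa> (x * y) = \<kappa> x * \<kappa> y"
    and map_one: "\<kappa> 1 = 1"
begin

lemma map_zero: "\<kappa> 0 = 0"
  using map_add[of 0 0] by simp

lemma map_minus: "\<kappa> (- x) = - \<kappa> x"
  using map_add[of x "- x"] by (simp add: map_zero eq_neg_iff_add_eq_0 add.commute)

lemma map_sum: "\<kappa> (sum f A) = (\<Sum>i\<in>A. \<kappa> (f i))"
  by (induction A rule: infinite_finite_induct) (simp_all add: map_add map_zero map_one)

lemma map_of_nat: "\<kappa> (of_nat n) = of_nat n"
  by (induction n) (simp_all add: map_add map_zero map_one)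

lemma map_power: "\<kappa> (x ^ n) = \<kappa> x ^ n"
  by (induction n) (simp_all add: map_mult map_one)

end

text \<open>The series \<open>f(c T\<^sup>W)\<close>, with the coefficients of \<open>f\<close> mapped by \<open>\<kappa>\<close>.\<close>
definition subst_monom :: "('a \<Rightarrow> 'r::comm_ring_1) \<Rightarrow> nat \<Rightarrow> 'r \<Rightarrow> 'a::zero fps \<Rightarrow> 'r fps" where
  "subst_monom \<kappa> W c f = Abs_fps (\<lambda>n. if W dvd n then \<kappa> (fps_nth f (n div W)) * c ^ (n div W) else 0)"

lemma subst_monom_nth:
  "fps_nth (subst_monom \<kappa> W c f) n
    = (if W dvd n then \<kappa> (fps_nth f (n div W)) * c ^ (n div W) else 0)"
  by (simp add: subst_monom_def)

lemma subst_monom_nth_0 [simp]: "fps_nth (subst_monom \<kappa> W c f) 0 = \<kappa> (fps_nth f 0)"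
  by (simp add: subst_monom_nth)

context ring_map
begin

lemma subst_monom_add:
  "subst_monom \<kappa> W c (f + g) = subst_monom \<kappa> W c f + subst_monom \<kappa> W c g"
  by (simp add: fps_eq_iff subst_monom_nth map_add algebra_simps)

lemma subst_monom_minus: "subst_monom \<kappa> W c (- f) = - subst_monom \<kappa> W c f"
  by (simp add: fps_eq_iff subst_monom_nth map_minus)

lemma subst_monom_sum: "subst_monom \<kappa> W c (sum f A) = (\<Sum>i\<in>A. subst_monom \<kappa> W c (f i))"
  by (induction A rule: infinite_finite_induct)
    (simp_all add: subst_monom_add, simp_all add: fps_eq_iff subst_monom_nth map_zero)

lemma subst_monom_mult:
  assumes "W > 0"
  shows "subst_monom \<kappa> W c (f * g) = subst_monom \<kappa> W c f * subst_monom \<kappa> W c g"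
proof (rule fps_ext)
  fix n
  show "fps_nth (subst_monom \<kappa> W c (f * g)) n
      = fps_nth (subst_monom \<kappa> W c f * subst_monom \<kappa> W c g) n"
  proof (cases "W dvd n")
    case True
    then obtain m where n: "n = W * m"
      by blast
    have "fps_nth (subst_monom \<kappa> W c f * subst_monom \<kappa> W c g) n
        = (\<Sum>i\<in>(*) W ` {0..m}. fps_nth (subst_monom \<kappa> W c f) i * fps_nth (subst_monom \<kappa> W c g) (n - i))"
      unfolding fps_mult_nth
    proof (rule sum.mono_neutral_right, simp, force simp: n, rule ballI)
      fix i
      assume i: "i \<in> {0..n} - (*) W ` {0..m}"
      have "\<not> W dvd i"
      proof
        assume "W dvd i"
        then obtain j where "i = W * j"
          by blast
        with i assms show False
          by (auto simp: n)
      qed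
      then show "fps_nth (subst_monom \<kappa> W c f) i * fps_nth (subst_monom \<kappa> W c g) (n - i) = 0"
        by (simp add: subst_monom_nth)
    qed
    also have "\<dots> = (\<Sum>i=0..m. fps_nth (subst_monom \<kappa> W c f) (W * i) * fps_nth (subst_monom \<kappa> W c g) (W * (m - i)))"
      by (subst sum.reindex) (use assms in \<open>auto simp: inj_on_def n diff_mult_distrib2\<close>)
    also have "\<dots> = (\<Sum>i=0..m. \<kappa> (fps_nth f i * fps_nth g (m - i)) * c ^ m)"
      using assms
      by (intro sum.cong) (auto simp: subst_monom_nth map_mult mult_ac simp flip: power_add)
    also have "\<dots> = fps_nth (subst_monom \<kappa> W c (f * g)) n"
      using assms by (simp add: subst_monom_nth n fps_mult_nth map_sum sum_distrib_right)
    finally show ?thesis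
      by simp
  next
    case False
    have "fps_nth (subst_monom \<kappa> W c f) i * fps_nth (subst_monom \<kappa> W c g) (n - i) = 0" if "i \<le> n" for i
    proof -
      have "\<not> (W dvd i \<and> W dvd n - i)"
        using False that by (metis dvd_add le_add_diff_inverse)
      then show ?thesis
        by (auto simp: subst_monom_nth)
    qed
    then have "fps_nth (subst_monom \<kappa> W c f * subst_monom \<kappa> W c g) n = 0"
      unfolding fps_mult_nth by (intro sum.neutral) auto
    with False show ?thesis
      by (simp add: subst_monom_nth[of _ _ _ "f * g"])
  qed
qed

lemma subst_monom_euler: "W > 0 \<Longrightarrow> euler (subst_monom \<kappa> W c f) = of_nat W * subst_monom \<kappa> W c (euler f)"
proof (rule fps_ext)
  fix n
  assume "W > 0"
  then show "fps_nth (euler (subst_monom \<kappa> W c f)) n = fps_nth (of_nat W * subst_monom \<kappa> W c (euler f)) n"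
    by (cases "W dvd n") (auto simp: subst_monom_nth map_mult map_of_nat fps_of_nat_mult_nth mult.assoc elim!: dvdE)
qed

lemma is_exp_subst_monom:
  assumes "is_exp F f" and "W > 0"
  shows "is_exp (subst_monom \<kappa> W c F) (subst_monom \<kappa> W c f)"
  using assms by (simp add: is_exp_def subst_monom_euler subst_monom_mult mult.assoc map_one)

lemma subst_monom_subst_monom:
  assumes "W > 0" and "V > 0"
  shows "subst_monom \<kappa> W c (subst_monom (\<lambda>x. x) V a f) = subst_monom \<kappa> (W * V) (\<kappa> a * c ^ V) f"
proof (rule fps_ext)
  fix n
  show "fps_nth (subst_monom \<kappa> W c (subst_monom (\<lambda>x. x) V a f)) n
      = fps_nth (subst_monom \<kappa> (W * V) (\<kappa> a * c ^ V) f) n"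
  proof (cases "W * V dvd n")
    case True
    then obtain m where "n = W * V * m"
      by blast
    with assms show ?thesis
      by (simp add: subst_monom_nth map_mult map_power power_mult_distrib mult.assoc flip: power_mult)
  next
    case False
    have "W dvd n \<Longrightarrow> \<not> V dvd n div W"
      using False assms by (auto elim!: dvdE)
    with False show ?thesis
      by (auto simp: subst_monom_nth map_zero)
  qed
qed

end

lemma ring_map_id: "ring_map (\<lambda>x::'a::field_char_0. x)"
  by unfold_locales auto

lemma ring_map_const: "ring_map (fps_const :: 'a::field_char_0 \<Rightarrow> 'a fps)"
  by unfold_locales auto

global_interpretation id_map: ring_map "\<lambda>x::'a::field_char_0. x"
  by (rule ring_map_id)

global_interpretation const_map: ring_map "fps_const :: 'a::field_char_0 \<Rightarrow> 'a fps"
  by (rule ring_map_const)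

section \<open>The Artin-Hasse exponential\<close>

definition ah_log :: "nat \<Rightarrow> 'a::field_char_0 fps" where
  "ah_log p = Abs_fps (\<lambda>n. if \<exists>i. n = p ^ i then 1 / of_nat n else 0)"

definition artin_hasse :: "nat \<Rightarrow> 'a::field_char_0 fps" where
  "artin_hasse p = fps_exp 1 oo ah_log p"

lemma is_exp_inverse:
  fixes F G :: "'r::{idom, semiring_char_0} fps"
  assumes "is_exp F f" and "F * G = 1"
  shows "is_exp G (- f)"
proof -
  have "fps_nth (F * G) 0 = 1"
    using assms(2) by simp
  then have "fps_nth G 0 = 1"
    using assms(1) by (simp add: is_exp_nth_0)
  moreover have "euler (F * G) = 0"
    by (simp add: assms(2) fps_eq_iff)
  then have "euler F * G + F * euler G = 0"
    by (simp add: euler_mult)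
  then have "F * (euler f * G + euler G) = 0"
    using assms(1) by (simp add: is_exp_def algebra_simps)
  then have "euler f * G + euler G = 0"
    using assms(2) by auto
  ultimately show ?thesis
    by (simp add: is_exp_def euler_minus eq_neg_iff_add_eq_0 add.commute)
qed

context padic_extension
begin

section \<open>Power series with integral coefficients\<close>

definition integral_fps :: "'a fps \<Rightarrow> bool" where
  "integral_fps f \<longleftrightarrow> (\<forall>n. nrm (fps_nth f n) \<le> 1)"

lemma integral_fpsD: "integral_fps f \<Longrightarrow> nrm (fps_nth f n) \<le> 1"
  by (simp add: integral_fps_def)

lemma integral_fps_1 [simp]: "integral_fps 1"
  by (simp add: integral_fps_def)

lemma integral_fps_0 [simp]: "integral_fps 0"
  by (simp add: integral_fps_def)

lemma integral_fps_add: "integral_fps f \<Longrightarrow> integral_fps g \<Longrightarrow> integral_fps (f + g)"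
  by (simp add: integral_fps_def nrm_add_le)

lemma integral_fps_sum: "(\<And>i. i \<in> A \<Longrightarrow> integral_fps (f i)) \<Longrightarrow> integral_fps (sum f A)"
  by (induction A rule: infinite_finite_induct) (auto intro: integral_fps_add)

lemma integral_fps_mult: "integral_fps f \<Longrightarrow> integral_fps g \<Longrightarrow> integral_fps (f * g)"
  unfolding integral_fps_def fps_mult_nth by (auto intro!: nrm_sum_le nrm_mult_le_one)

lemma integral_fps_power: "integral_fps f \<Longrightarrow> integral_fps (f ^ n)"
  by (induction n) (auto intro: integral_fps_mult)

lemma integral_fps_const: "nrm c \<le> 1 \<Longrightarrow> integral_fps (fps_const c)"
  by (simp add: integral_fps_def)

lemma nrm_mult_nth_le:
  assumes "\<And>i. i \<le> n \<Longrightarrow> nrm (fps_nth f i) \<le> B" and "\<And>i. i \<le> n \<Longrightarrow> nrm (fps_nth g i) \<le> 1" and "0 \<le> B"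
  shows "nrm (fps_nth (f * g) n) \<le> B"
  unfolding fps_mult_nth
  by (rule nrm_sum_le) (use assms nrm_mult_le[where B = 1] in \<open>fastforce+\<close>)

lemma nrm_inverse_nth_le:
  assumes "fps_nth f 0 = 1" and "f * g = 1" and "\<And>i. i \<le> m \<Longrightarrow> nrm (fps_nth f i) \<le> 1"
  shows "n \<le> m \<Longrightarrow> nrm (fps_nth g n) \<le> 1"
proof (induction n rule: less_induct)
  case (less n)
  have "fps_nth (f * g) n = fps_nth g n + (\<Sum>i=1..n. fps_nth f i * fps_nth g (n - i))"
    using assms(1) by (simp add: fps_mult_nth sum.atLeast_Suc_atMost)
  then have "fps_nth g n = fps_nth 1 n - (\<Sum>i=1..n. fps_nth f i * fps_nth g (n - i))"
    using assms(2) by simp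
  moreover have "nrm (\<Sum>i=1..n. fps_nth f i * fps_nth g (n - i)) \<le> 1"
    using less assms(3) by (intro nrm_sum_le nrm_mult_le_one) auto
  moreover have "nrm (fps_nth (1 :: 'a fps) n) \<le> 1"
    by simp
  ultimately show ?case
    using nrm_diff_le by metis
qed

lemma nrm_binomial_dvd:
  assumes "0 < i" and "i < p"
  shows "nrm (of_nat (p choose i)) \<le> 1 / real p"
  by (rule nrm_nat_dvd) (use assms prime_p in \<open>simp add: dvd_choose_prime\<close>)

lemma nrm_freshman:
  assumes "integral_fps x" and "integral_fps y"
  shows "nrm (fps_nth ((x + y) ^ p - x ^ p - y ^ p) n) \<le> 1 / real p"
proof -
  have "(x + y) ^ p = (\<Sum>i\<le>p. of_nat (p choose i) * x ^ i * y ^ (p - i))"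
    by (rule binomial_ring)
  also have "\<dots> = (\<Sum>i\<in>{0<..<p}. of_nat (p choose i) * x ^ i * y ^ (p - i)) + x ^ p + y ^ p"
  proof -
    have "{..p} = insert 0 (insert p {0<..<p})"
      using p_ge_2 by auto
    then show ?thesis
      using p_ge_2 by (simp add: algebra_simps)
  qed
  finally have eq: "(x + y) ^ p - x ^ p - y ^ p = (\<Sum>i\<in>{0<..<p}. of_nat (p choose i) * x ^ i * y ^ (p - i))"
    by simp
  show ?thesis
    unfolding eq fps_sum_nth
  proof (rule nrm_sum_le)
    fix i
    assume i: "i \<in> {0<..<p}"
    have "integral_fps (x ^ i * y ^ (p - i))"
      using assms by (intro integral_fps_mult integral_fps_power)
    then have "nrm (of_nat (p choose i) * fps_nth (x ^ i * y ^ (p - i)) n) \<le> 1 / real p * 1"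
      using i by (intro nrm_mult_le nrm_binomial_dvd integral_fpsD) auto
    then show "nrm (fps_nth (of_nat (p choose i) * x ^ i * y ^ (p - i)) n) \<le> 1 / real p"
      by (simp add: fps_of_nat_mult_nth mult.assoc)
  qed simp
qed

text \<open>The congruence f(T)^p = f(T^p) modulo p: the mixed binomial terms are divisible by p,
  and Fermat's congruence takes care of each coefficient.\<close>

lemma nrm_frobenius_lift:
  assumes "finite A" and "\<And>i. i \<in> A \<Longrightarrow> nrm (a i) \<le> 1 \<and> a i \<in> \<rat>"
  defines "f \<equiv> \<Sum>i\<in>A. fps_const (a i) * fps_X ^ i"
  shows "nrm (fps_nth (f ^ p - subst_monom (\<lambda>x. x) p 1 f) n) \<le> 1 / real p"
  using assms(1,2) unfolding f_def
proof (induction A arbitrary: n rule: finite_induct)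
  case empty
  show ?case
    using p_ge_2 by (simp add: fps_eq_iff subst_monom_nth power_0_left)
next
  case (insert j A)
  let ?x = "fps_const (a j) * fps_X ^ j :: 'a fps" and ?y = "\<Sum>i\<in>A. fps_const (a i) * fps_X ^ i :: 'a fps"
  let ?S = "subst_monom (\<lambda>x. x) p 1 :: 'a fps \<Rightarrow> 'a fps"
  have mono: "integral_fps (fps_const (a i) * fps_X ^ i)" if "i \<in> insert j A" for i
    using insert.prems[OF that] by (auto simp: integral_fps_def fps_X_power_nth)
  have "integral_fps ?x" "integral_fps ?y"
    using mono by (auto intro: integral_fps_sum)
  then have 1: "nrm (fps_nth ((?x + ?y) ^ p - ?x ^ p - ?y ^ p) n) \<le> 1 / real p"
    by (rule nrm_freshman)
  have 2: "nrm (fps_nth (?y ^ p - ?S ?y) n) \<le> 1 / real p"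
    using insert by simp
  have "fps_nth (?x ^ p) n = (if n = j * p then a j ^ p else 0)"
    by (simp add: power_mult_distrib fps_X_power_nth flip: power_mult)
  moreover have "fps_nth (?S ?x) n = (if n = j * p then a j else 0)"
    using p_ge_2 by (auto simp: subst_monom_nth fps_X_power_nth)
  ultimately have 3: "nrm (fps_nth (?x ^ p - ?S ?x) n) \<le> 1 / real p"
    using nrm_rat_power_p_diff insert.prems by simp
  have "(?x + ?y) ^ p - ?S (?x + ?y) = ((?x + ?y) ^ p - ?x ^ p - ?y ^ p) + (?y ^ p - ?S ?y) + (?x ^ p - ?S ?x)"
    by (simp add: id_map.subst_monom_add)
  then have "nrm (fps_nth ((?x + ?y) ^ p - ?S (?x + ?y)) n) \<le> 1 / real p"
    using 1 2 3 by (simp only: fps_add_nth nrm_add_le)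
  with insert.hyps show ?case
    by simp
qed

abbreviation AH :: "'a fps" where "AH \<equiv> artin_hasse p"

lemma prime_power_pos: "0 < p ^ i"
  using p_ge_2 by simp

lemma ah_log_power: "fps_nth (ah_log p) (p ^ i) = 1 / of_nat (p ^ i)"
  by (auto simp: ah_log_def)

lemma is_exp_AH: "is_exp AH (ah_log p)"
  unfolding artin_hasse_def
  by (rule is_exp_fps_exp_compose) (use p_ge_2 in \<open>auto simp: ah_log_def\<close>)

lemma AH_nth_0 [simp]: "fps_nth AH 0 = 1"
  using is_exp_AH by (rule is_exp_nth_0)

lemma AH_nth_1: "fps_nth AH 1 = 1"
  using is_exp_lowest[OF is_exp_AH, of 1] ah_log_power[of 0] by simp

lemma AH_Rats: "fps_nth AH n \<in> \<rat>"
proof (induction n rule: less_induct)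
  case (less n)
  show ?case
  proof (cases "n = 0")
    case False
    have "of_nat n * fps_nth AH n \<in> \<rat>"
      unfolding is_exp_rec[OF is_exp_AH]
      by (rule Rats_sum) (use less in \<open>auto simp: ah_log_def\<close>)
    then have "of_nat n * fps_nth AH n / of_nat n \<in> \<rat>"
      by (rule Rats_divide) simp
    with False show ?thesis
      by simp
  qed simp
qed

text \<open>The Artin-Hasse logarithm L satisfies p L(T) = p T + L(T^p); this is the exponential of
  that identity.\<close>

lemma AH_power_p: "AH ^ p = subst_monom (\<lambda>x. x) p 1 AH * fps_exp (of_nat p)"
proof (rule is_exp_unique)
  show "is_exp (AH ^ p) (of_nat p * ah_log p)"
    using is_exp_AH by (rule is_exp_power)
  have "is_exp (fps_exp (of_nat p) :: 'a fps) (fps_const (of_nat p) * fps_X)"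
    by (simp add: is_exp_def euler_def mult_ac)
  then have "is_exp (subst_monom (\<lambda>x. x) p 1 AH * fps_exp (of_nat p))
      (subst_monom (\<lambda>x. x) p 1 (ah_log p) + fps_const (of_nat p) * fps_X)"
    using p_ge_2 by (intro is_exp_add id_map.is_exp_subst_monom is_exp_AH) auto
  moreover have "subst_monom (\<lambda>x. x) p 1 (ah_log p) + fps_const (of_nat p) * fps_X = (of_nat p * ah_log p :: 'a fps)"
  proof (rule fps_ext)
    fix n
    consider (one) "n = 1" | (step) i where "n = p * p ^ i" | (no) "\<nexists>i. n = p ^ i"
      by (metis power_0 power_Suc not0_implies_Suc)
    then show "fps_nth (subst_monom (\<lambda>x. x) p 1 (ah_log p) + fps_const (of_nat p) * fps_X) n
        = fps_nth (of_nat p * ah_log p :: 'a fps) n"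
    proof cases
      case one
      then show ?thesis
        using p_ge_2 ah_log_power[of 0] by (auto simp: subst_monom_nth fps_of_nat_mult_nth)
    next
      case step
      have "\<not> p * p ^ i \<le> Suc 0"
        using mult_le_mono[OF p_ge_2, of 1 "p ^ i"] p_ge_2 by simp
      moreover have "fps_nth (ah_log p :: 'a fps) n = 1 / of_nat n"
        using ah_log_power[of "Suc i"] by (simp add: step)
      ultimately show ?thesis
        using p_ge_2 by (auto simp: step subst_monom_nth fps_of_nat_mult_nth ah_log_power)
    next
      case no
      have "n \<noteq> 1"
        using no by (metis power_0)
      moreover have "\<nexists>i. n div p = p ^ i" if "p dvd n"
        using no that p_ge_2 by (metis dvd_mult_div_cancel power_Suc)
      ultimately show ?thesis
        using no by (auto simp: subst_monom_nth fps_of_nat_mult_nth ah_log_def)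
    qed
  qed
  ultimately show "is_exp (subst_monom (\<lambda>x. x) p 1 AH * fps_exp (of_nat p)) (of_nat p * ah_log p)"
    by simp
qed

lemma nrm_exp_p_nth:
  assumes "n > 0"
  shows "nrm (fps_nth (fps_exp (of_nat p)) n) \<le> 1 / real p"
proof -
  have "nrm (fps_nth (fps_exp (of_nat p)) n) = (1 / real p) ^ n / nrm (fact n)"
    by (simp add: nrm_divide nrm_power nrm_p)
  also have "\<dots> \<le> (1 / real p) ^ n / (1 / real p) ^ (n - 1)"
    using nrm_fact_ge[of n] assms p_ge_2 nrm_pos[of "fact n"] by (intro divide_left_mono) auto
  also have "\<dots> = 1 / real p"
    using assms p_ge_2 by (cases n) auto
  finally show ?thesis .
qed

text \<open>Dwork's argument. In coefficient n of \<open>AH_power_p\<close> the unknown a_n enters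
  only as p a_n on the left. The rest involves earlier coefficients and cancels modulo p, by the
  Frobenius congruence and the divisibility of exp(pX) - 1 by p. Hence p divides p a_n.\<close>

lemma integral_AH: "integral_fps AH"
proof -
  have "nrm (fps_nth AH n) \<le> 1" for n
  proof (induction n rule: less_induct)
    case (less n)
    show ?case
    proof (cases "n = 0")
      case False
      define f where "f = (\<Sum>i<n. fps_const (fps_nth AH i) * fps_X ^ i)"
      define S where "S = (subst_monom (\<lambda>x. x) p 1 :: 'a fps \<Rightarrow> 'a fps)"
      have f_nth: "fps_nth f i = (if i < n then fps_nth AH i else 0)" for i
        by (simp add: f_def fps_sum_nth fps_X_power_nth if_distrib cong: if_cong)
      obtain h where h: "AH = f + fps_X ^ n * h" and h0: "fps_nth h 0 = fps_nth AH n"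
      proof
        show "AH = f + fps_X ^ n * Abs_fps (\<lambda>i. fps_nth AH (n + i))"
          by (rule fps_ext) (simp add: f_nth fps_X_power_mult_nth)
      qed simp
      have f0: "fps_nth f 0 = 1"
        using False by (simp add: f_nth)
      \<comment> \<open>Modulo T^(n+1) one has AH = f + a_n T^n with f(0) = 1, so only the linear
        term q a_n of the q-th power is seen.\<close>
      have lead: "fps_nth (AH ^ q) n = fps_nth (f ^ q) n + of_nat q * fps_nth AH n" for q
      proof (induction q)
        case (Suc q)
        have "AH ^ Suc q = f * AH ^ q + fps_X ^ n * (h * AH ^ q)"
          using h by (metis (no_types, opaque_lifting) distrib_right mult.assoc power_Suc)
        then have 1: "fps_nth (AH ^ Suc q) n = fps_nth (f * AH ^ q) n + fps_nth AH n"
          by (simp add: fps_X_power_mult_nth h0 fps_nth_power_0)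
        have low: "fps_nth (AH ^ q) i = fps_nth (f ^ q) i" if "i < n" for i
        proof -
          have "fps_nth (AH ^ r) i = fps_nth (f ^ r) i" if "i < n" for r i
            using that
            by (induction r arbitrary: i) (auto simp: fps_mult_nth f_nth intro!: sum.cong)
          with that show ?thesis
            by blast
        qed
        have "fps_nth (f * AH ^ q) n = fps_nth (f * f ^ q) n + of_nat q * fps_nth AH n"
          using low Suc f0 by (simp add: fps_mult_nth sum.atLeast_Suc_atMost)
        with 1 show ?case
          by (simp add: algebra_simps)
      qed simp
      have Sn: "fps_nth (S AH) i = fps_nth (S f) i" if "i \<le> n" for i
      proof -
        have "i div p < n"
          using False that p_ge_2 div_less_dividend[of p i] by (cases "i = 0") (linarith | simp)+
        then show ?thesis
          by (simp add: S_def subst_monom_nth f_nth)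
      qed
      have "fps_nth (AH ^ p) n = fps_nth (S f) n + (\<Sum>i=0..<n. fps_nth (S f) i * fps_nth (fps_exp (of_nat p)) (n - i))"
      proof -
        have "fps_nth (AH ^ p) n = (\<Sum>i=0..n. fps_nth (S f) i * fps_nth (fps_exp (of_nat p)) (n - i))"
          unfolding AH_power_p S_def[symmetric] fps_mult_nth using Sn by (intro sum.cong) auto
        then show ?thesis
          by (simp add: sum.last_plus add.commute)
      qed
      then have eq: "of_nat p * fps_nth AH n = (\<Sum>i=0..<n. fps_nth (S f) i * fps_nth (fps_exp (of_nat p)) (n - i))
          - fps_nth (f ^ p - S f) n"
        using lead[of p] by (simp add: algebra_simps)
      have "nrm (\<Sum>i=0..<n. fps_nth (S f) i * fps_nth (fps_exp (of_nat p)) (n - i)) \<le> 1 / real p"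
      proof (rule nrm_sum_le)
        fix i
        assume i: "i \<in> {0..<n}"
        have "nrm (fps_nth (S f) i) \<le> 1"
          using less.IH by (auto simp: S_def subst_monom_nth f_nth)
        then have "nrm (fps_nth (S f) i * fps_nth (fps_exp (of_nat p)) (n - i)) \<le> 1 * (1 / real p)"
          using i by (intro nrm_mult_le nrm_exp_p_nth) auto
        then show "nrm (fps_nth (S f) i * fps_nth (fps_exp (of_nat p)) (n - i)) \<le> 1 / real p"
          by simp
      qed simp
      moreover have "nrm (fps_nth (f ^ p - S f) n) \<le> 1 / real p"
        unfolding f_def S_def using less.IH AH_Rats by (intro nrm_frobenius_lift) auto
      ultimately have "nrm (of_nat p * fps_nth AH n) \<le> 1 / real p"
        unfolding eq by (rule nrm_diff_le)
      then show ?thesis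
        using p_ge_2 by (simp add: nrm_mult nrm_p field_simps)
    qed simp
  qed
  then show ?thesis
    by (simp add: integral_fps_def)
qed

lemma AH_inverse:
  obtains AHi where "is_exp AHi (- ah_log p)" and "AH * AHi = 1" and "integral_fps AHi"
proof
  show inv: "AH * inverse AH = 1"
    by (simp add: inverse_mult_eq_1')
  show "is_exp (inverse AH) (- ah_log p)"
    by (rule is_exp_inverse[OF is_exp_AH inv])
  show "integral_fps (inverse AH)"
    unfolding integral_fps_def
    using nrm_inverse_nth_le[OF AH_nth_0 inv integral_fpsD[OF integral_AH] order_refl] by blast
qed

text \<open>
  The logarithm of \<open>E(zX) / E(X)\<close>, where \<open>E\<close> is the Artin-Hasse exponential. It is a polynomial if
  \<open>z\<close> is a \<open>p\<close>-power root of unity.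
\<close>
definition robba_log :: "'a \<Rightarrow> 'a fps" where
  "robba_log z = Abs_fps (\<lambda>n. (z ^ n - 1) * fps_nth (ah_log p) n)"

lemma robba_log_power: "fps_nth (robba_log z) (p ^ i) = (z ^ p ^ i - 1) / of_nat (p ^ i)"
  by (simp add: robba_log_def ah_log_power)

lemma robba_log_eq_0: "\<nexists>i. n = p ^ i \<Longrightarrow> fps_nth (robba_log z) n = 0"
  by (simp add: robba_log_def ah_log_def)

text \<open>F is E(zX) / E(X) and G is its inverse. Each z^n - 1 is a multiple of z - 1, so E(zX)
  and E(X) agree modulo z - 1, and division by an integral series with constant term 1 keeps the
  congruence.\<close>

lemma robba_exp_near_one:
  assumes "nrm z = 1"
  obtains F G where "is_exp F (robba_log z)" and "is_exp G (- robba_log z)"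
    and "\<And>n. n > 0 \<Longrightarrow> nrm (fps_nth F n) \<le> nrm (z - 1)"
    and "\<And>n. n > 0 \<Longrightarrow> nrm (fps_nth G n) \<le> nrm (z - 1)"
proof -
  define A where "A = subst_monom (\<lambda>x. x) 1 z AH"
  have A_nth: "fps_nth A n = fps_nth AH n * z ^ n" for n
    by (simp add: A_def subst_monom_nth)
  have expA: "is_exp A (subst_monom (\<lambda>x. x) 1 z (ah_log p))"
    unfolding A_def by (rule id_map.is_exp_subst_monom[OF is_exp_AH]) simp
  have pow: "nrm (z ^ n - 1) \<le> nrm (z - 1)" for n
  proof -
    have "nrm (\<Sum>i<n. z ^ i) \<le> 1"
      using assms by (intro nrm_sum_le) (auto simp: nrm_power)
    then have "nrm ((z - 1) * (\<Sum>i<n. z ^ i)) \<le> nrm (z - 1) * 1"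
      by (intro nrm_mult_le) auto
    then show ?thesis
      by (simp add: power_diff_1_eq)
  qed
  define AHi Ai where "AHi = inverse AH" and "Ai = inverse A"
  have inv: "AH * AHi = 1" "A * Ai = 1"
    using A_nth[of 0] by (simp_all add: AHi_def Ai_def inverse_mult_eq_1')
  have rl: "robba_log z = subst_monom (\<lambda>x. x) 1 z (ah_log p) + (- ah_log p)"
    by (simp add: fps_eq_iff robba_log_def subst_monom_nth algebra_simps)
  have intAHi: "nrm (fps_nth AHi n) \<le> 1" for n
    by (rule nrm_inverse_nth_le[OF _ inv(1)]) (use integral_AH in \<open>auto simp: integral_fps_def\<close>)
  have intAi: "nrm (fps_nth Ai n) \<le> 1" for n
    by (rule nrm_inverse_nth_le[OF _ inv(2)])
      (use integral_AH assms in \<open>auto simp: integral_fps_def A_nth nrm_mult nrm_power\<close>)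
  have diff: "nrm (fps_nth (A - AH) n) \<le> nrm (z - 1)" for n
  proof -
    have "nrm ((z ^ n - 1) * fps_nth AH n) \<le> nrm (z - 1) * 1"
      by (intro nrm_mult_le pow integral_fpsD integral_AH)
    then show ?thesis
      by (simp add: A_nth algebra_simps)
  qed
  show ?thesis
  proof
    show "is_exp (A * AHi) (robba_log z)"
      unfolding rl by (intro is_exp_add expA is_exp_inverse[OF is_exp_AH] inv)
    have "is_exp (AH * Ai) (ah_log p + (- subst_monom (\<lambda>x. x) 1 z (ah_log p)))"
      by (intro is_exp_add is_exp_AH is_exp_inverse[OF expA] inv)
    then show "is_exp (AH * Ai) (- robba_log z)"
      by (simp add: rl)
    show "nrm (fps_nth (A * AHi) n) \<le> nrm (z - 1)" if "n > 0" for n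
    proof -
      have "A * AHi = (A - AH) * AHi + 1"
        using inv by (simp add: algebra_simps)
      then have "fps_nth (A * AHi) n = fps_nth ((A - AH) * AHi) n"
        using that by simp
      moreover have "nrm (fps_nth ((A - AH) * AHi) n) \<le> nrm (z - 1)"
        by (intro nrm_mult_nth_le diff intAHi nrm_nonneg)
      ultimately show ?thesis
        by simp
    qed
    show "nrm (fps_nth (AH * Ai) n) \<le> nrm (z - 1)" if "n > 0" for n
    proof -
      have "AH * Ai = 1 - (A - AH) * Ai"
        using inv by (simp add: algebra_simps)
      then have "fps_nth (AH * Ai) n = - fps_nth ((A - AH) * Ai) n"
        using that by simp
      moreover have "nrm (fps_nth ((A - AH) * Ai) n) \<le> nrm (z - 1)"
        by (intro nrm_mult_nth_le diff intAi nrm_nonneg)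
      ultimately show ?thesis
        by simp
    qed
  qed
qed

end

section \<open>Witt vectors\<close>

text \<open>The Witt vector with ghost components \<open>p\<^sup>m g(m)\<close>, where \<open>\<kappa>\<close> maps the field of scalars into the ring.\<close>
function witt :: "('a::field_char_0 \<Rightarrow> 'r::comm_ring_1) \<Rightarrow> nat \<Rightarrow> (nat \<Rightarrow> 'r) \<Rightarrow> nat \<Rightarrow> 'r" where
  "witt \<kappa> p g m = g m - (\<Sum>t<m. \<kappa> (1 / of_nat (p ^ (m - t))) * witt \<kappa> p g t ^ p ^ (m - t))"
  by auto
termination
  by (relation "Wellfounded.measure (\<lambda>(_, _, _, m). m)") auto

declare witt.simps [simp del]

lemma (in ring_map) witt_ghost:
  "g m = (\<Sum>t\<le>m. \<kappa> (1 / of_nat (p ^ (m - t))) * witt \<kappa> p g t ^ p ^ (m - t))"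
  by (simp add: lessThan_Suc_atMost[symmetric] witt.simps[of \<kappa> p g m] map_one)

context padic_extension
begin

text \<open>The shape of the logarithm of an Artin-Hasse product. Such series are equal once their
  coefficients at the powers of p agree, so identities of logarithms reduce to identities of ghost
  components.\<close>

definition p_supported :: "'r::zero fps \<Rightarrow> bool" where
  "p_supported f \<longleftrightarrow> (\<forall>n. fps_nth f n \<noteq> 0 \<longrightarrow> (\<exists>i. n = p ^ i))"

lemma p_supported_eqI:
  assumes "p_supported f" and "p_supported g" and "\<And>s. fps_nth f (p ^ s) = fps_nth g (p ^ s)"
  shows "f = g"
  using assms unfolding p_supported_def fps_eq_iff by metis

lemma p_supported_ah_log: "p_supported (ah_log p)"
  by (auto simp: p_supported_def ah_log_def)

lemma p_supported_robba_log: "p_supported (robba_log z)"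
  using robba_log_eq_0 by (auto simp: p_supported_def)

lemma p_supported_zero: "p_supported 0"
  by (simp add: p_supported_def)

lemma p_supported_minus: "p_supported f \<Longrightarrow> p_supported (- f :: 'r::comm_ring_1 fps)"
  by (auto simp: p_supported_def)

lemma p_supported_add: "p_supported f \<Longrightarrow> p_supported g \<Longrightarrow> p_supported (f + g :: 'r::comm_ring_1 fps)"
  unfolding p_supported_def by (metis add.right_neutral add.left_neutral fps_add_nth)

lemma p_supported_sum: "(\<And>i. i \<in> A \<Longrightarrow> p_supported (f i)) \<Longrightarrow> p_supported (sum f A :: 'r::comm_ring_1 fps)"
  by (induction A rule: infinite_finite_induct) (auto intro: p_supported_add p_supported_zero)

lemma p_supported_subst_monom:
  assumes "ring_map \<kappa>" and "p_supported f"
  shows "p_supported (subst_monom \<kappa> (p ^ t) c f)"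
  unfolding p_supported_def
proof (intro allI impI)
  fix n
  assume n: "fps_nth (subst_monom \<kappa> (p ^ t) c f) n \<noteq> 0"
  then have dvd: "p ^ t dvd n" and "fps_nth f (n div p ^ t) \<noteq> 0"
    using ring_map.map_zero[OF assms(1)] by (auto simp: subst_monom_nth split: if_splits)
  then obtain i where "n div p ^ t = p ^ i"
    using assms(2) by (auto simp: p_supported_def)
  then have "n = p ^ (t + i)"
    using dvd by (metis dvd_mult_div_cancel power_add)
  then show "\<exists>i. n = p ^ i"
    by blast
qed

lemma subst_monom_nth_power:
  "fps_nth (subst_monom \<kappa> (p ^ t) c f) (p ^ s)
    = (if t \<le> s then \<kappa> (fps_nth f (p ^ (s - t))) * c ^ p ^ (s - t) else 0)"
proof (cases "t \<le> s")
  case True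
  then have "p ^ s div p ^ t = p ^ (s - t)"
    using p_ge_2 by (simp add: power_diff)
  with True show ?thesis
    by (simp add: subst_monom_nth le_imp_power_dvd)
next
  case False
  then have "\<not> p ^ t dvd p ^ s"
    using p_ge_2 power_dvd_imp_le[of p t s] by auto
  with False show ?thesis
    by (simp add: subst_monom_nth)
qed

definition integral_fps2 :: "'a fps fps \<Rightarrow> bool" where
  "integral_fps2 F \<longleftrightarrow> (\<forall>w. integral_fps (fps_nth F w))"

lemma integral_fps2_mult: "integral_fps2 F \<Longrightarrow> integral_fps2 G \<Longrightarrow> integral_fps2 (F * G)"
  by (auto simp: integral_fps2_def fps_mult_nth intro!: integral_fps_sum integral_fps_mult)

lemma integral_fps2_one: "integral_fps2 1"
  by (simp add: integral_fps2_def fps_one_nth)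

lemma integral_fps2_prod: "(\<And>i. i \<in> A \<Longrightarrow> integral_fps2 (F i)) \<Longrightarrow> integral_fps2 (prod F A)"
  by (induction A rule: infinite_finite_induct)
    (auto intro: integral_fps2_mult integral_fps2_one)

lemma integral_fps2_subst:
  assumes "integral_fps f" and "integral_fps c"
  shows "integral_fps2 (subst_monom fps_const W c f)"
  using assms
  by (auto simp: integral_fps2_def subst_monom_nth integral_fpsD
      intro!: integral_fps_mult integral_fps_power integral_fps_const)

text \<open>
  The components of the Witt vector \<open>[x] - [1]\<close>: they are read off the integral series
  \<open>E(xT) / E(T) = \<Prod> E(\<tau>\<^sub>t T\<^bsup>p\<^sup>t\<^esup>)\<close>.
\<close>
lemma integral_witt_diff_one:
  fixes x :: "'a fps"
  assumes x: "integral_fps x" and x0: "fps_nth x 0 = 1"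
  defines "\<tau> \<equiv> witt fps_const p (\<lambda>m. fps_const (1 / of_nat (p ^ m)) * (x ^ p ^ m - 1))"
  shows "integral_fps (\<tau> m)" and "fps_nth (\<tau> m) 0 = 0"
proof -
  obtain AHi where AHi: "is_exp AHi (- ah_log p)" "integral_fps AHi"
    using AH_inverse by blast
  have ghost: "fps_const (1 / of_nat (p ^ m)) * (x ^ p ^ m - 1)
      = (\<Sum>t\<le>m. fps_const (1 / of_nat (p ^ (m - t))) * \<tau> t ^ p ^ (m - t))" for m
    unfolding \<tau>_def by (rule const_map.witt_ghost)
  show "integral_fps (\<tau> m)"
  proof (induction m rule: less_induct)
    case (less m)
    \<comment> \<open>Dividing E(xT) / E(T) by the factors found so far leaves a series whose
      logarithm \<open>f\<close> begins with \<open>\<tau> m\<close> at T^(p^m). By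
      \<open>is_exp_lowest\<close>, \<open>\<tau> m\<close> is then a coefficient of a product of
      integral series.\<close>
    define F where "F = subst_monom fps_const 1 x AH * subst_monom fps_const 1 1 AHi
      * (\<Prod>t<m. subst_monom fps_const (p ^ t) (\<tau> t) AHi)"
    define f where "f = subst_monom fps_const 1 x (ah_log p) + subst_monom fps_const 1 1 (- ah_log p)
      + (\<Sum>t<m. subst_monom fps_const (p ^ t) (\<tau> t) (- ah_log p))"
    have "is_exp F f"
      unfolding F_def f_def
      by (intro is_exp_add is_exp_sum const_map.is_exp_subst_monom is_exp_AH AHi) (use p_ge_2 in auto)
    have "p_supported (subst_monom fps_const 1 y g)" if "p_supported g" for y :: "'a fps" and g
      using p_supported_subst_monom[OF ring_map_const that, of 0] by (simp only: power_0)
    then have supp: "p_supported f"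
      unfolding f_def
      by (intro p_supported_add p_supported_sum p_supported_subst_monom ring_map_const
          p_supported_minus p_supported_ah_log) (simp_all only: p_supported_ah_log p_supported_minus)
    have f_nth: "fps_nth f (p ^ s) = (if s < m then 0 else \<tau> m)" if "s \<le> m" for s
    proof -
      have "fps_nth f (p ^ s) = fps_const (1 / of_nat (p ^ s)) * (x ^ p ^ s - 1)
          - (\<Sum>t<m. if t \<le> s then fps_const (1 / of_nat (p ^ (s - t))) * \<tau> t ^ p ^ (s - t) else 0)"
        by (simp add: f_def const_map.subst_monom_minus fps_sum_nth subst_monom_nth_power sum_negf
            ah_log_power algebra_simps if_distrib[of uminus] cong: if_cong)
          (simp add: subst_monom_nth ah_log_power algebra_simps)
      also have "(\<Sum>t<m. if t \<le> s then fps_const (1 / of_nat (p ^ (s - t))) * \<tau> t ^ p ^ (s - t) else 0)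
          = (\<Sum>t\<in>{..<m} \<inter> {..s}. fps_const (1 / of_nat (p ^ (s - t))) * \<tau> t ^ p ^ (s - t))"
        by (simp add: sum.If_cases Int_def)
      also have "{..<m} \<inter> {..s} = (if s < m then {..s} else {..<m})"
        using that by auto
      also have "fps_const (1 / of_nat (p ^ s)) * (x ^ p ^ s - 1)
          - (\<Sum>t\<in>(if s < m then {..s} else {..<m}). fps_const (1 / of_nat (p ^ (s - t))) * \<tau> t ^ p ^ (s - t))
          = (if s < m then 0 else \<tau> m)"
        using that unfolding ghost[of s] by (auto simp: lessThan_Suc_atMost[symmetric])
      finally show ?thesis .
    qed
    have "fps_nth F (p ^ m) = fps_nth f (p ^ m)"
    proof (rule is_exp_lowest[OF \<open>is_exp F f\<close>])
      fix i
      assume "0 < i" "i < p ^ m"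
      then show "fps_nth f i = 0"
        using supp f_nth p_ge_2 by (metis less_imp_le p_supported_def power_less_imp_less_exp
            power_strict_increasing_iff less_le_trans one_less_numeral_iff semiring_norm(76))
    qed (use p_ge_2 in simp)
    then have "\<tau> m = fps_nth F (p ^ m)"
      using f_nth[of m] by simp
    moreover have "integral_fps2 F"
      unfolding F_def using less.IH
      by (intro integral_fps2_mult integral_fps2_prod integral_fps2_subst x AHi integral_AH) auto
    ultimately show ?case
      by (simp add: integral_fps2_def)
  qed
  show "fps_nth (\<tau> m) 0 = 0"
  proof (induction m rule: less_induct)
    case (less m)
    have "fps_nth (\<tau> m) 0 = (1 / of_nat (p ^ m)) * (fps_nth x 0 ^ p ^ m - 1)
        - (\<Sum>t<m. (1 / of_nat (p ^ (m - t))) * fps_nth (\<tau> t) 0 ^ p ^ (m - t))"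
      unfolding \<tau>_def by (subst witt.simps) (simp add: fps_sum_nth fps_nth_power_0)
    also have "\<dots> = 0"
      using less p_ge_2 by (simp add: x0 power_0_left)
    finally show ?case .
  qed
qed

section \<open>The twist by a soluble exponential\<close>

text \<open>The outer variable is \<open>T\<close>, the inner one is \<open>v\<close>, where \<open>T + y = T (1 + v)\<close>.\<close>
definition weighted :: "nat \<Rightarrow> real \<Rightarrow> 'a fps fps \<Rightarrow> bool" where
  "weighted k c F \<longleftrightarrow> (\<forall>w b. b \<le> k \<longrightarrow> nrm (fps_nth (fps_nth F w) b) \<le> c ^ w)"

lemma weighted_mult:
  assumes "weighted k c F" and "weighted k c G" and "0 \<le> c"
  shows "weighted k c (F * G)"
  unfolding weighted_def
proof (intro allI impI)
  fix w b
  assume b: "b \<le> k"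
  have "nrm (fps_nth (fps_nth F i * fps_nth G (w - i)) b) \<le> c ^ w" if "i \<le> w" for i
    unfolding fps_mult_nth[of "fps_nth F i"]
  proof (rule nrm_sum_le)
    fix j
    assume "j \<in> {0..b}"
    then have "nrm (fps_nth (fps_nth F i) j * fps_nth (fps_nth G (w - i)) (b - j)) \<le> c ^ i * c ^ (w - i)"
      using assms b by (intro nrm_mult_le) (auto simp: weighted_def)
    then show "nrm (fps_nth (fps_nth F i) j * fps_nth (fps_nth G (w - i)) (b - j)) \<le> c ^ w"
      using that by (simp flip: power_add)
  qed (use assms in simp)
  then show "nrm (fps_nth (fps_nth (F * G) w) b) \<le> c ^ w"
    unfolding fps_mult_nth[of F] fps_sum_nth using assms by (intro nrm_sum_le) auto
qed

lemma weighted_one: "0 \<le> c \<Longrightarrow> weighted k c 1"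
  by (auto simp: weighted_def fps_one_nth)

lemma weighted_prod:
  assumes "\<And>i. i \<in> A \<Longrightarrow> weighted k c (F i)" and "0 \<le> c"
  shows "weighted k c (prod F A)"
  using assms by (induction A rule: infinite_finite_induct) (auto intro: weighted_mult weighted_one)

lemma fps_power_nth_below:
  assumes "fps_nth f 0 = (0::'a)"
  shows "b < m \<Longrightarrow> fps_nth (f ^ m) b = 0"
proof (induction m arbitrary: b)
  case (Suc m)
  have "fps_nth f i * fps_nth (f ^ m) (b - i) = 0" if "i \<le> b" for i
    using that Suc assms by (cases "i = 0") auto
  then show ?case
    unfolding power_Suc fps_mult_nth by (intro sum.neutral) auto
qed simp

text \<open>As a has no constant term, a^m contributes to v^b only when m <= b <= k. The exponents
  of T that occur are therefore at most W k, and the single bound c^(k W) on the coefficients of G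
  is below c^(W m) for all of them.\<close>

lemma weighted_subst:
  assumes "\<And>i. i > 0 \<Longrightarrow> nrm (fps_nth G i) \<le> c ^ (k * W)" and "fps_nth G 0 = 1"
    and "integral_fps a" and "fps_nth a 0 = 0" and "0 \<le> c" and "c \<le> 1" and "W > 0"
  shows "weighted k c (subst_monom fps_const W a G)"
  unfolding weighted_def
proof (intro allI impI)
  fix w b
  assume b: "b \<le> k"
  show "nrm (fps_nth (fps_nth (subst_monom fps_const W a G) w) b) \<le> c ^ w"
  proof (cases "W dvd w")
    case True
    then obtain m where w: "w = W * m"
      by blast
    consider "m = 0" | "m > b" | "0 < m" "m \<le> b"
      by linarith
    then show ?thesis
    proof cases
      case 1
      then show ?thesis
        using assms by (simp add: w)
    next
      case 2
      then show ?thesis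
        using assms fps_power_nth_below[of a b m] by (simp add: w subst_monom_nth)
    next
      case 3
      have "nrm (fps_nth G m * fps_nth (a ^ m) b) \<le> c ^ (k * W) * 1"
        using 3 assms by (intro nrm_mult_le integral_fpsD integral_fps_power) auto
      also have "\<dots> \<le> c ^ w"
        using 3 b assms by (auto simp: w intro!: power_decreasing)
      finally show ?thesis
        using assms by (simp add: w subst_monom_nth)
    qed
  qed (use assms in \<open>simp add: subst_monom_nth\<close>)
qed

end

text \<open>The order of z is exactly p^(n+1). In this form the assumptions pass to z^(p^j), with n
  - j in place of n, as needed when the factors before j are split off.\<close>

locale padic_root_of_unity = padic_extension p nrm for p and nrm :: "'a::field_char_0 \<Rightarrow> real" +
  fixes n :: nat and z :: 'a
  assumes root: "z ^ p ^ Suc n = 1" and primitive: "z ^ p ^ n \<noteq> 1"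
begin

lemma padic_root_of_unity_power:
  assumes "j \<le> n"
  shows "padic_root_of_unity p nrm (n - j) (z ^ p ^ j)"
proof unfold_locales
  have "p ^ j * p ^ Suc (n - j) = p ^ Suc n" "p ^ j * p ^ (n - j) = p ^ n"
    using assms by (simp_all flip: power_add add: mult.left_commute)
  then show "(z ^ p ^ j) ^ p ^ Suc (n - j) = 1" "(z ^ p ^ j) ^ p ^ (n - j) \<noteq> 1"
    using root primitive by (metis power_mult)+
qed

text \<open>The distance from 1 of a primitive p-th root of unity, that is p^(-1/(p-1)).\<close>

definition w :: real where "w = nrm (z ^ p ^ n - 1)"

lemma nrm_z [simp]: "nrm z = 1"
proof -
  have "nrm z ^ p ^ Suc n = 1"
    unfolding nrm_power[symmetric] root by simp
  then show ?thesis
    using p_ge_2 by (metis nrm_nonneg one_le_power power_eq_1_iff prime_power_pos zero_less_iff_neq_zero power_eq_imp_eq_base power_one zero_le_one)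
qed

lemma z_power_eq_1: "m > n \<Longrightarrow> z ^ p ^ m = 1"
proof -
  assume "m > n"
  then have "p ^ m = p ^ Suc n * p ^ (m - Suc n)"
    by (simp only: power_add[symmetric]) simp
  then show ?thesis
    by (simp only: power_mult root power_one)
qed

lemma power_p_minus_1:
  "(1 + y) ^ p - 1 = (y ^ p + of_nat p * y) + (\<Sum>i\<in>{1<..<p}. of_nat (p choose i) * y ^ i)"
  for y :: 'a
proof -
  have "(1 + y) ^ p = (\<Sum>i\<le>p. of_nat (p choose i) * y ^ i)"
    using binomial_ring[of y 1 p] by (simp add: add.commute)
  moreover have "{..p} = insert 0 (insert 1 (insert p {1<..<p}))"
    using p_ge_2 by auto
  ultimately show ?thesis
    using p_ge_2 by simp
qed

lemma nrm_middle_terms: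
  assumes "nrm y \<le> 1"
  shows "nrm (\<Sum>i\<in>{1<..<p}. of_nat (p choose i) * y ^ i) \<le> 1 / real p * nrm y ^ 2"
proof (rule nrm_sum_le)
  fix i
  assume i: "i \<in> {1<..<p}"
  then have "nrm (y ^ i) \<le> nrm y ^ 2"
    unfolding nrm_power using assms by (intro power_decreasing) (auto simp: nrm_nonneg)
  then show "nrm (of_nat (p choose i) * y ^ i) \<le> 1 / real p * nrm y ^ 2"
    using i by (intro nrm_mult_le nrm_binomial_dvd) auto
qed simp

lemma nrm_z_power_diff_le_1: "nrm (z ^ m - 1) \<le> 1"
  by (intro nrm_diff_le) (auto simp: nrm_power)

lemma w_pos: "0 < w"
  unfolding w_def using primitive by (intro nrm_pos) simp

text \<open>With y = z^(p^n) - 1, the equation (1 + y)^p = 1 reads y^p = -(p y + ...), the omitted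
  terms being at most |y|^2 / p in norm. Once |y| < 1 is known, p y dominates and |y|^p = |y| /
  p.\<close>

lemma w_power: "w ^ (p - 1) = 1 / real p"
proof -
  define y where "y = z ^ p ^ n - 1"
  have w: "nrm y = w"
    by (simp add: y_def w_def)
  have "(1 + y) ^ p - 1 = 0"
    using root by (simp add: y_def mult.commute flip: power_mult)
  then have eq: "y ^ p = - (of_nat p * y + (\<Sum>i\<in>{1<..<p}. of_nat (p choose i) * y ^ i))"
    unfolding power_p_minus_1 by (simp add: algebra_simps eq_neg_iff_add_eq_0)
  have y1: "nrm y \<le> 1"
    unfolding y_def by (rule nrm_z_power_diff_le_1)
  have p_y: "nrm (of_nat p * y) = 1 / real p * nrm y"
    by (simp add: nrm_mult nrm_p)
  have sq: "nrm y ^ 2 \<le> nrm y"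
    using y1 nrm_nonneg[of y] by (simp add: power2_eq_square mult_left_le_one_le)
  have "nrm (y ^ p) \<le> 1 / real p * nrm y"
    unfolding eq nrm_minus
  proof (intro nrm_add_le)
    have "1 / real p * nrm y ^ 2 \<le> 1 / real p * nrm y"
      using sq by (intro mult_left_mono) auto
    then show "nrm (\<Sum>i\<in>{1<..<p}. of_nat (p choose i) * y ^ i) \<le> 1 / real p * nrm y"
      using nrm_middle_terms[OF y1] by linarith
  qed (use p_y in simp)
  have "nrm y \<noteq> 1"
    using \<open>nrm (y ^ p) \<le> 1 / real p * nrm y\<close> nrm_p_less_1 by (auto simp: nrm_power)
  then have "nrm y < 1"
    using y1 by simp
  then have "nrm y ^ 2 < nrm y"
    using w w_pos by (simp add: power2_eq_square)
  then have "1 / real p * nrm y ^ 2 < 1 / real p * nrm y"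
    using p_ge_2 by (intro mult_strict_left_mono) auto
  then have "nrm (y ^ p) = 1 / real p * nrm y"
    unfolding eq nrm_minus using nrm_middle_terms[OF y1] p_y by (subst nrm_add_dominant) auto
  then have "w ^ (p - 1) * w = 1 / real p * w"
    using p_ge_2 by (simp add: nrm_power w flip: power_Suc2)
  then show ?thesis
    using w_pos by (metis less_irrefl mult_right_cancel)
qed

lemma w_less_1: "w < 1"
proof (rule ccontr)
  assume "\<not> w < 1"
  then have "1 \<le> w ^ (p - 1)"
    by (intro one_le_power) simp
  then show False
    using w_power nrm_p_less_1 by simp
qed

text \<open>Downwards from m = n, with y = z^(p^m) - 1: either |y| <= w, and w < 1 suffices, or |y|
  > w = p^(-1/(p-1)), and then y^p dominates (1 + y)^p - 1, so that passing from m to m + 1 raises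
  the norm to the p-th power.\<close>

lemma nrm_z_power_diff_le: "m \<le> n \<Longrightarrow> nrm (z ^ p ^ m - 1) ^ p ^ (n - m) \<le> w"
proof (induction m rule: inc_induct)
  case (step m)
  define y where "y = z ^ p ^ m - 1"
  have y1: "nrm y \<le> 1"
    unfolding y_def by (rule nrm_z_power_diff_le_1)
  show ?case
  proof (cases "nrm y \<le> w")
    case True
    then have "nrm y ^ p ^ (n - m) \<le> w ^ p ^ (n - m)"
      by (intro power_mono nrm_nonneg)
    also have "\<dots> \<le> w"
      using w_pos w_less_1 p_ge_2 power_decreasing[of 1 "p ^ (n - m)" w] by (simp add: Suc_le_eq)
    finally show ?thesis
      by (simp add: y_def)
  next
    case False
    then have "1 / real p < nrm y ^ (p - 1)"
      unfolding w_power[symmetric] using w_pos p_ge_2 by (intro power_strict_mono) auto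
    then have "1 / real p * nrm y < nrm y ^ (p - 1) * nrm y"
      using False w_pos by (intro mult_strict_right_mono) auto
    then have big: "1 / real p * nrm y < nrm (y ^ p)"
      using p_ge_2 by (simp add: nrm_power flip: power_Suc2)
    have "nrm y ^ 2 \<le> nrm y"
      using y1 nrm_nonneg[of y] by (simp add: power2_eq_square mult_left_le_one_le)
    then have "1 / real p * nrm y ^ 2 \<le> 1 / real p * nrm y"
      by (intro mult_left_mono) auto
    then have "nrm (of_nat p * y + (\<Sum>i\<in>{1<..<p}. of_nat (p choose i) * y ^ i)) < nrm (y ^ p)"
      using big nrm_middle_terms[OF y1] by (intro nrm_add_less) (auto simp: nrm_mult nrm_p)
    then have "nrm ((1 + y) ^ p - 1) = nrm (y ^ p)"
      unfolding power_p_minus_1 add.assoc by (rule nrm_add_dominant)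
    then have "nrm (z ^ p ^ Suc m - 1) = nrm y ^ p"
      by (simp add: y_def nrm_power mult.commute flip: power_mult)
    moreover have "p ^ (n - m) = p * p ^ (n - Suc m)"
      using step.hyps by (simp flip: power_Suc add: Suc_diff_Suc)
    ultimately show ?thesis
      using step.IH by (simp add: y_def power_mult)
  qed
qed (simp add: w_def)

text \<open>The link between roots of unity and radii: c is chosen so that the p^(n-m)-th root of w,
  the bound from \<open>nrm_z_power_diff_le\<close>, equals c^(k p^m), as
  \<open>weighted_subst\<close> requires for W = p^m.\<close>

lemma nrm_z_power_diff_weight:
  assumes "0 \<le> c" and "c ^ (p ^ n * k) = w"
  shows "nrm (z ^ p ^ m - 1) \<le> c ^ (k * p ^ m)"
proof (cases "m \<le> n")
  case True
  have "p ^ n = p ^ m * p ^ (n - m)"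
    using True by (simp flip: power_add)
  then have "nrm (z ^ p ^ m - 1) ^ p ^ (n - m) \<le> (c ^ (k * p ^ m)) ^ p ^ (n - m)"
    using nrm_z_power_diff_le[OF True] assms by (simp add: mult_ac flip: power_mult)
  then show ?thesis
    using assms p_ge_2 by (subst (asm) power_mono_iff) (auto simp: nrm_nonneg)
next
  case False
  then show ?thesis
    using assms by (simp add: z_power_eq_1)
qed

text \<open>The logarithm of the product of the E(z^(p^i) X) / E(X) at X = \<mu>_i T^(p^i). Factors
  with i > n would be 1, as z^(p^i) = 1.\<close>

definition exponent :: "(nat \<Rightarrow> 'a) \<Rightarrow> 'a fps" where
  "exponent \<mu> = (\<Sum>i\<le>n. subst_monom (\<lambda>x. x) (p ^ i) (\<mu> i) (robba_log (z ^ p ^ i)))"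

text \<open>The series is e(T) / e(T(1 + v)). With \<tau> the components of [x] - [1] for x = (1 +
  v)^(p^i), factor i of e contributes the series E(X) / E(z^(p^(i+t)) X) at X = \<mu>_i^(p^t)
  \<tau>_t T^(p^(i+t)). Each is covered by \<open>weighted_subst\<close>, because \<tau>_t is
  integral and vanishes at v = 0.\<close>

lemma weighted_twist:
  assumes \<mu>: "\<And>i. i \<le> n \<Longrightarrow> nrm (\<mu> i) \<le> 1"
    and c: "0 \<le> c" "c \<le> 1" "c ^ (p ^ n * k) = w"
    and e: "is_exp e (exponent \<mu>)" and e': "is_exp e' (- exponent \<mu>)"
  shows "weighted k c (subst_monom fps_const 1 1 e * subst_monom fps_const 1 (1 + fps_X) e')"
proof -
  let ?x = "\<lambda>i. (1 + fps_X :: 'a fps) ^ p ^ i"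
  define \<tau> where "\<tau> i = witt fps_const p (\<lambda>m. fps_const (1 / of_nat (p ^ m)) * (?x i ^ p ^ m - 1))" for i
  have int_x: "integral_fps (?x i)" for i
    by (intro integral_fps_power) (auto simp: integral_fps_def fps_one_nth)
  have x0: "fps_nth (?x i) 0 = 1" for i
    by (simp add: fps_nth_power_0)
  note \<tau>_int = integral_witt_diff_one[OF int_x x0, folded \<tau>_def]
  have ghost: "fps_const (1 / of_nat (p ^ m)) * (?x i ^ p ^ m - 1)
      = (\<Sum>t\<le>m. fps_const (1 / of_nat (p ^ (m - t))) * \<tau> i t ^ p ^ (m - t))" for i m
    unfolding \<tau>_def by (rule const_map.witt_ghost)
  define a where "a i t = fps_const (\<mu> i) ^ p ^ t * \<tau> i t" for i t
  have "\<exists>G. is_exp G (- robba_log (z ^ p ^ (i + t)))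
      \<and> (\<forall>j>0. nrm (fps_nth G j) \<le> nrm (z ^ p ^ (i + t) - 1))" for i t
    by (rule robba_exp_near_one[of "z ^ p ^ (i + t)"]) (auto simp: nrm_power)
  then obtain G where G: "\<And>i t. is_exp (G i t) (- robba_log (z ^ p ^ (i + t)))"
    and G_nth: "\<And>i t j. j > 0 \<Longrightarrow> nrm (fps_nth (G i t) j) \<le> nrm (z ^ p ^ (i + t) - 1)"
    by metis
  define Z where "Z = (\<Prod>i\<le>n. \<Prod>t\<le>n. subst_monom fps_const (p ^ (i + t)) (a i t) (G i t))"
  have "weighted k c Z"
    unfolding Z_def
  proof (intro weighted_prod weighted_subst)
    fix i t j
    assume it: "i \<in> {..n}" "t \<in> {..n}"
    show "integral_fps (a i t)"
      unfolding a_def using \<mu> it by (intro integral_fps_mult integral_fps_power integral_fps_const \<tau>_int) auto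
    show "fps_nth (a i t) 0 = 0"
      by (simp add: a_def \<tau>_int)
    show "nrm (fps_nth (G i t) j) \<le> c ^ (k * p ^ (i + t))" if "j > 0"
      using G_nth[OF that, of i t] nrm_z_power_diff_weight[OF c(1,3), of "i + t"] by linarith
    show "fps_nth (G i t) 0 = 1"
      using G by (rule is_exp_nth_0)
  qed (use c p_ge_2 in auto)
  have regroup: "- fps_const u * g * (fps_const (1 / q) * (y - 1)) = fps_const (u / q) * g * (1 - y)"
    for u q :: 'a and g y :: "'a fps"
  proof -
    have "- a * g * (b * (y - 1)) = (a * b) * g * (1 - y)" for a b :: "'a fps"
      by (simp add: algebra_simps)
    from this[of "fps_const u" "fps_const (1 / q)"] show ?thesis
      by (simp only: fps_const_mult times_divide_eq_right mult_1_right)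
  qed
  \<comment> \<open>At T^(p^s) with s = i + m, both sides have the common factor (z^(p^s) - 1)
    \<mu>_i^(p^m); what remains is the identity \<open>ghost\<close> for \<tau>.\<close>
  have split: "subst_monom fps_const 1 1 (subst_monom (\<lambda>x. x) (p ^ i) (\<mu> i) (robba_log (z ^ p ^ i)))
      - subst_monom fps_const 1 (1 + fps_X) (subst_monom (\<lambda>x. x) (p ^ i) (\<mu> i) (robba_log (z ^ p ^ i)))
      = (\<Sum>t\<le>n. subst_monom fps_const (p ^ (i + t)) (a i t) (- robba_log (z ^ p ^ (i + t))))"
    (is "?A - ?B = ?C") for i
  proof (rule p_supported_eqI)
    have A: "?A = subst_monom fps_const (p ^ i) (fps_const (\<mu> i)) (robba_log (z ^ p ^ i))"
      using p_ge_2 by (subst const_map.subst_monom_subst_monom) auto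
    have B: "?B = subst_monom fps_const (p ^ i) (fps_const (\<mu> i) * ?x i) (robba_log (z ^ p ^ i))"
      using p_ge_2 by (subst const_map.subst_monom_subst_monom) auto
    show "p_supported (?A - ?B)"
      unfolding A B diff_conv_add_uminus
      by (intro p_supported_add p_supported_minus p_supported_subst_monom ring_map_const p_supported_robba_log)
    show "p_supported ?C"
      by (intro p_supported_sum p_supported_minus p_supported_subst_monom ring_map_const p_supported_robba_log)
    fix s
    show "fps_nth (?A - ?B) (p ^ s) = fps_nth ?C (p ^ s)"
    proof (cases "i \<le> s")
      case True
      define m where "m = s - i"
      have s: "s = i + m"
        using True by (simp add: m_def)
      have zs: "(z ^ p ^ i) ^ p ^ m = z ^ p ^ s"
        by (simp add: s power_add flip: power_mult)
      have "fps_nth ?C (p ^ s) = (\<Sum>t\<le>n. if i + t \<le> s then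
          - fps_const (((z ^ p ^ (i + t)) ^ p ^ (s - (i + t)) - 1) / of_nat (p ^ (s - (i + t)))) * a i t ^ p ^ (s - (i + t)) else 0)"
        by (simp add: fps_sum_nth subst_monom_nth_power robba_log_power cong: if_cong)
      also have "\<dots> = (\<Sum>t\<le>n. if t \<le> m then
          - fps_const (z ^ p ^ s - 1) * fps_const (\<mu> i) ^ p ^ m * (fps_const (1 / of_nat (p ^ (m - t))) * \<tau> i t ^ p ^ (m - t)) else 0)"
      proof (intro sum.cong refl if_cong)
        fix t
        show "i + t \<le> s \<longleftrightarrow> t \<le> m"
          by (simp add: s)
        assume "t \<le> m"
        then have st: "s - (i + t) = m - t" and mt: "p ^ m = p ^ t * p ^ (m - t)"
          and ss: "p ^ s = p ^ (i + t) * p ^ (m - t)"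
          by (auto simp: s simp flip: power_add)
        show "- fps_const (((z ^ p ^ (i + t)) ^ p ^ (s - (i + t)) - 1) / of_nat (p ^ (s - (i + t)))) * a i t ^ p ^ (s - (i + t))
            = - fps_const (z ^ p ^ s - 1) * fps_const (\<mu> i) ^ p ^ m * (fps_const (1 / of_nat (p ^ (m - t))) * \<tau> i t ^ p ^ (m - t))"
          unfolding st a_def mt ss power_mult_distrib power_mult[symmetric]
          by (simp add: mult_ac minus_divide_left flip: fps_const_mult)
      qed
      also have "\<dots> = - fps_const (z ^ p ^ s - 1) * fps_const (\<mu> i) ^ p ^ m
          * (\<Sum>t\<in>{..n} \<inter> {..m}. fps_const (1 / of_nat (p ^ (m - t))) * \<tau> i t ^ p ^ (m - t))"
        by (simp add: sum.If_cases sum_distrib_left Int_def)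
      also have "\<dots> = - fps_const (z ^ p ^ s - 1) * fps_const (\<mu> i) ^ p ^ m
          * (\<Sum>t\<le>m. fps_const (1 / of_nat (p ^ (m - t))) * \<tau> i t ^ p ^ (m - t))"
      \<comment> \<open>The factors are cut off at t = n, so for m > n the ghost sum is incomplete;
        there the factor z^(p^s) - 1 vanishes.\<close>
      proof (cases "m \<le> n")
        case True
        then have "{..n} \<inter> {..m} = {..m}"
          by auto
        then show ?thesis
          by simp
      qed (simp add: z_power_eq_1 s)
      also have "\<dots> = fps_const ((z ^ p ^ s - 1) / of_nat (p ^ m)) * fps_const (\<mu> i) ^ p ^ m * (1 - ?x i ^ p ^ m)"
        unfolding ghost[symmetric] by (rule regroup)
      also have "\<dots> = fps_nth (?A - ?B) (p ^ s)"
        unfolding A B using True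
        by (simp add: subst_monom_nth_power robba_log_power zs power_mult_distrib algebra_simps flip: m_def)
      finally show ?thesis
        by simp
    next
      case False
      then have "\<not> i + t \<le> s" for t
        by simp
      with False show ?thesis
        unfolding A B by (simp add: fps_sum_nth subst_monom_nth_power)
    qed
  qed
  have exp_Z: "is_exp Z (\<Sum>i\<le>n. \<Sum>t\<le>n. subst_monom fps_const (p ^ (i + t)) (a i t) (- robba_log (z ^ p ^ (i + t))))"
    unfolding Z_def using p_ge_2 by (intro is_exp_sum const_map.is_exp_subst_monom G) auto
  have exp_twist: "is_exp (subst_monom fps_const 1 1 e * subst_monom fps_const 1 (1 + fps_X) e')
      (subst_monom fps_const 1 1 (exponent \<mu>) + subst_monom fps_const 1 (1 + fps_X) (- exponent \<mu>))"
    by (intro is_exp_add const_map.is_exp_subst_monom e e') auto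
  have log_eq: "subst_monom fps_const 1 1 (exponent \<mu>) + subst_monom fps_const 1 (1 + fps_X) (- exponent \<mu>)
      = (\<Sum>i\<le>n. \<Sum>t\<le>n. subst_monom fps_const (p ^ (i + t)) (a i t) (- robba_log (z ^ p ^ (i + t))))"
  proof -
    have "subst_monom fps_const 1 1 (exponent \<mu>) + subst_monom fps_const 1 (1 + fps_X) (- exponent \<mu>)
        = subst_monom fps_const 1 1 (exponent \<mu>) - subst_monom fps_const 1 (1 + fps_X) (exponent \<mu>)"
      unfolding const_map.subst_monom_minus by (rule diff_conv_add_uminus[symmetric])
    also have "\<dots> = (\<Sum>i\<le>n. subst_monom fps_const 1 1 (subst_monom (\<lambda>x. x) (p ^ i) (\<mu> i) (robba_log (z ^ p ^ i)))
      - subst_monom fps_const 1 (1 + fps_X) (subst_monom (\<lambda>x. x) (p ^ i) (\<mu> i) (robba_log (z ^ p ^ i))))"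
      unfolding exponent_def const_map.subst_monom_sum by (rule sum_subtractf[symmetric])
    finally show ?thesis
      unfolding split .
  qed
  have "subst_monom fps_const 1 1 e * subst_monom fps_const 1 (1 + fps_X) e' = Z"
    by (rule is_exp_unique[OF exp_twist]) (subst log_eq, rule exp_Z)
  with \<open>weighted k c Z\<close> show ?thesis
    by simp
qed

end

section \<open>Divided powers of the differential operator\<close>

text \<open>The b-th iterate of d/dT over b!. Written with binomial coefficients, it visibly
  preserves integrality.\<close>

definition hasse_deriv :: "nat \<Rightarrow> 'r::comm_ring_1 fps \<Rightarrow> 'r fps" where
  "hasse_deriv b f = Abs_fps (\<lambda>n. of_nat ((n + b) choose b) * fps_nth f (n + b))"

lemma hasse_deriv_nth: "fps_nth (hasse_deriv b f) n = of_nat ((n + b) choose b) * fps_nth f (n + b)"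
  by (simp add: hasse_deriv_def)

lemma hasse_deriv_0 [simp]: "hasse_deriv 0 f = f"
  by (simp add: fps_eq_iff hasse_deriv_nth)

lemma hasse_deriv_Suc: "of_nat (Suc b) * hasse_deriv (Suc b) f = fps_deriv (hasse_deriv b f)"
proof (rule fps_ext)
  fix n
  have "Suc b * ((n + Suc b) choose Suc b) = Suc (n + b) * ((n + b) choose b)"
    using Suc_times_binomial[of b "n + b"] by simp
  moreover have "Suc n * ((Suc n + b) choose b) = Suc (n + b) * ((n + b) choose b)"
    using Suc_times_binomial[of n "n + b"] binomial_symmetric[of b "Suc n + b"]
      binomial_symmetric[of b "n + b"] by simp
  ultimately have "of_nat (Suc b) * of_nat ((n + Suc b) choose Suc b)
      = (of_nat (Suc n) * of_nat ((Suc n + b) choose b) :: 'a)"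
    by (metis of_nat_mult)
  then show "fps_nth (of_nat (Suc b) * hasse_deriv (Suc b) f) n = fps_nth (fps_deriv (hasse_deriv b f)) n"
    by (simp only: fps_of_nat_mult_nth hasse_deriv_nth fps_deriv_nth mult.assoc[symmetric])
      (simp add: mult.assoc)
qed

text \<open>Leibniz rule for divided powers. The induction multiplies by b + 1 and splits b + 1 = a
  + (b + 1 - a); the factor is cancelled at the end.\<close>

lemma hasse_deriv_mult:
  fixes f g :: "'r::{idom, semiring_char_0} fps"
  shows "hasse_deriv b (f * g) = (\<Sum>a\<le>b. hasse_deriv a f * hasse_deriv (b - a) g)"
proof (induction b)
  case (Suc b)
  let ?x = "\<lambda>a. hasse_deriv a f" and ?y = "\<lambda>a. hasse_deriv a g"
  have "of_nat (Suc b) * hasse_deriv (Suc b) (f * g) = fps_deriv (\<Sum>a\<le>b. ?x a * ?y (b - a))"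
    unfolding hasse_deriv_Suc Suc ..
  also have "\<dots> = (\<Sum>a\<le>b. fps_deriv (?x a) * ?y (b - a) + ?x a * fps_deriv (?y (b - a)))"
    by (simp add: fps_deriv_sum add.commute)
  also have "\<dots> = (\<Sum>a\<le>b. of_nat (Suc a) * ?x (Suc a) * ?y (Suc b - Suc a))
      + (\<Sum>a\<le>b. of_nat (Suc b - a) * ?x a * ?y (Suc b - a))"
    unfolding sum.distrib
    by (intro arg_cong2[of _ _ _ _ "(+)"] sum.cong)
      (auto simp: hasse_deriv_Suc[symmetric] Suc_diff_le mult_ac simp del: of_nat_Suc)
  also have "(\<Sum>a\<le>b. of_nat (Suc a) * ?x (Suc a) * ?y (Suc b - Suc a))
      = (\<Sum>a\<le>Suc b. of_nat a * ?x a * ?y (Suc b - a))"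
    by (simp add: sum.atMost_Suc_shift del: of_nat_Suc sum.atMost_Suc)
  also have "(\<Sum>a\<le>b. of_nat (Suc b - a) * ?x a * ?y (Suc b - a))
      = (\<Sum>a\<le>Suc b. of_nat (Suc b - a) * ?x a * ?y (Suc b - a))"
    by simp
  also have "(\<Sum>a\<le>Suc b. of_nat a * ?x a * ?y (Suc b - a)) + (\<Sum>a\<le>Suc b. of_nat (Suc b - a) * ?x a * ?y (Suc b - a))
      = (\<Sum>a\<le>Suc b. of_nat (Suc b) * (?x a * ?y (Suc b - a)))"
    unfolding sum.distrib[symmetric]
  proof (rule sum.cong[OF refl])
    fix a
    assume "a \<in> {..Suc b}"
    then have "of_nat a + of_nat (Suc b - a) = (of_nat (Suc b) :: 'r fps)"
      by (simp flip: of_nat_add del: of_nat_Suc)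
    then show "of_nat a * ?x a * ?y (Suc b - a) + of_nat (Suc b - a) * ?x a * ?y (Suc b - a)
        = of_nat (Suc b) * (?x a * ?y (Suc b - a))"
      by (metis distrib_right mult.assoc)
  qed
  finally have "of_nat (Suc b) * hasse_deriv (Suc b) (f * g)
      = of_nat (Suc b) * (\<Sum>a\<le>Suc b. ?x a * ?y (Suc b - a))"
    unfolding sum_distrib_left .
  then show ?case
    by (simp del: of_nat_Suc sum.atMost_Suc)
qed simp

lemma hasse_deriv_fps_X_power:
  "hasse_deriv a (fps_X ^ m) = of_nat (m choose a) * (fps_X ^ (m - a) :: 'r::comm_ring_1 fps)"
proof (rule fps_ext)
  fix n
  show "fps_nth (hasse_deriv a (fps_X ^ m)) n = fps_nth (of_nat (m choose a) * (fps_X ^ (m - a) :: 'r fps)) n"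
    by (cases "a \<le> m") (auto simp: hasse_deriv_nth fps_of_nat_mult_nth fps_X_power_nth binomial_eq_0)
qed

lemma fps_mult_nth_above:
  assumes "\<And>i. i > s \<Longrightarrow> fps_nth f i = (0::'r::comm_ring_1)" and "\<And>i. i > t \<Longrightarrow> fps_nth g i = 0"
  shows "m > s + t \<Longrightarrow> fps_nth (f * g) m = 0"
    and "fps_nth (f * g) (s + t) = fps_nth f s * fps_nth g t"
proof -
  assume m: "m > s + t"
  have "fps_nth f i * fps_nth g (m - i) = 0" for i
    using m assms(1)[of i] assms(2)[of "m - i"] by (cases "i > s") auto
  then show "fps_nth (f * g) m = 0"
    by (simp add: fps_mult_nth)
next
  have "fps_nth (f * g) (s + t) = (\<Sum>i=0..s+t. if i = s then fps_nth f s * fps_nth g t else 0)"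
    unfolding fps_mult_nth
  proof (rule sum.cong[OF refl])
    fix i
    show "fps_nth f i * fps_nth g (s + t - i) = (if i = s then fps_nth f s * fps_nth g t else 0)"
      using assms(1)[of i] assms(2)[of "s + t - i"] by (cases i s rule: linorder_cases) auto
  qed
  then show "fps_nth (f * g) (s + t) = fps_nth f s * fps_nth g t"
    by simp
qed

lemma diff_op_add: "diff_op L (f + g) = diff_op L f + diff_op L g"
  by (simp add: diff_op_def algebra_simps)

lemma diff_op_diff: "diff_op L (f - g) = diff_op L f - diff_op L g"
  by (simp add: diff_op_def algebra_simps)

lemma diff_op_const_mult: "diff_op L (fps_const c * f) = fps_const c * diff_op L f"
  by (simp add: diff_op_def algebra_simps)

lemma diff_op_sum: "diff_op L (sum f A) = (\<Sum>i\<in>A. diff_op L (f i))"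
  by (simp add: diff_op_def fps_deriv_sum sum_distrib_left sum_subtractf)

lemma diff_op_0: "diff_op L 0 = 0"
  by (simp add: diff_op_def)

lemma diff_op_exp:
  assumes "is_exp e P"
  shows "diff_op (fps_deriv P) (e * g) = e * fps_deriv g"
  using is_exp_fps_deriv[OF assms] by (simp add: diff_op_def algebra_simps)

text \<open>The inverse exponential is a parameter, so that exchanging e and \<open>e'\<close>
  yields an instance for - P; the solubility estimate is applied to that instance.\<close>

locale polynomial_exponent = padic_extension p nrm for p and nrm :: "'a::field_char_0 \<Rightarrow> real" +
  fixes P e e' :: "'a fps" and N :: nat
  assumes exp_P: "is_exp e P" and exp_minus_P: "is_exp e' (- P)"
    and N_pos: "N > 0" and P_above: "\<And>j. j > N \<Longrightarrow> fps_nth P j = 0"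
begin

abbreviation nabla :: "'a fps \<Rightarrow> 'a fps" where
  "nabla \<equiv> diff_op (fps_deriv P)"

definition lead :: 'a where
  "lead = of_nat N * fps_nth P N"

text \<open>Conjugation by e turns d/dT into \<nabla>, so this is \<nabla>^b / b! applied to 1. By
  \<open>nabla_monom_eq\<close> these polynomials determine the divided powers on all
  monomials.\<close>

definition H :: "nat \<Rightarrow> 'a fps" where
  "H b = e * hasse_deriv b e'"

text \<open>The divided power \<open>\<nabla>\<^sup>b / b!\<close> of the operator, applied to \<open>T\<^sup>m\<close>.\<close>
definition nabla_monom :: "nat \<Rightarrow> nat \<Rightarrow> 'a fps" where
  "nabla_monom b m = e * hasse_deriv b (fps_X ^ m * e')"

lemma e_e': "e * e' = 1"
  by (rule is_exp_minus[OF exp_P exp_minus_P])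

lemma nabla_monom_Suc: "of_nat (Suc b) * nabla_monom (Suc b) m = nabla (nabla_monom b m)"
  unfolding nabla_monom_def diff_op_exp[OF exp_P] hasse_deriv_Suc[symmetric] by (simp add: mult_ac)

lemma H_Suc: "of_nat (Suc b) * H (Suc b) = nabla (H b)"
  using nabla_monom_Suc[of b 0] by (simp add: nabla_monom_def H_def)

lemma nabla_monom_eq: "nabla_monom b m = (\<Sum>a\<le>b. of_nat (m choose a) * (fps_X ^ (m - a) * H (b - a)))"
  unfolding nabla_monom_def hasse_deriv_mult hasse_deriv_fps_X_power H_def sum_distrib_left
  by (intro sum.cong refl) (simp only: mult_ac)

lemma nabla_monom_nth:
  "fps_nth (nabla_monom b m) j
    = (\<Sum>a\<le>b. of_nat (m choose a) * (if j < m - a then 0 else fps_nth (H (b - a)) (j - (m - a))))"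
  by (simp add: nabla_monom_eq fps_sum_nth fps_of_nat_mult_nth fps_X_power_mult_nth)

lemma fps_deriv_P_above: "i > N - 1 \<Longrightarrow> fps_nth (fps_deriv P) i = 0"
  using N_pos by (simp add: P_above)

lemma fps_deriv_P_lead: "fps_nth (fps_deriv P) (N - 1) = lead"
  using N_pos by (simp add: lead_def)

text \<open>Each \<nabla> multiplies the leading term by - lead T^(N-1); the derivative contributes
  in lower degree only.\<close>

lemma H_top:
  shows "j > b * (N - 1) \<Longrightarrow> fps_nth (H b) j = 0"
    and "fps_nth (H b) (b * (N - 1)) = (- lead) ^ b / fact b"
proof -
  have "(\<forall>j>b * (N - 1). fps_nth (H b) j = 0) \<and> fps_nth (H b) (b * (N - 1)) = (- lead) ^ b / fact b"
  proof (induction b)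
    case 0
    have "H 0 = 1"
      by (simp add: H_def e_e')
    then show ?case
      by simp
  next
    case (Suc b)
    then have above: "\<And>j. j > b * (N - 1) \<Longrightarrow> fps_nth (H b) j = 0"
      and top: "fps_nth (H b) (b * (N - 1)) = (- lead) ^ b / fact b"
      by auto
    note prod = fps_mult_nth_above[of "N - 1" "fps_deriv P" "b * (N - 1)" "H b", OF fps_deriv_P_above above]
    have rec: "of_nat (Suc b) * fps_nth (H (Suc b)) j
        = of_nat (Suc j) * fps_nth (H b) (Suc j) - fps_nth (fps_deriv P * H b) j" for j
    proof -
      have "of_nat (Suc b) * fps_nth (H (Suc b)) j = fps_nth (nabla (H b)) j"
        using H_Suc[of b] fps_of_nat_mult_nth by metis
      then show ?thesis
        by (simp add: diff_op_def)
    qed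
    have "fps_nth (H (Suc b)) j = 0" if "j > Suc b * (N - 1)" for j
    proof -
      have "of_nat (Suc b) * fps_nth (H (Suc b)) j = 0"
        unfolding rec using above[of "Suc j"] prod(1)[of j] that by simp
      then show ?thesis
        by (simp del: of_nat_Suc)
    qed
    moreover have "of_nat (Suc b) * fps_nth (H (Suc b)) (Suc b * (N - 1)) = - (lead * ((- lead) ^ b / fact b))"
      unfolding rec using above[of "Suc (Suc b * (N - 1))"] prod(2)[unfolded fps_deriv_P_lead top] by simp
    then have "fps_nth (H (Suc b)) (Suc b * (N - 1)) = (- lead) ^ Suc b / fact (Suc b)"
      by (simp add: field_simps del: of_nat_Suc)
    ultimately show ?case
      by blast
  qed
  then show "j > b * (N - 1) \<Longrightarrow> fps_nth (H b) j = 0"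
    and "fps_nth (H b) (b * (N - 1)) = (- lead) ^ b / fact b"
    by auto
qed

lemma nabla_monom_top:
  shows "j > m + b * (N - 1) \<Longrightarrow> fps_nth (nabla_monom b m) j = 0"
    and "fps_nth (nabla_monom b m) (m + b * (N - 1)) = (- lead) ^ b / fact b"
proof -
  have zero: "fps_nth (H (b - a)) (j - (m - a)) = 0"
    if "j > m + b * (N - 1) \<or> j = m + b * (N - 1) \<and> a > 0 \<and> a \<le> m" "a \<le> b" for a j
  proof (rule H_top)
    have "(b - a) * (N - 1) \<le> b * (N - 1)"
      by simp
    then show "j - (m - a) > (b - a) * (N - 1)"
      using that by linarith
  qed
  show "fps_nth (nabla_monom b m) j = 0" if "j > m + b * (N - 1)"
    unfolding nabla_monom_nth using zero that by (intro sum.neutral) auto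
  have "fps_nth (nabla_monom b m) (m + b * (N - 1))
      = (\<Sum>a\<le>b. if a = 0 then (- lead) ^ b / fact b else 0)"
    unfolding nabla_monom_nth
  proof (rule sum.cong[OF refl])
    fix a
    assume a: "a \<in> {..b}"
    show "of_nat (m choose a) * (if m + b * (N - 1) < m - a then 0 else fps_nth (H (b - a)) (m + b * (N - 1) - (m - a)))
      = (if a = 0 then (- lead) ^ b / fact b else 0)"
    proof (cases "a = 0")
      case True
      then show ?thesis
        using H_top(2)[of b] by simp
    next
      case False
      then show ?thesis
        using zero[of "m + b * (N - 1)" a] a by (cases "a \<le> m") (auto simp: binomial_eq_0)
    qed
  qed
  then show "fps_nth (nabla_monom b m) (m + b * (N - 1)) = (- lead) ^ b / fact b"
    by simp
qed

text \<open>The bounds are on the Gauss norms of radius \<open>1 / c\<close>.\<close>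
definition reducible :: "real \<Rightarrow> real \<Rightarrow> nat \<Rightarrow> bool" where
  "reducible c C M \<longleftrightarrow> (\<exists>Q R. fps_X ^ M = nabla Q + R \<and> (\<forall>i>M. fps_nth Q i = 0)
     \<and> (\<forall>i. N \<le> i + 1 \<longrightarrow> fps_nth R i = 0)
     \<and> (\<forall>i. nrm (fps_nth Q i) * c ^ M \<le> C * c ^ i) \<and> (\<forall>i. nrm (fps_nth R i) * c ^ M \<le> C * c ^ i))"

text \<open>Superposition of the reductions of monomials. By the strong triangle inequality the
  constant C does not grow with the number of terms, which is what lets reductions be
  nested.\<close>

lemma reducible_polynomial:
  assumes red: "\<And>M. M < K \<Longrightarrow> reducible c C M" and c: "0 < c" and C: "0 \<le> C"
    and f: "\<And>M. M \<ge> K \<Longrightarrow> fps_nth f M = 0" and B: "\<And>M. nrm (fps_nth f M) \<le> B * c ^ M"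
  obtains Q R where "f = nabla Q + R" and "\<And>i. i \<ge> K \<Longrightarrow> fps_nth Q i = 0"
    and "\<And>i. N \<le> i + 1 \<Longrightarrow> fps_nth R i = 0"
    and "\<And>i. nrm (fps_nth Q i) \<le> B * C * c ^ i" and "\<And>i. nrm (fps_nth R i) \<le> B * C * c ^ i"
proof -
  have "\<forall>M. \<exists>Q R. M < K \<longrightarrow> fps_X ^ M = nabla Q + R \<and> (\<forall>i>M. fps_nth Q i = 0)
     \<and> (\<forall>i. N \<le> i + 1 \<longrightarrow> fps_nth R i = 0)
     \<and> (\<forall>i. nrm (fps_nth Q i) * c ^ M \<le> C * c ^ i) \<and> (\<forall>i. nrm (fps_nth R i) * c ^ M \<le> C * c ^ i)"
    using red unfolding reducible_def by blast
  then obtain Q R where "\<forall>M. M < K \<longrightarrow> fps_X ^ M = nabla (Q M) + R M \<and> (\<forall>i>M. fps_nth (Q M) i = 0)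
     \<and> (\<forall>i. N \<le> i + 1 \<longrightarrow> fps_nth (R M) i = 0)
     \<and> (\<forall>i. nrm (fps_nth (Q M) i) * c ^ M \<le> C * c ^ i) \<and> (\<forall>i. nrm (fps_nth (R M) i) * c ^ M \<le> C * c ^ i)"
    by (simp only: choice_iff) blast
  then have QR: "\<And>M. M < K \<Longrightarrow> fps_X ^ M = nabla (Q M) + R M"
    "\<And>M i. M < K \<Longrightarrow> i > M \<Longrightarrow> fps_nth (Q M) i = 0"
    "\<And>M i. M < K \<Longrightarrow> N \<le> i + 1 \<Longrightarrow> fps_nth (R M) i = 0"
    "\<And>M i. M < K \<Longrightarrow> nrm (fps_nth (Q M) i) * c ^ M \<le> C * c ^ i"
    "\<And>M i. M < K \<Longrightarrow> nrm (fps_nth (R M) i) * c ^ M \<le> C * c ^ i"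
    by auto
  have B0: "0 \<le> B"
    using B[of 0] nrm_nonneg[of "fps_nth f 0"] by simp
  have bound: "nrm (\<Sum>M<K. fps_nth f M * fps_nth (G M) i) \<le> B * C * c ^ i"
    if "\<And>M. M < K \<Longrightarrow> nrm (fps_nth (G M) i) * c ^ M \<le> C * c ^ i" for G :: "nat \<Rightarrow> 'a fps" and i
  proof (rule nrm_sum_le)
    fix M
    assume "M \<in> {..<K}"
    have "nrm (fps_nth f M * fps_nth (G M) i) \<le> B * c ^ M * nrm (fps_nth (G M) i)"
      unfolding nrm_mult by (intro mult_right_mono B nrm_nonneg)
    also have "\<dots> = B * (nrm (fps_nth (G M) i) * c ^ M)"
      by simp
    also have "\<dots> \<le> B * (C * c ^ i)"
      using that \<open>M \<in> {..<K}\<close> B0 by (intro mult_left_mono) auto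
    finally show "nrm (fps_nth f M * fps_nth (G M) i) \<le> B * C * c ^ i"
      by simp
  qed (use B0 C c in simp)
  show ?thesis
  proof
    have "f = (\<Sum>M<K. fps_const (fps_nth f M) * fps_X ^ M)"
      using f by (auto simp: fps_eq_iff fps_sum_nth fps_X_power_nth if_distrib not_less cong: if_cong)
    also have "\<dots> = (\<Sum>M<K. fps_const (fps_nth f M) * (nabla (Q M) + R M))"
      by (rule sum.cong) (simp_all flip: QR(1))
    finally show "f = nabla (\<Sum>M<K. fps_const (fps_nth f M) * Q M) + (\<Sum>M<K. fps_const (fps_nth f M) * R M)"
      by (simp add: diff_op_sum diff_op_const_mult distrib_left sum.distrib)
    show "fps_nth (\<Sum>M<K. fps_const (fps_nth f M) * Q M) i = 0" if "i \<ge> K" for i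
      using QR(2) that by (auto simp: fps_sum_nth intro!: sum.neutral)
    show "fps_nth (\<Sum>M<K. fps_const (fps_nth f M) * R M) i = 0" if "N \<le> i + 1" for i
      using QR(3) that by (auto simp: fps_sum_nth intro!: sum.neutral)
    show "nrm (fps_nth (\<Sum>M<K. fps_const (fps_nth f M) * Q M) i) \<le> B * C * c ^ i" for i
      using bound[OF QR(4)] by (simp add: fps_sum_nth)
    show "nrm (fps_nth (\<Sum>M<K. fps_const (fps_nth f M) * R M) i) \<le> B * C * c ^ i" for i
      using bound[OF QR(5)] by (simp add: fps_sum_nth)
  qed
qed

lemma nrm_nabla_monom_le:
  assumes H: "\<And>b j. b \<le> k \<Longrightarrow> nrm (fps_nth (H b) j) \<le> c ^ (j + b)" and c: "0 < c" and b: "b \<le> k"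
  shows "nrm (fps_nth (nabla_monom b m) j) * c ^ m \<le> c ^ (j + b)"
proof -
  have "nrm (fps_nth (nabla_monom b m) j) \<le> c ^ (j + b) / c ^ m"
    unfolding nabla_monom_nth
  proof (rule nrm_sum_le)
    fix a
    assume a: "a \<in> {..b}"
    show "nrm (of_nat (m choose a) * (if j < m - a then 0 else fps_nth (H (b - a)) (j - (m - a)))) \<le> c ^ (j + b) / c ^ m"
    proof (cases "j < m - a \<or> a > m")
      case True
      then show ?thesis
        using c by (auto simp: binomial_eq_0)
    next
      case False
      then have "m - a \<le> j" "a \<le> m" "a \<le> b"
        using a by auto
      then have "j + b = (j - (m - a) + (b - a)) + m"
        by arith
      then have "c ^ (j + b) / c ^ m = c ^ (j - (m - a) + (b - a))"
        using c by (simp only: power_add) simp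
      moreover have "nrm (of_nat (m choose a) * fps_nth (H (b - a)) (j - (m - a))) \<le> 1 * c ^ (j - (m - a) + (b - a))"
        using a b by (intro nrm_mult_le nrm_nat_le_one H) auto
      ultimately show ?thesis
        using False by simp
    qed
  qed (use c in simp)
  then show ?thesis
    using c by (simp add: field_simps)
qed

text \<open>
  The leading term of \<open>(\<nabla>\<^sup>k / k!) T\<^sup>m\<close> dominates on the circle of radius \<open>1 / c\<close>, so that it can be used to
  lower the degree of \<open>T\<^bsup>m+k(N-1)\<^esup>\<close> without any loss.
\<close>
lemma reducible_step:
  assumes H: "\<And>b j. b \<le> k \<Longrightarrow> nrm (fps_nth (H b) j) \<le> c ^ (j + b)"
    and c: "0 < c" "c \<le> 1" and k: "k > 0"
    and lead: "c ^ (N * k) \<le> nrm (lead ^ k / fact k)"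
    and C: "1 / (nrm (lead ^ k / fact k) * nrm (of_nat k)) \<le> C"
    and base: "\<And>M. M < k * (N - 1) \<Longrightarrow> reducible c C M"
  shows "reducible c C M"
proof (induction M rule: less_induct)
  case (less M)
  show ?case
  proof (cases "M < k * (N - 1)")
    case True
    then show ?thesis
      by (rule base)
  next
    case False
    define m where "m = M - k * (N - 1)"
    define l where "l = (- lead) ^ k / fact k"
    obtain b where kb: "k = Suc b"
      using k gr0_conv_Suc by auto
    have M: "M = m + k * (N - 1)" and Mk: "M + k = m + N * k"
      using False N_pos by (auto simp: m_def algebra_simps diff_mult_distrib2)
    have nl: "nrm l = nrm (lead ^ k / fact k)"
      by (simp add: l_def nrm_divide nrm_power)
    have l0: "0 < nrm l"
      using lead c by (simp add: nl) (smt (verit) zero_less_power)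
    have k0: "0 < nrm (of_nat k)"
      using k by (intro nrm_pos) simp
    have C0: "0 \<le> C"
      using C nl l0 k0 by (smt (verit) zero_le_divide_1_iff mult_nonneg_nonneg)
    have nabla_le: "nrm (fps_nth (nabla_monom b m) j) * c ^ m \<le> c ^ (j + b)" if "b \<le> k" for b j
      using nrm_nabla_monom_le[of k c b m j] H c that by blast
    \<comment> \<open>Subtracting the normalised \<nabla>^k / k! of T^m cancels T^M. As the leading
      term is of maximal size at radius 1/c, the difference has at most the Gauss norm of T^M, and
      induction applies with the same C.\<close>
    define f where "f = fps_X ^ M - fps_const (1 / l) * nabla_monom k m"
    have l_ne: "l \<noteq> 0"
      using l0 by auto
    have f_top: "fps_nth f j = 0" if "j \<ge> M" for j
      using that l_ne nabla_monom_top(1)[of m k j] nabla_monom_top(2)[of k m] unfolding M[symmetric] l_def[symmetric]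
      by (cases "j = M") (auto simp: f_def fps_X_power_nth)
    have f_bound: "nrm (fps_nth f j) \<le> 1 / c ^ M * c ^ j" for j
    proof (cases "j \<ge> M")
      case True
      then show ?thesis
        using c by (simp add: f_top)
    next
      case False
      have "nrm (fps_nth f j) = nrm (fps_nth (nabla_monom k m) j) / nrm l"
        using False by (simp add: f_def fps_X_power_nth nrm_divide)
      moreover have "nrm (fps_nth (nabla_monom k m) j) * c ^ m * c ^ (N * k) \<le> c ^ (j + k) * nrm l"
        using nabla_le[of k j] lead c unfolding nl
        by (intro mult_mono) (auto simp: nrm_nonneg)
      then have "nrm (fps_nth (nabla_monom k m) j) * c ^ (M + k) \<le> c ^ (j + k) * nrm l"
        by (simp add: Mk power_add mult.assoc)
      then have "nrm (fps_nth (nabla_monom k m) j) \<le> 1 / c ^ M * c ^ j * nrm l"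
        using c by (simp add: power_add field_simps)
      ultimately show ?thesis
        using l0 by (simp only: pos_divide_le_eq)
    qed
    obtain Q R where QR: "f = nabla Q + R" "\<And>i. i \<ge> M \<Longrightarrow> fps_nth Q i = 0"
      "\<And>i. N \<le> i + 1 \<Longrightarrow> fps_nth R i = 0"
      "\<And>i. nrm (fps_nth Q i) \<le> 1 / c ^ M * C * c ^ i" "\<And>i. nrm (fps_nth R i) \<le> 1 / c ^ M * C * c ^ i"
      using reducible_polynomial[OF less c(1) C0 f_top f_bound] by metis
    \<comment> \<open>A preimage of the subtracted term, by k (\<nabla>^k / k!) = \<nabla>
      (\<nabla>^(k-1) / (k-1)!). Its size brings in 1 / (|l| |k|), which is independent of M and
      covered by C.\<close>
    define S where "S = fps_const (1 / (l * of_nat k)) * nabla_monom b m"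
    have "nabla S = fps_const (1 / (l * of_nat k)) * (of_nat k * nabla_monom k m)"
      unfolding S_def diff_op_const_mult kb nabla_monom_Suc ..
    also have "\<dots> = fps_const (1 / l) * nabla_monom k m"
      using k by (simp add: fps_of_nat[symmetric] mult.assoc[symmetric] del: fps_of_nat)
    finally have "fps_X ^ M = nabla (Q + S) + R"
      using QR(1) by (simp add: f_def diff_op_add algebra_simps)
    moreover have "fps_nth (Q + S) i = 0" if "i > M" for i
    proof -
      have "b * (N - 1) \<le> k * (N - 1)"
        by (simp add: kb)
      then have "fps_nth (nabla_monom b m) i = 0"
        using that unfolding M by (intro nabla_monom_top) linarith
      then show ?thesis
        using QR(2) that by (simp add: S_def)
    qed
    moreover have "nrm (fps_nth (Q + S) i) * c ^ M \<le> C * c ^ i" for i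
    proof -
      have "nrm (fps_nth S i) = nrm (fps_nth (nabla_monom b m) i) * (1 / (nrm l * nrm (of_nat k)))"
        by (simp add: S_def nrm_divide nrm_mult)
      also have "\<dots> \<le> nrm (fps_nth (nabla_monom b m) i) * C"
        using C nl by (intro mult_left_mono) (auto simp: nrm_nonneg)
      also have "\<dots> \<le> c ^ (i + b) / c ^ m * C"
        using nabla_le[of b i] c C0 kb
        by (intro mult_right_mono) (auto simp: field_simps)
      finally have "nrm (fps_nth S i) * c ^ M \<le> c ^ (i + b) / c ^ m * C * c ^ M"
        using c by (intro mult_right_mono) auto
      also have "\<dots> = C * c ^ i * c ^ (b + k * (N - 1))"
        using c by (simp add: M power_add)
      also have "\<dots> \<le> C * c ^ i * 1"
        using c C0 by (intro mult_left_mono power_le_one) auto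
      finally have "nrm (fps_nth S i) \<le> 1 / c ^ M * C * c ^ i"
        using c by (simp add: field_simps)
      then have "nrm (fps_nth (Q + S) i) \<le> 1 / c ^ M * C * c ^ i"
        using QR(4)[of i] by (simp add: nrm_add_le)
      then show ?thesis
        using c by (simp add: field_simps)
    qed
    moreover have "nrm (fps_nth R i) * c ^ M \<le> C * c ^ i" for i
      using QR(5)[of i] c by (simp add: field_simps)
    ultimately show ?thesis
      unfolding reducible_def using QR(3) by blast
  qed
qed

lemma reducible_base:
  assumes "0 < c" and "1 \<le> C" and "M < N - 1"
  shows "reducible c C M"
  unfolding reducible_def
proof (intro exI conjI allI impI)
  show "fps_X ^ M = nabla 0 + fps_X ^ M"
    by (simp add: diff_op_0)
qed (use assms in \<open>auto simp: fps_X_power_nth\<close>)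

text \<open>Q and R have degree at most K, so all radii are comparable up to a constant. The
  constant is harmless since the lemma only has to supply the finitely many base cases of
  \<open>reducible_step\<close>.\<close>

lemma reducible_change_radius:
  assumes "reducible c C M" and "M \<le> K" and "N \<le> K" and "0 < c" "c \<le> 1" and "0 < c'" "c' \<le> 1" and "0 \<le> C"
  shows "reducible c' (C / (c ^ K * c' ^ K)) M"
proof -
  have *: "nrm (fps_nth G i) * c' ^ M \<le> C / (c ^ K * c' ^ K) * c' ^ i"
    if G: "\<And>i. nrm (fps_nth G i) * c ^ M \<le> C * c ^ i" and zero: "i > K \<Longrightarrow> fps_nth G i = 0" for G :: "'a fps" and i
  proof (cases "i > K")
    case False
    have "nrm (fps_nth G i) * c ^ K \<le> nrm (fps_nth G i) * c ^ M"
      using assms by (intro mult_left_mono power_decreasing) (auto simp: nrm_nonneg)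
    also have "\<dots> \<le> C * c ^ i"
      by (rule G)
    also have "\<dots> \<le> C * 1"
      using assms by (intro mult_left_mono power_le_one) auto
    finally have "nrm (fps_nth G i) \<le> C / c ^ K"
      using assms by (simp add: field_simps)
    then have "nrm (fps_nth G i) * c' ^ M \<le> C / c ^ K * 1"
      using assms by (intro mult_mono power_le_one) auto
    also have "\<dots> \<le> C / c ^ K * (c' ^ i / c' ^ K)"
      using assms False by (intro mult_left_mono) (auto simp: divide_simps intro!: power_decreasing)
    finally show ?thesis
      by simp
  qed (use zero assms in simp)
  obtain Q R where "fps_X ^ M = nabla Q + R" "\<forall>i>M. fps_nth Q i = 0" "\<forall>i. N \<le> i + 1 \<longrightarrow> fps_nth R i = 0"
    "\<And>i. nrm (fps_nth Q i) * c ^ M \<le> C * c ^ i" "\<And>i. nrm (fps_nth R i) * c ^ M \<le> C * c ^ i"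
    using assms(1) unfolding reducible_def by blast
  then show ?thesis
    unfolding reducible_def using *[of Q] *[of R] assms by (intro exI[of _ Q] exI[of _ R]) auto
qed

end

section \<open>Overconvergent series\<close>

text \<open>Taking the last index where the maximum is attained gives strict inequality beyond it,
  as needed to isolate one dominant term in a product.\<close>

lemma largest_argmax:
  fixes g :: "nat \<Rightarrow> real"
  assumes lim: "g \<longlonglongrightarrow> 0" and pos: "g a > 0"
  obtains m where "g m > 0" and "\<And>j. g j \<le> g m" and "\<And>j. j > m \<Longrightarrow> g j < g m"
proof -
  have "eventually (\<lambda>j. g j < g a) sequentially"
    using order_tendstoD(2)[OF lim pos] .
  then obtain J where J: "\<And>j. j \<ge> J \<Longrightarrow> g j < g a"
    by (auto simp: eventually_sequentially)
  define A where "A = {j. g a \<le> g j}"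
  have "A \<subseteq> {..<J}"
  proof
    fix j
    assume "j \<in> A"
    then show "j \<in> {..<J}"
      using J[of j] by (cases "J \<le> j") (auto simp: A_def)
  qed
  then have fin: "finite A"
    using finite_subset by blast
  define v where "v = Max (g ` A)"
  have aA: "a \<in> A"
    by (simp add: A_def)
  have v: "v \<in> g ` A" and ge: "\<And>j. j \<in> A \<Longrightarrow> g j \<le> v"
    unfolding v_def using fin aA by (auto intro!: Max_in Max_ge)
  define E where "E = {j \<in> A. g j = v}"
  have E: "finite E" "E \<noteq> {}"
    using fin v by (auto simp: E_def)
  define m where "m = Max E"
  have m: "m \<in> E"
    unfolding m_def using E by (rule Max_in)
  then have gm: "g m = v" "g m \<ge> g a"
    by (auto simp: E_def A_def)
  have le: "g j \<le> g m" for j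
    using gm ge[of j] by (cases "j \<in> A") (auto simp: A_def)
  show thesis
  proof
    show "g m > 0"
      using gm pos by simp
    show "g j \<le> g m" for j
      by (rule le)
    show "g j < g m" if "j > m" for j
    proof (rule ccontr)
      assume "\<not> g j < g m"
      then have "j \<in> E"
        using le[of j] gm by (auto simp: E_def A_def)
      then have "j \<le> m"
        unfolding m_def using E by (intro Max_ge)
      with that show False
        by simp
    qed
  qed
qed

lemma geometric_unbounded:
  fixes x B :: real
  assumes "x > 1" and "1 < p" and "0 < N"
  obtains h where "B < x ^ (N * p ^ h)"
proof -
  obtain m where "B < x ^ m"
    using real_arch_pow[OF assms(1)] by blast
  also have "m \<le> N * p ^ m"
    using less_exp[of m] power_mono[of 2 p m] assms
    by (metis One_nat_def Suc_leI le_trans less_imp_le mult_le_mono nat_mult_1 numeral_2_eq_2 zero_le)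
  then have "x ^ m \<le> x ^ (N * p ^ m)"
    using assms by (intro power_increasing) auto
  finally show thesis
    using that by blast
qed

context padic_extension
begin

lemma eq_0_if_le_geometric:
  assumes "\<And>K. nrm x \<le> A * \<delta> ^ K" and "0 \<le> \<delta>" and "\<delta> < 1"
  shows "x = 0"
proof -
  have "(\<lambda>K. A * \<delta> ^ K) \<longlonglongrightarrow> A * 0"
    using assms by (intro tendsto_mult_left LIMSEQ_power_zero) auto
  then have "nrm x \<le> 0"
    using assms(1) by (intro LIMSEQ_le_const[of _ 0]) auto
  then show ?thesis
    using nrm_nonneg[of x] nrm_eq_0_iff by auto
qed

text \<open>The sum is formed coefficientwise by completeness of K. The ultrametric inequality gives
  tails the same bound as their first term, and the factor c^i keeps the limit bounded at radius
  1/c.\<close>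

lemma fps_series_limit:
  assumes F: "\<And>M i. nrm (fps_nth (F M) i) \<le> B * \<delta> ^ M * c ^ i"
    and \<delta>: "0 \<le> \<delta>" "\<delta> < 1" and c: "0 \<le> c" and B: "0 \<le> B"
  obtains S where "\<And>K i. nrm (fps_nth (S - (\<Sum>M<K. F M)) i) \<le> B * \<delta> ^ K * c ^ i"
proof -
  have "\<exists>l. \<forall>K. nrm (l - (\<Sum>M<K. fps_nth (F M) i)) \<le> B * \<delta> ^ K * c ^ i" for i
  proof -
    define s where "s K = (\<Sum>M<K. fps_nth (F M) i)" for K
    have diff: "nrm (s J - s K) \<le> B * \<delta> ^ K * c ^ i" if "K \<le> J" for J K
    proof -
      have "s J = s K + (\<Sum>M\<in>{K..<J}. fps_nth (F M) i)"
        unfolding s_def using that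
        by (metis atLeast0LessThan sum.atLeastLessThan_concat zero_le)
      then have "s J - s K = (\<Sum>M\<in>{K..<J}. fps_nth (F M) i)"
        by simp
      moreover have "nrm (\<Sum>M\<in>{K..<J}. fps_nth (F M) i) \<le> B * \<delta> ^ K * c ^ i"
      proof (rule nrm_sum_le)
        fix M
        assume "M \<in> {K..<J}"
        then have "B * \<delta> ^ M * c ^ i \<le> B * \<delta> ^ K * c ^ i"
          using \<delta> c B by (intro mult_right_mono mult_left_mono power_decreasing) auto
        with F[of M i] show "nrm (fps_nth (F M) i) \<le> B * \<delta> ^ K * c ^ i"
          by linarith
      qed (use \<delta> c B in simp)
      ultimately show ?thesis
        by simp
    qed
    have lim0: "(\<lambda>K. B * \<delta> ^ K * c ^ i) \<longlonglongrightarrow> 0"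
      using LIMSEQ_power_zero[of \<delta>] \<delta> by (auto intro!: tendsto_mult_left_zero tendsto_mult_right_zero)
    have "\<exists>l. (\<lambda>K. nrm (s K - l)) \<longlonglongrightarrow> 0"
    proof (rule nrm_complete)
      fix \<epsilon> :: real
      assume "\<epsilon> > 0"
      then have "eventually (\<lambda>K. B * \<delta> ^ K * c ^ i < \<epsilon>) sequentially"
        using order_tendstoD(2)[OF lim0] by blast
      then obtain K where K: "B * \<delta> ^ K * c ^ i < \<epsilon>"
        by (auto simp: eventually_sequentially)
      have "nrm (s J - s J') < \<epsilon>" if "J \<ge> K" "J' \<ge> K" for J J'
      proof -
        have "nrm ((s J - s K) - (s J' - s K)) \<le> B * \<delta> ^ K * c ^ i"
          using that by (intro nrm_diff_le diff)
        with K show ?thesis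
          by simp
      qed
      then show "\<exists>N. \<forall>i\<ge>N. \<forall>j\<ge>N. nrm (s i - s j) < \<epsilon>"
        by blast
    qed
    then obtain l where l: "(\<lambda>K. nrm (s K - l)) \<longlonglongrightarrow> 0"
      by blast
    have "nrm (l - s K) \<le> B * \<delta> ^ K * c ^ i" for K
    proof (rule field_le_epsilon)
      fix \<epsilon> :: real
      assume e: "\<epsilon> > 0"
      have "eventually (\<lambda>J. nrm (s J - l) < \<epsilon> \<and> K \<le> J) sequentially"
        using order_tendstoD(2)[OF l e] eventually_ge_at_top[of K] by (rule eventually_conj)
      then obtain J where J: "nrm (s J - l) < \<epsilon>" "K \<le> J"
        by (auto simp: eventually_sequentially)
      have nonneg: "0 \<le> B * \<delta> ^ K * c ^ i"
        using B \<delta> c by simp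
      have "nrm ((s J - s K) - (s J - l)) \<le> B * \<delta> ^ K * c ^ i + \<epsilon>"
        using J(1) diff[OF J(2)] e nonneg
        by (intro nrm_diff_le[of "s J - s K" _ "s J - l"]) linarith+
      then show "nrm (l - s K) \<le> B * \<delta> ^ K * c ^ i + \<epsilon>"
        by simp
    qed
    then show ?thesis
      unfolding s_def by blast
  qed
  then obtain l where l: "\<And>i K. nrm (l i - (\<Sum>M<K. fps_nth (F M) i)) \<le> B * \<delta> ^ K * c ^ i"
    by metis
  show thesis
    by (rule that[of "Abs_fps l"]) (use l in \<open>simp add: fps_sum_nth\<close>)
qed

section \<open>Boundedness on circles, radius of convergence and the Gauss norm\<close>

definition bounded_at :: "real \<Rightarrow> 'a fps \<Rightarrow> bool" where
  "bounded_at \<sigma> f \<longleftrightarrow> (\<exists>B. \<forall>n. nrm (fps_nth f n) * \<sigma> ^ n \<le> B)"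

lemma bounded_at_mono:
  assumes "bounded_at \<sigma> f" and "0 \<le> \<rho>" and "\<rho> \<le> \<sigma>"
  shows "bounded_at \<rho> f"
proof -
  obtain B where B: "\<And>n. nrm (fps_nth f n) * \<sigma> ^ n \<le> B"
    using assms(1) unfolding bounded_at_def by blast
  have "nrm (fps_nth f n) * \<rho> ^ n \<le> B" for n
  proof -
    have "nrm (fps_nth f n) * \<rho> ^ n \<le> nrm (fps_nth f n) * \<sigma> ^ n"
      using assms by (intro mult_left_mono power_mono nrm_nonneg)
    with B[of n] show ?thesis
      by linarith
  qed
  then show ?thesis
    unfolding bounded_at_def by blast
qed

lemma bounded_at_mult:
  assumes "bounded_at \<sigma> f" and "bounded_at \<sigma> g" and "0 \<le> \<sigma>"
  shows "bounded_at \<sigma> (f * g)"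
proof -
  obtain A B where A: "\<And>n. nrm (fps_nth f n) * \<sigma> ^ n \<le> A" and B: "\<And>n. nrm (fps_nth g n) * \<sigma> ^ n \<le> B"
    using assms(1,2) unfolding bounded_at_def by blast
  have A0: "0 \<le> A" and B0: "0 \<le> B"
    using A[of 0] B[of 0] nrm_nonneg[of "fps_nth f 0"] nrm_nonneg[of "fps_nth g 0"] by simp_all
  have "nrm (fps_nth (f * g) n) * \<sigma> ^ n \<le> A * B" for n
  proof (cases "\<sigma> = 0")
    case True
    then show ?thesis
      using A[of 0] B[of 0] A0 B0 by (cases n) (auto simp: nrm_mult intro!: mult_mono nrm_nonneg)
  next
    case False
    have "nrm (fps_nth (f * g) n) \<le> A * B / \<sigma> ^ n"
      unfolding fps_mult_nth
    proof (rule nrm_sum_le)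
      fix i
      assume i: "i \<in> {0..n}"
      have "(nrm (fps_nth f i) * \<sigma> ^ i) * (nrm (fps_nth g (n - i)) * \<sigma> ^ (n - i)) \<le> A * B"
        using A B A0 assms(3) by (intro mult_mono) (auto simp: nrm_nonneg)
      moreover have "\<sigma> ^ n = \<sigma> ^ i * \<sigma> ^ (n - i)"
        using i by (simp flip: power_add)
      ultimately show "nrm (fps_nth f i * fps_nth g (n - i)) \<le> A * B / \<sigma> ^ n"
        using False assms(3) by (simp add: nrm_mult field_simps)
    qed (use A0 B0 assms in simp)
    then show ?thesis
      using False assms(3) by (simp add: field_simps)
  qed
  then show ?thesis
    unfolding bounded_at_def by blast
qed

lemma bounded_at_prod:
  assumes "\<And>i. i \<in> A \<Longrightarrow> bounded_at \<sigma> (F i)" and "0 \<le> \<sigma>"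
  shows "bounded_at \<sigma> (prod F A)"
proof -
  have one: "bounded_at \<sigma> 1"
    unfolding bounded_at_def by (intro exI[of _ 1]) (simp add: fps_one_nth)
  show ?thesis
    using assms by (induction A rule: infinite_finite_induct) (auto intro: bounded_at_mult one)
qed

lemma bounded_at_if_radius_gt:
  assumes "ereal \<sigma> < radius nrm f" and "0 \<le> \<sigma>"
  shows "bounded_at \<sigma> f"
proof -
  have "summable (\<lambda>n. nrm (fps_nth f n) * \<sigma> ^ n)"
    using assms unfolding radius_def by (intro summable_in_conv_radius) simp
  then have "Bseq (\<lambda>n. nrm (fps_nth f n) * \<sigma> ^ n)"
    by (intro convergent_imp_Bseq convergentI[OF summable_LIMSEQ_zero])
  then obtain B where "\<And>n. norm (nrm (fps_nth f n) * \<sigma> ^ n) \<le> B"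
    unfolding Bseq_def by auto
  then show ?thesis
    unfolding bounded_at_def by (metis abs_ge_self order_trans real_norm_def)
qed

lemma radius_ge_if_bounded_at:
  assumes "bounded_at \<sigma> f" and "0 < \<sigma>"
  shows "ereal \<sigma> \<le> radius nrm f"
  unfolding radius_def
proof (rule conv_radius_geI_ex')
  fix r :: real
  assume r: "0 < r" "ereal r < ereal \<sigma>"
  obtain B where B: "\<And>n. nrm (fps_nth f n) * \<sigma> ^ n \<le> B"
    using assms(1) unfolding bounded_at_def by blast
  have "summable (\<lambda>n. B * (r / \<sigma>) ^ n)"
    using r assms by (intro summable_mult summable_geometric) auto
  then show "summable (\<lambda>n. nrm (fps_nth f n) * of_real r ^ n)"
  proof (rule summable_comparison_test'[where N = 0])
    fix n :: nat
    have "nrm (fps_nth f n) * r ^ n = nrm (fps_nth f n) * \<sigma> ^ n * (r / \<sigma>) ^ n"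
      using assms by (simp add: power_divide)
    also have "\<dots> \<le> B * (r / \<sigma>) ^ n"
      using B r assms by (intro mult_right_mono) auto
    finally show "norm (nrm (fps_nth f n) * of_real r ^ n) \<le> B * (r / \<sigma>) ^ n"
      using r by (simp add: nrm_nonneg)
  qed
qed

lemma overconvergent_iff: "f \<in> overconvergent nrm \<longleftrightarrow> (\<exists>\<sigma>>1. bounded_at \<sigma> f)"
proof
  assume "f \<in> overconvergent nrm"
  then obtain \<sigma> where "1 < ereal \<sigma>" "ereal \<sigma> < radius nrm f"
    unfolding overconvergent_def using ereal_dense2[of 1 "radius nrm f"] by auto
  then show "\<exists>\<sigma>>1. bounded_at \<sigma> f"
    by (intro exI[of _ \<sigma>]) (auto intro: bounded_at_if_radius_gt)
next
  assume "\<exists>\<sigma>>1. bounded_at \<sigma> f"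
  then obtain \<sigma> where "\<sigma> > 1" "bounded_at \<sigma> f"
    by blast
  then have "ereal \<sigma> \<le> radius nrm f"
    by (intro radius_ge_if_bounded_at) auto
  moreover have "1 < ereal \<sigma>"
    using \<open>\<sigma> > 1\<close> by simp
  ultimately show "f \<in> overconvergent nrm"
    unfolding overconvergent_def using less_le_trans by blast
qed

lemma overconvergent_mult:
  assumes "f \<in> overconvergent nrm" and "g \<in> overconvergent nrm"
  shows "f * g \<in> overconvergent nrm"
proof -
  obtain \<sigma> \<rho> where "\<sigma> > 1" "bounded_at \<sigma> f" "\<rho> > 1" "bounded_at \<rho> g"
    using assms unfolding overconvergent_iff by blast
  then have "bounded_at (min \<sigma> \<rho>) (f * g)"
    by (intro bounded_at_mult) (auto elim: bounded_at_mono)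
  then show ?thesis
    unfolding overconvergent_iff using \<open>\<sigma> > 1\<close> \<open>\<rho> > 1\<close> by (intro exI[of _ "min \<sigma> \<rho>"]) auto
qed

lemma bounded_at_add:
  assumes "bounded_at \<sigma> f" and "bounded_at \<sigma> g" and "0 \<le> \<sigma>"
  shows "bounded_at \<sigma> (f + g)"
proof -
  obtain A B where A: "\<And>n. nrm (fps_nth f n) * \<sigma> ^ n \<le> A" and B: "\<And>n. nrm (fps_nth g n) * \<sigma> ^ n \<le> B"
    using assms(1,2) unfolding bounded_at_def by blast
  have "nrm (fps_nth (f + g) n) * \<sigma> ^ n \<le> max A B" for n
  proof -
    have "nrm (fps_nth (f + g) n) * \<sigma> ^ n \<le> max (nrm (fps_nth f n)) (nrm (fps_nth g n)) * \<sigma> ^ n"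
      using assms(3) by (intro mult_right_mono) (auto simp: nrm_ultrametric)
    also have "\<dots> \<le> max A B"
      using A[of n] B[of n] by (auto simp: max_def)
    finally show ?thesis .
  qed
  then show ?thesis
    unfolding bounded_at_def by blast
qed

lemma overconvergent_add:
  assumes "f \<in> overconvergent nrm" and "g \<in> overconvergent nrm"
  shows "f + g \<in> overconvergent nrm"
proof -
  obtain \<sigma> \<rho> where "\<sigma> > 1" "bounded_at \<sigma> f" "\<rho> > 1" "bounded_at \<rho> g"
    using assms unfolding overconvergent_iff by blast
  then have "bounded_at (min \<sigma> \<rho>) (f + g)"
    by (intro bounded_at_add) (auto elim: bounded_at_mono)
  then show ?thesis
    unfolding overconvergent_iff using \<open>\<sigma> > 1\<close> \<open>\<rho> > 1\<close> by (intro exI[of _ "min \<sigma> \<rho>"]) auto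
qed

lemma overconvergent_polynomial:
  assumes "\<And>i. i \<ge> K \<Longrightarrow> fps_nth f i = 0"
  shows "f \<in> overconvergent nrm"
  unfolding overconvergent_iff bounded_at_def
proof (rule exI[of _ 2], rule conjI, simp, rule exI, rule allI)
  fix n :: nat
  show "nrm (fps_nth f n) * 2 ^ n \<le> (\<Sum>i<K. nrm (fps_nth f i) * 2 ^ i)"
  proof (cases "n < K")
    case True
    then show ?thesis
      by (intro member_le_sum) (auto simp: nrm_nonneg)
  next
    case False
    then show ?thesis
      using assms by (auto intro!: sum_nonneg simp: nrm_nonneg)
  qed
qed

text \<open>If a and b are the last indices where the terms of f and of g are largest, the product
  of these two terms strictly dominates all other contributions to coefficient a + b of f g.\<close>

lemma gauss_norm_mult:
  assumes f: "(\<lambda>j. nrm (fps_nth f j) * \<sigma> ^ j) \<longlonglongrightarrow> 0" and g: "(\<lambda>j. nrm (fps_nth g j) * \<sigma> ^ j) \<longlonglongrightarrow> 0"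
    and \<sigma>: "0 < \<sigma>" and prod: "\<And>m. nrm (fps_nth (f * g) m) * \<sigma> ^ m \<le> B"
  shows "(nrm (fps_nth f i) * \<sigma> ^ i) * (nrm (fps_nth g j) * \<sigma> ^ j) \<le> B"
proof (cases "fps_nth f i = 0 \<or> fps_nth g j = 0")
  case True
  have "0 \<le> B"
    using prod[of 0] nrm_nonneg[of "fps_nth (f * g) 0"] by simp
  with True show ?thesis
    by auto
next
  case False
  let ?f = "\<lambda>j. nrm (fps_nth f j) * \<sigma> ^ j" and ?g = "\<lambda>j. nrm (fps_nth g j) * \<sigma> ^ j"
  have "?f i > 0" "?g j > 0"
    using False \<sigma> by (auto intro!: mult_pos_pos nrm_pos)
  obtain a where a: "?f a > 0" "\<And>l. ?f l \<le> ?f a" "\<And>l. l > a \<Longrightarrow> ?f l < ?f a"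
    by (rule largest_argmax[OF f \<open>?f i > 0\<close>], rule that)
  obtain b where b: "?g b > 0" "\<And>l. ?g l \<le> ?g b" "\<And>l. l > b \<Longrightarrow> ?g l < ?g b"
    by (rule largest_argmax[OF g \<open>?g j > 0\<close>], rule that)
  have small: "nrm (fps_nth f l * fps_nth g (a + b - l)) < nrm (fps_nth f a * fps_nth g b)"
    if l: "l \<le> a + b" "l \<noteq> a" for l
  proof -
    have "?f l * ?g (a + b - l) < ?f a * ?g b"
    proof (cases "l > a")
      case True
      then have "?f l * ?g (a + b - l) \<le> ?f l * ?g b"
        using b(2) \<sigma> by (intro mult_left_mono) (auto simp: nrm_nonneg)
      also have "\<dots> < ?f a * ?g b"
        using a(3)[OF True] b(1) by (intro mult_strict_right_mono)
      finally show ?thesis .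
    next
      case False
      then have "a + b - l > b"
        using l by simp
      then have "?f a * ?g (a + b - l) < ?f a * ?g b"
        using b(3) a(1) by (intro mult_strict_left_mono)
      moreover have "?f l * ?g (a + b - l) \<le> ?f a * ?g (a + b - l)"
        using a(2) \<sigma> by (intro mult_right_mono) (auto simp: nrm_nonneg)
      ultimately show ?thesis
        by linarith
    qed
    moreover have "\<sigma> ^ l * \<sigma> ^ (a + b - l) = \<sigma> ^ a * \<sigma> ^ b"
      using l by (simp flip: power_add)
    ultimately have "nrm (fps_nth f l) * nrm (fps_nth g (a + b - l)) * (\<sigma> ^ a * \<sigma> ^ b)
        < nrm (fps_nth f a) * nrm (fps_nth g b) * (\<sigma> ^ a * \<sigma> ^ b)"
      by (metis mult.assoc mult.left_commute)
    then show ?thesis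
      using \<sigma> by (simp add: nrm_mult)
  qed
  have "fps_nth (f * g) (a + b) = fps_nth f a * fps_nth g b
      + (\<Sum>l\<in>{0..a+b} - {a}. fps_nth f l * fps_nth g (a + b - l))"
    unfolding fps_mult_nth by (subst sum.remove[of _ a]) auto
  moreover have "nrm (\<Sum>l\<in>{0..a+b} - {a}. fps_nth f l * fps_nth g (a + b - l)) < nrm (fps_nth f a * fps_nth g b)"
    using small a(1) b(1) \<sigma> by (intro nrm_sum_less) (auto simp: nrm_mult zero_less_mult_iff)
  ultimately have "nrm (fps_nth (f * g) (a + b)) = nrm (fps_nth f a * fps_nth g b)"
    by (simp add: nrm_add_dominant)
  then have "?f a * ?g b \<le> B"
    using prod[of "a + b"] by (simp add: nrm_mult power_add mult_ac)
  moreover have "?f i * ?g j \<le> ?f a * ?g b"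
    using mult_mono[OF a(2)[of i] b(2)[of j]] \<sigma> by (simp add: nrm_nonneg)
  ultimately show ?thesis
    by linarith
qed

end

section \<open>The cokernel on overconvergent series\<close>

context polynomial_exponent
begin

text \<open>With y = T v, the coefficient of T^(j+b) v^b in e(T) / e(T + y) is that of T^j y^b, and
  Taylor expansion of \<open>e'\<close> in y gives \<open>H b\<close>. Thus one bound on the twist
  controls the \<open>H b\<close> for all b <= k.\<close>

lemma twist_nth:
  "fps_nth (fps_nth (subst_monom fps_const 1 1 e * subst_monom fps_const 1 (1 + fps_X) e') (j + b)) b
    = fps_nth (H b) j"
proof -
  have binom: "fps_nth ((1 + fps_X :: 'a fps) ^ m) b = of_nat (m choose b)" for m
    by (metis binomial_gbinomial fps_binomial_nth fps_binomial_of_nat)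
  have "fps_nth (fps_nth (subst_monom fps_const 1 1 e * subst_monom fps_const 1 (1 + fps_X) e') (j + b)) b
      = (\<Sum>i=0..j+b. fps_nth e i * (fps_nth e' (j + b - i) * of_nat ((j + b - i) choose b)))"
    unfolding fps_mult_nth[of "subst_monom fps_const 1 1 e"] fps_sum_nth
    by (intro sum.cong refl) (simp add: subst_monom_nth binom)
  also have "\<dots> = (\<Sum>i=0..j. fps_nth e i * (fps_nth e' (j + b - i) * of_nat ((j + b - i) choose b)))"
    by (rule sum.mono_neutral_right) (auto simp: binomial_eq_0)
  also have "\<dots> = fps_nth (H b) j"
    unfolding H_def fps_mult_nth hasse_deriv_nth by (intro sum.cong) (auto simp: mult_ac)
  finally show ?thesis .
qed

text \<open>\<open>H k\<close> times \<open>e'\<close> is the k-th divided derivative of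
  \<open>e'\<close>, which costs at most \<rho>^(-k) in Gauss norm. Multiplicativity then bounds the
  Gauss norm of \<open>H k\<close>, in particular its leading term, by \<rho>^(-k). Strictness of
  \<rho> < \<sigma> ensures that the Gauss norm of \<open>e'\<close> is attained.\<close>

lemma lead_growth_le:
  assumes bd: "bounded_at \<sigma> e'" and \<sigma>: "0 < \<sigma>" and \<rho>: "0 < \<rho>" "\<rho> < \<sigma>"
  shows "nrm (lead ^ k / fact k) * \<rho> ^ (N * k) \<le> 1"
proof -
  obtain B where B: "\<And>n. nrm (fps_nth e' n) * \<sigma> ^ n \<le> B"
    using bd unfolding bounded_at_def by blast
  let ?g = "\<lambda>j. nrm (fps_nth e' j) * \<rho> ^ j"
  have lim: "?g \<longlonglongrightarrow> 0"
  proof (rule Lim_null_comparison)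
    show "eventually (\<lambda>n. norm (?g n) \<le> B * (\<rho> / \<sigma>) ^ n) sequentially"
    proof (intro always_eventually allI)
      fix n
      have "?g n = nrm (fps_nth e' n) * \<sigma> ^ n * (\<rho> / \<sigma>) ^ n"
        using \<sigma> by (simp add: power_divide)
      also have "\<dots> \<le> B * (\<rho> / \<sigma>) ^ n"
        using B \<rho> \<sigma> by (intro mult_right_mono) auto
      finally show "norm (?g n) \<le> B * (\<rho> / \<sigma>) ^ n"
        using \<rho> by (simp add: nrm_nonneg)
    qed
    show "(\<lambda>n. B * (\<rho> / \<sigma>) ^ n) \<longlonglongrightarrow> 0"
      using \<rho> \<sigma> by (intro tendsto_mult_right_zero LIMSEQ_power_zero) auto
  qed
  have "?g 0 > 0"
    using is_exp_nth_0[OF exp_minus_P] by simp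
  obtain j where j: "?g j > 0" "\<And>i. ?g i \<le> ?g j" "\<And>i. i > j \<Longrightarrow> ?g i < ?g j"
    by (rule largest_argmax[OF lim \<open>?g 0 > 0\<close>], rule that)
  have eq: "H k * e' = hasse_deriv k e'"
  proof -
    have "H k * e' = (e * e') * hasse_deriv k e'"
      unfolding H_def by (simp only: mult_ac)
    then show ?thesis
      by (simp add: e_e')
  qed
  have prod: "nrm (fps_nth (H k * e') m) * \<rho> ^ m \<le> ?g j / \<rho> ^ k" for m
  proof -
    have "nrm (fps_nth (H k * e') m) \<le> 1 * nrm (fps_nth e' (m + k))"
      unfolding eq hasse_deriv_nth by (intro nrm_mult_le nrm_nat_le_one) simp
    then have "nrm (fps_nth (H k * e') m) * \<rho> ^ m \<le> nrm (fps_nth e' (m + k)) * \<rho> ^ m"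
      using \<rho> by (intro mult_right_mono) auto
    also have "\<dots> = ?g (m + k) / \<rho> ^ k"
      using \<rho> by (simp add: power_add)
    also have "\<dots> \<le> ?g j / \<rho> ^ k"
      using j(2) \<rho> by (intro divide_right_mono) auto
    finally show ?thesis .
  qed
  have "(\<lambda>i. nrm (fps_nth (H k) i) * \<rho> ^ i) \<longlonglongrightarrow> 0"
  proof (rule tendsto_eventually)
    show "eventually (\<lambda>i. nrm (fps_nth (H k) i) * \<rho> ^ i = 0) sequentially"
      using eventually_gt_at_top[of "k * (N - 1)"] by eventually_elim (simp add: H_top)
  qed
  from gauss_norm_mult[OF this lim \<rho>(1) prod, of "k * (N - 1)" j, unfolded H_top(2)]
  have "nrm (lead ^ k / fact k) * \<rho> ^ (k * (N - 1)) * ?g j \<le> ?g j / \<rho> ^ k"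
    by (simp add: nrm_divide nrm_power)
  then have "nrm (lead ^ k / fact k) * (\<rho> ^ (k * (N - 1)) * \<rho> ^ k) * ?g j \<le> 1 * ?g j"
    using \<rho> by (simp add: field_simps)
  then have "nrm (lead ^ k / fact k) * (\<rho> ^ (k * (N - 1)) * \<rho> ^ k) \<le> 1"
    using j(1) by (rule mult_right_le_imp_le)
  moreover have "k * (N - 1) + k = N * k"
    using N_pos by (cases N) auto
  ultimately show ?thesis
    by (simp flip: power_add)
qed

end

text \<open>The radius 1/c lies between 1 and \<sigma>: monomials are reduced with bounded loss on
  circles arbitrarily close to the unit circle. The constant C may depend on c but not on M.\<close>

locale reducing_exponent = polynomial_exponent p nrm P e e' N
  for p and nrm :: "'a::field_char_0 \<Rightarrow> real" and P e e' N +
  assumes reducing: "\<And>\<sigma>. \<sigma> > 1 \<Longrightarrow> \<exists>c C. 1 / \<sigma> < c \<and> c < 1 \<and> 0 \<le> C \<and> (\<forall>M. reducible c C M)"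
    and lead_nonzero: "lead \<noteq> 0"
    and deriv_P_integral: "\<And>j. nrm (fps_nth (fps_deriv P) j) \<le> 1"
begin

lemma nrm_nabla_nth_le:
  assumes g: "\<And>j. nrm (fps_nth g j) \<le> A * c ^ j" and A: "0 \<le> A" and c: "0 < c" "c < 1"
  shows "nrm (fps_nth (nabla g) M) \<le> A / c ^ N * c ^ M"
proof -
  have le: "A * c ^ j \<le> A / c ^ N * c ^ M" if "M \<le> j + N" for j
  proof -
    have "c ^ (j + N) \<le> c ^ M"
      using that c by (intro power_decreasing) auto
    then have "A * c ^ (j + N) \<le> A * c ^ M"
      using A by (rule mult_left_mono)
    then show ?thesis
      using c by (simp add: power_add field_simps)
  qed
  have "nrm (of_nat (Suc M) * fps_nth g (Suc M)) \<le> 1 * (A * c ^ Suc M)"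
    by (intro nrm_mult_le nrm_nat_le_one g)
  then have 1: "nrm (of_nat (Suc M) * fps_nth g (Suc M)) \<le> A / c ^ N * c ^ M"
    using le[of "Suc M"] by linarith
  have 2: "nrm (fps_nth (fps_deriv P * g) M) \<le> A / c ^ N * c ^ M"
    unfolding fps_mult_nth
  proof (rule nrm_sum_le)
    fix i
    assume i: "i \<in> {0..M}"
    show "nrm (fps_nth (fps_deriv P) i * fps_nth g (M - i)) \<le> A / c ^ N * c ^ M"
    proof (cases "i > N - 1")
      case True
      then show ?thesis
        using A c by (simp add: P_above)
    next
      case False
      have "nrm (fps_nth (fps_deriv P) i * fps_nth g (M - i)) \<le> 1 * (A * c ^ (M - i))"
        by (intro nrm_mult_le deriv_P_integral g)
      also have "\<dots> \<le> A / c ^ N * c ^ M"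
        using le[of "M - i"] False by simp
      finally show ?thesis .
    qed
  qed (use A c in simp)
  show ?thesis
    using nrm_diff_le[OF 1 2] by (simp add: diff_op_def)
qed

text \<open>With lead nonzero, \<nabla> raises the degree of a nonzero polynomial by exactly N -
  1.\<close>

lemma nabla_polynomial_eq_0:
  assumes Q: "\<And>i. i \<ge> K \<Longrightarrow> fps_nth Q i = 0" and nabla: "\<And>i. N \<le> i + 1 \<Longrightarrow> fps_nth (nabla Q) i = 0"
  shows "Q = 0"
proof (rule ccontr)
  assume "Q \<noteq> 0"
  then obtain i where i: "fps_nth Q i \<noteq> 0"
    by (auto simp: fps_eq_iff)
  define d where "d = Max {i. fps_nth Q i \<noteq> 0}"
  have "{i. fps_nth Q i \<noteq> 0} \<subseteq> {..<K}"
    using Q by (auto simp: not_le[symmetric])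
  then have fin: "finite {i. fps_nth Q i \<noteq> 0}"
    using finite_subset by blast
  then have d: "fps_nth Q d \<noteq> 0"
    unfolding d_def using Max_in[of "{i. fps_nth Q i \<noteq> 0}"] i by blast
  have above: "fps_nth Q j = 0" if "j > d" for j
    using Max_ge[OF fin, of j] that by (force simp: d_def)
  have "fps_nth (fps_deriv P * Q) ((N - 1) + d) = lead * fps_nth Q d"
    using fps_mult_nth_above(2)[OF fps_deriv_P_above above] fps_deriv_P_lead by simp
  moreover have "fps_nth (nabla Q) ((N - 1) + d) = 0"
    using N_pos by (intro nabla) auto
  ultimately show False
    using d lead_nonzero above[of "Suc (N - 1 + d)"] by (simp add: diff_op_def)
qed

text \<open>The reduction radius 1/c is chosen strictly below a radius \<sigma> at which f is
  bounded; the margin \<delta> = 1 / (\<sigma> c) is the geometric decay that makes summed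
  reductions converge.\<close>

lemma bounded_at_decay:
  assumes "f \<in> overconvergent nrm"
  obtains B c C \<delta> where "0 \<le> B" "0 < c" "c < 1" "0 \<le> C" "\<And>M. reducible c C M" "0 \<le> \<delta>" "\<delta> < 1"
    "\<And>n. nrm (fps_nth f n) \<le> B * \<delta> ^ n * c ^ n"
proof -
  obtain \<sigma> B where \<sigma>: "\<sigma> > 1" and B: "\<And>n. nrm (fps_nth f n) * \<sigma> ^ n \<le> B"
    using assms unfolding overconvergent_iff bounded_at_def by blast
  obtain c C where c: "1 / \<sigma> < c" "c < 1" "0 \<le> C" "\<And>M. reducible c C M"
    using reducing[OF \<sigma>] by blast
  have c0: "0 < c"
    using c(1) \<sigma> by (smt (verit) divide_pos_pos)
  show thesis
  proof (rule that[of B c C "1 / (\<sigma> * c)"])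
    show "0 \<le> B"
      using B[of 0] nrm_nonneg[of "fps_nth f 0"] by simp
    show "0 \<le> 1 / (\<sigma> * c)" "1 / (\<sigma> * c) < 1"
      using c c0 \<sigma> by (auto simp: field_simps)
    show "nrm (fps_nth f n) \<le> B * (1 / (\<sigma> * c)) ^ n * c ^ n" for n
      using B[of n] c0 \<sigma> by (simp add: power_mult_distrib power_divide field_simps)
  qed (use c c0 in auto)
qed

text \<open>Polynomials of degree below N - 1 stay independent modulo the image. Truncate f to a
  polynomial h; then r - \<nabla> h is small and equals \<nabla> Q + R with R small. The polynomial
  h + Q has image r - R, of degree below N - 1, so it vanishes by
  \<open>nabla_polynomial_eq_0\<close>, and r = R is arbitrarily small.\<close>

lemma nabla_eq_polynomial:
  assumes f: "f \<in> overconvergent nrm" and r: "\<And>i. N \<le> i + 1 \<Longrightarrow> fps_nth r i = 0" and eq: "nabla f = r"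
  shows "r = 0"
proof -
  obtain B c C \<delta> where B: "0 \<le> B" and c: "0 < c" "c < 1" and C: "0 \<le> C" and red: "\<And>M. reducible c C M"
    and \<delta>: "0 \<le> \<delta>" "\<delta> < 1" and decay: "\<And>n. nrm (fps_nth f n) \<le> B * \<delta> ^ n * c ^ n"
    using bounded_at_decay[OF f] by metis
  have "nrm (fps_nth r i) \<le> B / c ^ N * C * c ^ i * \<delta> ^ K" for i K
  proof -
    define h where "h = Abs_fps (\<lambda>n. if n < K then fps_nth f n else 0)"
    have tail: "nrm (fps_nth (f - h) j) \<le> B * \<delta> ^ K * c ^ j" for j
    proof (cases "j < K")
      case True
      then show ?thesis
        using B \<delta> c by (simp add: h_def)
    next
      case False
      then have "B * \<delta> ^ j * c ^ j \<le> B * \<delta> ^ K * c ^ j"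
        using B \<delta> c by (intro mult_right_mono mult_left_mono power_decreasing) auto
      with decay[of j] False show ?thesis
        by (simp add: h_def)
    qed
    have t: "r - nabla h = nabla (f - h)"
      by (simp add: eq diff_op_diff)
    have t_bound: "nrm (fps_nth (r - nabla h) M) \<le> B * \<delta> ^ K / c ^ N * c ^ M" for M
      unfolding t using B \<delta> by (intro nrm_nabla_nth_le tail c) auto
    have t_top: "fps_nth (r - nabla h) M = 0" if "M \<ge> K + N" for M
    proof -
      have "fps_nth (fps_deriv P * h) M = 0"
        using that N_pos by (intro fps_mult_nth_above(1)[of "N - 1" _ K] fps_deriv_P_above) (auto simp: h_def)
      with that show ?thesis
        using r[of M] by (simp add: diff_op_def h_def)
    qed
    obtain Q R where QR: "r - nabla h = nabla Q + R" "\<And>i. i \<ge> K + N \<Longrightarrow> fps_nth Q i = 0"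
      "\<And>i. N \<le> i + 1 \<Longrightarrow> fps_nth R i = 0" "\<And>i. nrm (fps_nth R i) \<le> B * \<delta> ^ K / c ^ N * C * c ^ i"
      using reducible_polynomial[OF red c(1) C t_top t_bound] by metis
    have "nabla (h + Q) = r - R"
      using QR(1) by (simp add: diff_op_add algebra_simps)
    then have "h + Q = 0"
      using QR(2,3) r by (intro nabla_polynomial_eq_0[of "K + N"]) (auto simp: h_def)
    with \<open>nabla (h + Q) = r - R\<close> have "r = R"
      by (simp add: diff_op_0)
    with QR(4)[of i] show ?thesis
      by (simp add: mult_ac)
  qed
  then have "fps_nth r i = 0" for i
    by (rule eq_0_if_le_geometric[OF _ \<delta>])
  then show ?thesis
    by (simp add: fps_eq_iff)
qed

text \<open>The monomials of v are reduced one by one and the results summed; operator and summation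
  commute up to an error of order \<delta>^K.\<close>

lemma nabla_surj_mod_polynomials:
  assumes v: "v \<in> overconvergent nrm"
  obtains f R where "f \<in> overconvergent nrm" and "v = nabla f + R" and "\<And>i. N \<le> i + 1 \<Longrightarrow> fps_nth R i = 0"
proof -
  obtain B c C \<delta> where B: "0 \<le> B" and c: "0 < c" "c < 1" and C: "0 \<le> C" and red: "\<And>M. reducible c C M"
    and \<delta>: "0 \<le> \<delta>" "\<delta> < 1" and decay: "\<And>n. nrm (fps_nth v n) \<le> B * \<delta> ^ n * c ^ n"
    using bounded_at_decay[OF v] by metis
  have "\<forall>M. \<exists>Q R. fps_X ^ M = nabla Q + R \<and> (\<forall>i. N \<le> i + 1 \<longrightarrow> fps_nth R i = 0)
     \<and> (\<forall>i. nrm (fps_nth Q i) * c ^ M \<le> C * c ^ i) \<and> (\<forall>i. nrm (fps_nth R i) * c ^ M \<le> C * c ^ i)"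
    using red unfolding reducible_def by blast
  then obtain Q R where QR: "\<And>M. fps_X ^ M = nabla (Q M) + R M"
    and R: "\<And>M i. N \<le> i + 1 \<Longrightarrow> fps_nth (R M) i = 0"
    and Q_bound: "\<And>M i. nrm (fps_nth (Q M) i) * c ^ M \<le> C * c ^ i"
    and R_bound: "\<And>M i. nrm (fps_nth (R M) i) * c ^ M \<le> C * c ^ i"
    by (simp only: choice_iff) blast
  have term_le: "nrm (fps_nth (fps_const (fps_nth v M) * G M) i) \<le> (B * C) * \<delta> ^ M * c ^ i"
    if G: "\<And>M i. nrm (fps_nth (G M) i) * c ^ M \<le> C * c ^ i" for G :: "nat \<Rightarrow> 'a fps" and M i
  proof -
    have "nrm (fps_nth v M * fps_nth (G M) i) \<le> B * \<delta> ^ M * c ^ M * nrm (fps_nth (G M) i)"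
      unfolding nrm_mult by (intro mult_right_mono decay nrm_nonneg)
    also have "\<dots> = B * \<delta> ^ M * (nrm (fps_nth (G M) i) * c ^ M)"
      by simp
    also have "\<dots> \<le> B * \<delta> ^ M * (C * c ^ i)"
      using B \<delta> by (intro mult_left_mono G) auto
    finally show ?thesis
      by (simp add: mult_ac)
  qed
  have BC: "0 \<le> B * C" and c0: "0 \<le> c"
    using B C c by simp_all
  obtain S where S: "\<And>K i. nrm (fps_nth (S - (\<Sum>M<K. fps_const (fps_nth v M) * Q M)) i) \<le> B * C * \<delta> ^ K * c ^ i"
    using fps_series_limit[OF term_le[OF Q_bound] \<delta> c0 BC] by metis
  obtain U where U: "\<And>K i. nrm (fps_nth (U - (\<Sum>M<K. fps_const (fps_nth v M) * R M)) i) \<le> B * C * \<delta> ^ K * c ^ i"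
    using fps_series_limit[OF term_le[OF R_bound] \<delta> c0 BC] by metis
  have "fps_nth (v - (nabla S + U)) i = 0" for i
  proof (rule eq_0_if_le_geometric[OF _ \<delta>])
    fix K
    let ?Q = "\<Sum>M<K. fps_const (fps_nth v M) * Q M" and ?R = "\<Sum>M<K. fps_const (fps_nth v M) * R M"
      and ?v = "\<Sum>M<K. fps_const (fps_nth v M) * fps_X ^ M"
    have "?v = nabla ?Q + ?R"
      unfolding QR by (simp add: diff_op_sum diff_op_const_mult distrib_left sum.distrib)
    then have eq: "v - (nabla S + U) = ((v - ?v) - nabla (S - ?Q)) - (U - ?R)"
      by (simp add: diff_op_diff)
    define A where "A = (B + B * C / c ^ N * c ^ i + B * C) * \<delta> ^ K"
    have pos: "0 \<le> B * \<delta> ^ K" "0 \<le> B * C / c ^ N * c ^ i * \<delta> ^ K" "0 \<le> B * C * \<delta> ^ K"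
      using B C c \<delta> by simp_all
    have v_nth: "fps_nth (v - ?v) i = (if i < K then 0 else fps_nth v i)"
      by (simp add: fps_sum_nth fps_X_power_nth if_distrib cong: if_cong)
    have ci: "c ^ i \<le> 1"
      using c by (intro power_le_one) auto
    have "nrm (fps_nth (v - ?v) i) \<le> B * \<delta> ^ K"
    proof (cases "i < K")
      case False
      have "B * \<delta> ^ i * c ^ i \<le> B * \<delta> ^ K * 1"
        using False B \<delta> c by (intro mult_mono power_decreasing power_le_one mult_nonneg_nonneg) auto
      with decay[of i] False v_nth show ?thesis
        by simp
    qed (use v_nth pos in simp)
    then have 1: "nrm (fps_nth (v - ?v) i) \<le> A"
      using pos by (simp add: A_def distrib_right)
    have "nrm (fps_nth (nabla (S - ?Q)) i) \<le> B * C * \<delta> ^ K / c ^ N * c ^ i"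
      using B C \<delta> by (intro nrm_nabla_nth_le S c) auto
    moreover have "B * C * \<delta> ^ K / c ^ N * c ^ i = B * C / c ^ N * c ^ i * \<delta> ^ K"
      by simp
    ultimately have 2: "nrm (fps_nth (nabla (S - ?Q)) i) \<le> A"
      using pos unfolding A_def distrib_right by linarith
    have "B * C * \<delta> ^ K * c ^ i \<le> B * C * \<delta> ^ K * 1"
      using pos(3) ci by (intro mult_left_mono)
    then have 3: "nrm (fps_nth (U - ?R) i) \<le> A"
      using U[of K i] pos by (simp add: A_def distrib_right)
    show "nrm (fps_nth (v - (nabla S + U)) i) \<le> (B + B * C / c ^ N * c ^ i + B * C) * \<delta> ^ K"
      unfolding eq A_def[symmetric] fps_sub_nth[of _ "U - ?R"] fps_sub_nth[of "v - ?v"]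
      by (intro nrm_diff_le 1 2 3)
  qed
  then have "v = nabla S + U"
    by (simp add: fps_eq_iff)
  moreover have "fps_nth U i = 0" if i: "N \<le> i + 1" for i
  proof (rule eq_0_if_le_geometric[OF _ \<delta>])
    show "nrm (fps_nth U i) \<le> (B * C * c ^ i) * \<delta> ^ K" for K
      using U[of K i] R[OF i] by (simp add: fps_sum_nth mult_ac)
  qed
  moreover have "S \<in> overconvergent nrm"
    unfolding overconvergent_iff bounded_at_def
  proof (rule exI[of _ "1 / c"], rule conjI)
    have "nrm (fps_nth S n) * (1 / c) ^ n \<le> B * C" for n
      using S[of 0 n] c by (simp add: power_divide field_simps)
    then show "\<exists>B. \<forall>n. nrm (fps_nth S n) * (1 / c) ^ n \<le> B"
      by blast
  qed (use c in simp)
  ultimately show thesis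
    using that by blast
qed

end

section \<open>Exponents given by Witt vectors\<close>

context padic_root_of_unity
begin

lemma p_supported_exponent: "p_supported (exponent \<mu>)"
  unfolding exponent_def
  by (intro p_supported_sum p_supported_subst_monom ring_map_id p_supported_robba_log)

lemma exponent_nth_power:
  "fps_nth (exponent \<mu>) (p ^ m)
    = (\<Sum>i\<le>n. if i \<le> m then (z ^ p ^ m - 1) / of_nat (p ^ (m - i)) * \<mu> i ^ p ^ (m - i) else 0)"
proof -
  have "(z ^ p ^ i) ^ p ^ (m - i) = z ^ p ^ m" if "i \<le> m" for i
    using that by (simp flip: power_mult power_add)
  then show ?thesis
    unfolding exponent_def fps_sum_nth subst_monom_nth_power
    by (intro sum.cong refl if_cong) (simp_all add: robba_log_power del: of_nat_power)
qed

lemma exponent_above: "j > p ^ n \<Longrightarrow> fps_nth (exponent \<mu>) j = 0"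
proof (rule ccontr)
  assume j: "j > p ^ n" "fps_nth (exponent \<mu>) j \<noteq> 0"
  then obtain m where m: "j = p ^ m"
    using p_supported_exponent by (auto simp: p_supported_def)
  then have "m > n"
    using j p_ge_2 by (metis le_less_trans less_or_eq_imp_le linorder_not_less nat_less_le one_le_numeral power_increasing order_trans)
  then show False
    using j(2) by (simp add: m exponent_nth_power z_power_eq_1)
qed

text \<open>Multiplication by p^m leaves z^(p^m) - 1 times a ghost component of \<mu>, free of
  denominators; so T P' is integral for integral \<mu> even where P is not.\<close>

lemma euler_exponent_power:
  "of_nat (p ^ m) * fps_nth (exponent \<mu>) (p ^ m)
    = (z ^ p ^ m - 1) * (\<Sum>i\<le>n. if i \<le> m then of_nat (p ^ i) * \<mu> i ^ p ^ (m - i) else 0)"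
  unfolding exponent_nth_power sum_distrib_left
proof (intro sum.cong refl)
  fix i
  have "p ^ m = p ^ i * p ^ (m - i)" if "i \<le> m"
    using that by (simp flip: power_add)
  then have "of_nat (p ^ m) / of_nat (p ^ (m - i)) = (of_nat (p ^ i) :: 'a)" if "i \<le> m"
    using that p_ge_2 by (simp only: of_nat_mult) simp
  moreover have "of_nat (p ^ m) * (y / b * x) = (of_nat (p ^ m) / b) * (y * x)" for x y b :: 'a
    by simp
  ultimately show "of_nat (p ^ m) * (if i \<le> m then (z ^ p ^ m - 1) / of_nat (p ^ (m - i)) * \<mu> i ^ p ^ (m - i) else 0)
      = (z ^ p ^ m - 1) * (if i \<le> m then of_nat (p ^ i) * \<mu> i ^ p ^ (m - i) else 0)"
    by (simp only: if_distrib[of "(*) _"] mult_zero_right cong: if_cong) (simp only: mult.left_commute)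
qed

lemma nrm_euler_exponent_le_one:
  assumes "\<And>i. i \<le> n \<Longrightarrow> nrm (\<mu> i) \<le> 1"
  shows "nrm (of_nat j * fps_nth (exponent \<mu>) j) \<le> 1"
proof (cases "\<exists>m. j = p ^ m")
  case True
  then obtain m where m: "j = p ^ m"
    by blast
  show ?thesis
    unfolding m euler_exponent_power
    using assms
    by (intro nrm_mult_le_one nrm_sum_le nrm_z_power_diff_le_1)
      (auto intro!: nrm_mult_le_one nrm_nat_le_one nrm_power_le_one simp del: of_nat_power)
next
  case False
  then have "fps_nth (exponent \<mu>) j = 0"
    using p_supported_exponent by (auto simp: p_supported_def)
  then show ?thesis
    by simp
qed

text \<open>The bounds |\<mu>_i| <= r^(p^i) say that \<mu>_0 is dominant after rescaling T. In the
  n-th ghost component the terms with i > 0 carry an extra factor p^i, so \<mu>_0^(p^n) alone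
  determines the norm.\<close>

lemma nrm_euler_exponent_top:
  assumes r: "nrm (\<mu> 0) = r" "r > 0" and le: "\<And>i. i \<le> n \<Longrightarrow> nrm (\<mu> i) \<le> r ^ p ^ i"
  shows "nrm (of_nat (p ^ n) * fps_nth (exponent \<mu>) (p ^ n)) = w * r ^ p ^ n"
proof -
  have "(\<Sum>i\<le>n. if i \<le> n then of_nat (p ^ i) * \<mu> i ^ p ^ (n - i) else 0)
      = \<mu> 0 ^ p ^ n + (\<Sum>i\<in>{1..n}. of_nat (p ^ i) * \<mu> i ^ p ^ (n - i))"
    by (simp add: atMost_atLeast0 sum.atLeast_Suc_atMost cong: if_cong)
  moreover have "nrm (\<mu> 0 ^ p ^ n + (\<Sum>i\<in>{1..n}. of_nat (p ^ i) * \<mu> i ^ p ^ (n - i))) = nrm (\<mu> 0 ^ p ^ n)"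
  proof (rule nrm_add_dominant, rule nrm_sum_less)
    show "0 < nrm (\<mu> 0 ^ p ^ n)"
      using r by (simp add: nrm_power)
    fix i
    assume i: "i \<in> {1..n}"
    have "nrm (\<mu> i) ^ p ^ (n - i) \<le> (r ^ p ^ i) ^ p ^ (n - i)"
      using le i by (intro power_mono nrm_nonneg) auto
    also have "\<dots> = r ^ p ^ n"
      using i by (simp flip: power_mult power_add)
    finally have "nrm (of_nat (p ^ i) * \<mu> i ^ p ^ (n - i)) \<le> (1 / real p) ^ i * r ^ p ^ n"
      using p_ge_2 by (simp add: nrm_mult nrm_power nrm_p divide_right_mono field_simps)
    also have "\<dots> < 1 * r ^ p ^ n"
    proof (rule mult_strict_right_mono)
      have "(1 / real p) ^ i < 1 ^ i"
        using i p_ge_2 by (intro power_strict_mono) auto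
      then show "(1 / real p) ^ i < 1"
        by simp
    qed (use r in simp)
    finally show "nrm (of_nat (p ^ i) * \<mu> i ^ p ^ (n - i)) < nrm (\<mu> 0 ^ p ^ n)"
      by (simp add: nrm_power r)
  qed
  ultimately show ?thesis
    unfolding euler_exponent_power nrm_mult by (simp add: w_def nrm_power r)
qed

lemma exp_exponent:
  obtains e e' where "is_exp e (exponent \<mu>)" and "is_exp e' (- exponent \<mu>)"
proof
  have "fps_nth (exponent \<mu>) 0 = 0"
    using p_supported_exponent[of \<mu>] p_ge_2 by (auto simp: p_supported_def)
  then show "is_exp (fps_exp 1 oo exponent \<mu>) (exponent \<mu>)"
    and "is_exp (fps_exp 1 oo (- exponent \<mu>)) (- exponent \<mu>)"
    by (auto intro!: is_exp_fps_exp_compose)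
qed

lemma polynomial_exponent:
  assumes "is_exp e (exponent \<mu>)" and "is_exp e' (- exponent \<mu>)"
  shows "polynomial_exponent p nrm (exponent \<mu>) e e' (p ^ n)"
  by unfold_locales (use assms exponent_above p_ge_2 in auto)

lemma polynomial_exponent_minus:
  assumes "is_exp e (exponent \<mu>)" and "is_exp e' (- exponent \<mu>)"
  shows "polynomial_exponent p nrm (- exponent \<mu>) e' e (p ^ n)"
  by unfold_locales (use assms exponent_above p_ge_2 in auto)

text \<open>For k = p^h, |k!| is at most w^(k-1), so k! cancels all but one of the factors w in
  x^k.\<close>

lemma nrm_power_div_fact_ge:
  assumes "nrm x = w * s" and "0 \<le> s"
  shows "w * s ^ p ^ h \<le> nrm (x ^ p ^ h / fact (p ^ h))"
proof -
  have "nrm (fact (p ^ h)) \<le> w ^ (p ^ h - 1)"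
    using w_pos w_power by (intro nrm_fact_prime_power_le) auto
  moreover have "0 < nrm (fact (p ^ h))"
    by (rule nrm_pos) simp
  moreover have "w * w ^ (p ^ h - 1) = w ^ p ^ h"
    using p_ge_2 by (simp flip: power_Suc)
  ultimately have "w * s ^ p ^ h * nrm (fact (p ^ h)) \<le> w * s ^ p ^ h * w ^ (p ^ h - 1)"
    using assms(2) w_pos by (intro mult_left_mono) auto
  also have "\<dots> = w ^ p ^ h * s ^ p ^ h"
    unfolding \<open>w * w ^ (p ^ h - 1) = w ^ p ^ h\<close>[symmetric] by (simp only: mult_ac)
  finally have "w * s ^ p ^ h * nrm (fact (p ^ h)) \<le> w ^ p ^ h * s ^ p ^ h" .
  then show ?thesis
    using \<open>0 < nrm (fact (p ^ h))\<close>
    by (simp add: nrm_divide nrm_power assms power_mult_distrib pos_le_divide_eq)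
qed

text \<open>For - P, whose inverse exponential is e, \<open>lead_growth_le\<close> bounds w (r
  \<rho>)^(p^n k) by 1 for all k = p^h and \<rho> < \<sigma>. Letting k grow excludes r \<rho> >
  1.\<close>

lemma radius_exp_exponent_le:
  assumes e: "is_exp e (exponent \<mu>)" and e': "is_exp e' (- exponent \<mu>)"
    and r: "nrm (\<mu> 0) = r" "r > 0" and le: "\<And>i. i \<le> n \<Longrightarrow> nrm (\<mu> i) \<le> r ^ p ^ i"
    and bd: "bounded_at \<sigma> e" and \<sigma>: "0 < \<sigma>"
  shows "r * \<sigma> \<le> 1"
proof (rule ccontr)
  assume "\<not> r * \<sigma> \<le> 1"
  then have "1 / r < \<sigma>"
    using r by (simp add: field_simps)
  then obtain \<rho> where \<rho>: "1 / r < \<rho>" "\<rho> < \<sigma>"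
    using dense by blast
  have \<rho>0: "0 < \<rho>"
    using \<rho>(1) r by (smt (verit) divide_pos_pos)
  have gt1: "1 < r * \<rho>"
    using \<rho>(1) r by (simp add: field_simps)
  interpret E: polynomial_exponent p nrm "- exponent \<mu>" e' e "p ^ n"
    using e e' by (rule polynomial_exponent_minus)
  have lead: "nrm E.lead = w * r ^ p ^ n"
    using nrm_euler_exponent_top[OF r le] by (simp add: E.lead_def del: of_nat_power)
  obtain h where h: "1 / w < (r * \<rho>) ^ (p ^ n * p ^ h)"
    using geometric_unbounded[OF gt1, of p "p ^ n" "1 / w"] p_ge_2 by auto
  have "w * (r ^ p ^ n) ^ p ^ h \<le> nrm (E.lead ^ p ^ h / fact (p ^ h))"
    using lead r by (intro nrm_power_div_fact_ge) auto
  then have "w * (r ^ p ^ n) ^ p ^ h * \<rho> ^ (p ^ n * p ^ h)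
      \<le> nrm (E.lead ^ p ^ h / fact (p ^ h)) * \<rho> ^ (p ^ n * p ^ h)"
    using \<rho>0 by (intro mult_right_mono) auto
  also have "\<dots> \<le> 1"
    using bd \<sigma> \<rho>0 \<rho>(2) by (rule E.lead_growth_le)
  finally have "w * (r * \<rho>) ^ (p ^ n * p ^ h) \<le> 1"
    by (simp add: power_mult power_mult_distrib mult.assoc)
  with h w_pos show False
    by (simp add: field_simps)
qed

text \<open>The case k = 1 reduces every monomial, but at one radius only. For larger k = p^h, which
  gives a radius closer to 1, the base cases M < k (N - 1) are imported from there by
  \<open>reducible_change_radius\<close>.\<close>

lemma reducing_exponent:
  assumes e: "is_exp e (exponent \<mu>)" and e': "is_exp e' (- exponent \<mu>)"
    and \<mu>0: "nrm (\<mu> 0) = 1" and \<mu>: "\<And>i. i \<le> n \<Longrightarrow> nrm (\<mu> i) \<le> 1"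
  shows "reducing_exponent p nrm (exponent \<mu>) e e' (p ^ n)"
proof -
  interpret E: polynomial_exponent p nrm "exponent \<mu>" e e' "p ^ n"
    using e e' by (rule polynomial_exponent)
  have lead: "nrm E.lead = w"
    using nrm_euler_exponent_top[of \<mu> 1] \<mu>0 \<mu> by (simp add: E.lead_def del: of_nat_power)
  have N0: "0 < p ^ n"
    using p_ge_2 by simp
  have root: "\<exists>c. 0 < c \<and> c < 1 \<and> c ^ (p ^ n * k) = w" if "k > 0" for k
  proof (intro exI conjI)
    have pos: "0 < p ^ n * k"
      using N0 that by simp
    show "0 < root (p ^ n * k) w"
      using pos w_pos by (rule real_root_gt_zero)
    show "root (p ^ n * k) w < 1"
      using pos w_less_1 by simp
    show "root (p ^ n * k) w ^ (p ^ n * k) = w"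
      using pos w_pos by (simp only: real_root_pow_pos2 less_imp_le)
  qed
  have H_le: "nrm (fps_nth (E.H b) j) \<le> c ^ (j + b)"
    if "0 < c" "c < 1" "c ^ (p ^ n * k) = w" "b \<le> k" for c k b j
  proof -
    have "weighted k c (subst_monom fps_const 1 1 e * subst_monom fps_const 1 (1 + fps_X) e')"
      using that by (intro weighted_twist[of \<mu>] \<mu> e e') auto
    then show ?thesis
      using that(4) unfolding weighted_def E.twist_nth[symmetric] by blast
  qed
  have lead_ge: "w \<le> nrm (E.lead ^ p ^ h / fact (p ^ h))" for h
    using nrm_power_div_fact_ge[of E.lead 1] lead by simp
  have step: "\<exists>C\<ge>1. \<forall>M. E.reducible c C M"
    if c: "0 < c" "c < 1" "c ^ (p ^ n * p ^ h) = w"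
      and base: "\<And>M. M < p ^ h * (p ^ n - 1) \<Longrightarrow> E.reducible c C0 M" for c h C0
  proof -
    define C where "C = max (max 1 C0) (1 / (nrm (E.lead ^ p ^ h / fact (p ^ h)) * nrm (of_nat (p ^ h))))"
    have mono: "E.reducible c C M" if "E.reducible c C0 M" for M
    proof -
      have "C0 * c ^ i \<le> C * c ^ i" for i
        using c by (intro mult_right_mono) (auto simp: C_def)
      with that show ?thesis
        unfolding E.reducible_def by (meson order_trans)
    qed
    have "E.reducible c C M" for M
    proof (rule E.reducible_step)
      show "nrm (fps_nth (E.H b) j) \<le> c ^ (j + b)" if "b \<le> p ^ h" for b j
        using c that by (rule H_le)
      show "c ^ (p ^ n * p ^ h) \<le> nrm (E.lead ^ p ^ h / fact (p ^ h))"
        unfolding c(3) by (rule lead_ge)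
      show "1 / (nrm (E.lead ^ p ^ h / fact (p ^ h)) * nrm (of_nat (p ^ h))) \<le> C"
        unfolding C_def by (rule max.cobounded2)
    qed (use c p_ge_2 base mono in auto)
    moreover have "1 \<le> C"
      by (simp add: C_def)
    ultimately show ?thesis
      by blast
  qed
  obtain c1 where c1: "0 < c1" "c1 < 1" "c1 ^ (p ^ n * p ^ 0) = w"
    using root[of "p ^ 0"] by auto
  obtain C1 where C1: "C1 \<ge> 1" "\<And>M. E.reducible c1 C1 M"
    using step[OF c1, of 1] E.reducible_base[OF c1(1) order_refl] by auto
  have "\<exists>c C. 1 / \<sigma> < c \<and> c < 1 \<and> 0 \<le> C \<and> (\<forall>M. E.reducible c C M)" if \<sigma>: "\<sigma> > 1" for \<sigma>
  proof -
    obtain h where h: "1 / w < \<sigma> ^ (p ^ n * p ^ h)"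
      using geometric_unbounded[OF \<sigma>, of p "p ^ n" "1 / w"] p_ge_2 by auto
    obtain c where c: "0 < c" "c < 1" "c ^ (p ^ n * p ^ h) = w"
      using root[of "p ^ h"] p_ge_2 by auto
    define K where "K = p ^ h * p ^ n"
    have "E.reducible c (C1 / (c1 ^ K * c ^ K)) M" if "M < p ^ h * (p ^ n - 1)" for M
    proof (rule E.reducible_change_radius[OF C1(2)])
      have "p ^ h * (p ^ n - 1) \<le> K"
        unfolding K_def by (intro mult_left_mono) auto
      then show "M \<le> K"
        using that by simp
      show "p ^ n \<le> K"
        unfolding K_def using p_ge_2 by simp
    qed (use c c1 C1 in auto)
    then obtain C where "C \<ge> 1" "\<forall>M. E.reducible c C M"
      using step[OF c] by blast
    moreover have "1 / \<sigma> < c"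
    proof (rule power_less_imp_less_base)
      show "(1 / \<sigma>) ^ (p ^ n * p ^ h) < c ^ (p ^ n * p ^ h)"
        using h \<sigma> w_pos unfolding c(3) by (simp add: power_divide field_simps)
    qed (use c in simp)
    ultimately show ?thesis
      using c(2) by (intro exI[of _ c] exI[of _ C]) auto
  qed
  moreover have "E.lead \<noteq> 0"
    using lead w_pos by auto
  moreover have "nrm (fps_nth (fps_deriv (exponent \<mu>)) j) \<le> 1" for j
    using nrm_euler_exponent_le_one[OF \<mu>, where j = "j + 1"] by simp
  ultimately show ?thesis
    by unfold_locales
qed

end

section \<open>Pulling back by a power of the variable\<close>

text \<open>The left inverse of T -> T^q that selects the exponents divisible by q, often written
  U_q.\<close>

definition fps_section :: "nat \<Rightarrow> 'a::zero fps \<Rightarrow> 'a fps" where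
  "fps_section q f = Abs_fps (\<lambda>m. fps_nth f (q * m))"

lemma fps_section_nth [simp]: "fps_nth (fps_section q f) m = fps_nth f (q * m)"
  by (simp add: fps_section_def)

text \<open>The solution of \<open>T f' = a f + T v\<close> with \<open>f(0) = 0\<close>, where \<open>a(0) = 0\<close>.\<close>
function euler_solution :: "(nat \<Rightarrow> 'a::field) \<Rightarrow> (nat \<Rightarrow> 'a) \<Rightarrow> nat \<Rightarrow> 'a" where
  "euler_solution a v M = (v (M - 1) + (\<Sum>l<M. a (M - l) * euler_solution a v l)) / of_nat M"
  by auto
termination
  by (relation "Wellfounded.measure (\<lambda>(_, _, M). M)") auto

declare euler_solution.simps [simp del]

lemma fps_X_diff_op: "fps_X * diff_op (fps_deriv P) f = euler f - euler P * f"
  by (simp add: diff_op_def euler_def algebra_simps)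

context padic_extension
begin

abbreviation "pull q \<equiv> subst_monom (\<lambda>x. x) q (1::'a)"

lemma pull_nth: "fps_nth (pull q f) i = (if q dvd i then fps_nth f (i div q) else 0)"
  by (simp add: subst_monom_nth)

lemma fps_section_overconvergent:
  assumes "f \<in> overconvergent nrm" and "q > 0"
  shows "fps_section q f \<in> overconvergent nrm"
proof -
  obtain \<sigma> B where \<sigma>: "\<sigma> > 1" and B: "\<And>n. nrm (fps_nth f n) * \<sigma> ^ n \<le> B"
    using assms(1) unfolding overconvergent_iff bounded_at_def by blast
  have "bounded_at (\<sigma> ^ q) (fps_section q f)"
    unfolding bounded_at_def using B[of "q * n" for n] by (auto simp flip: power_mult)
  moreover have "\<sigma> ^ q > 1"
    using \<sigma> assms(2) by (rule one_less_power)
  ultimately show ?thesis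
    unfolding overconvergent_iff by blast
qed

lemma pull_overconvergent:
  assumes "f \<in> overconvergent nrm" and "q > 0"
  shows "pull q f \<in> overconvergent nrm"
proof -
  obtain \<sigma> B where \<sigma>: "\<sigma> > 1" and B: "\<And>n. nrm (fps_nth f n) * \<sigma> ^ n \<le> B"
    using assms(1) unfolding overconvergent_iff bounded_at_def by blast
  have B0: "0 \<le> B"
    using B[of 0] nrm_nonneg[of "fps_nth f 0"] by simp
  have pow: "root q \<sigma> ^ (q * m) = \<sigma> ^ m" for m
    using \<sigma> assms(2) by (simp add: power_mult)
  have "nrm (fps_nth (pull q f) n) * root q \<sigma> ^ n \<le> B" for n
    using B B0 assms(2) by (cases "q dvd n") (auto simp: pull_nth pow elim!: dvdE)
  then have "bounded_at (root q \<sigma>) (pull q f)"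
    unfolding bounded_at_def by blast
  moreover have "root q \<sigma> > 1"
    using \<sigma> assms(2) by simp
  ultimately show ?thesis
    unfolding overconvergent_iff by blast
qed

lemma fps_section_pull_mult:
  assumes "q > 0"
  shows "fps_section q (pull q a * f) = a * fps_section q f"
proof (rule fps_ext)
  fix m
  have "fps_nth (fps_section q (pull q a * f)) m
      = (\<Sum>i\<in>(*) q ` {0..m}. fps_nth (pull q a) i * fps_nth f (q * m - i))"
    unfolding fps_section_nth fps_mult_nth
  proof (rule sum.mono_neutral_right, simp, force, rule ballI)
    fix i
    assume i: "i \<in> {0..q * m} - (*) q ` {0..m}"
    have "\<not> q dvd i"
    proof
      assume "q dvd i"
      then obtain j where "i = q * j"
        by blast
      with i assms show False
        by auto
    qed
    then show "fps_nth (pull q a) i * fps_nth f (q * m - i) = 0"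
      by (simp add: pull_nth)
  qed
  also have "\<dots> = (\<Sum>i=0..m. fps_nth (pull q a) (q * i) * fps_nth f (q * (m - i)))"
    by (subst sum.reindex) (use assms in \<open>auto simp: inj_on_def diff_mult_distrib2\<close>)
  also have "\<dots> = fps_nth (a * fps_section q f) m"
    using assms by (simp add: fps_mult_nth pull_nth)
  finally show "fps_nth (fps_section q (pull q a * f)) m = fps_nth (a * fps_section q f) m" .
qed

end

context reducing_exponent
begin

definition nabla_pull :: "nat \<Rightarrow> 'a fps \<Rightarrow> 'a fps" where
  "nabla_pull q = diff_op (fps_deriv (pull q P))"

lemma fps_X_nabla_pull:
  assumes "q > 0"
  shows "fps_X * nabla_pull q f = euler f - of_nat q * (pull q (euler P) * f)"
  using assms by (simp add: nabla_pull_def fps_X_diff_op id_map.subst_monom_euler mult.assoc)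

text \<open>The section commutes with multiplication by pulled-back series and turns T d/dT into q T
  d/dT, so it carries the pulled-back operator to q times the original one.\<close>

lemma nabla_section:
  assumes "q > 0"
  shows "fps_section q (fps_X * nabla_pull q f) = of_nat q * (fps_X * nabla (fps_section q f))"
proof -
  have "fps_section q (euler f) = of_nat q * euler (fps_section q f)"
    by (simp add: fps_eq_iff fps_of_nat_mult_nth mult.assoc)
  moreover have "fps_section q (of_nat q * (pull q (euler P) * f)) = of_nat q * (euler P * fps_section q f)"
    using fps_section_pull_mult[OF assms, of "euler P" f]
    by (simp add: fps_eq_iff fps_of_nat_mult_nth)
  moreover have "fps_section q (g - h) = fps_section q g - fps_section q h" for g h :: "'a fps"
    by (simp add: fps_eq_iff)
  ultimately show ?thesis
    unfolding fps_X_nabla_pull[OF assms] fps_X_diff_op by (simp add: right_diff_distrib)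
qed

text \<open>Exponents i with i + 1 = q (m + 1) are those of the pullbacks of the differential forms
  T^m dT, hence the shift by one. The section of T times the equation reduces the claim to
  \<open>nabla_eq_polynomial\<close>.\<close>

lemma nabla_pull_eq_remainder:
  assumes f: "f \<in> overconvergent nrm" and q: "q > 0"
    and r: "\<And>i. fps_nth r i \<noteq> 0 \<Longrightarrow> \<exists>m. i + 1 = q * (m + 1) \<and> m + 1 < N"
    and eq: "nabla_pull q f = r"
  shows "r = 0"
proof -
  define s where "s = Abs_fps (\<lambda>m. fps_nth r (q * (m + 1) - 1))"
  have "fps_section q (fps_X * r) = fps_X * s"
  proof (rule fps_ext)
    fix m
    show "fps_nth (fps_section q (fps_X * r)) m = fps_nth (fps_X * s) m"
      using q by (cases m) (auto simp: s_def)
  qed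
  then have "of_nat q * (fps_X * nabla (fps_section q f)) = fps_X * s"
    using nabla_section[OF q, of f] eq by simp
  then have "fps_X * (of_nat q * nabla (fps_section q f)) = fps_X * s"
    by (simp add: mult_ac)
  then have "of_nat q * nabla (fps_section q f) = s"
    by simp
  then have "nabla (fps_const (of_nat q) * fps_section q f) = s"
    unfolding diff_op_const_mult unfolding fps_of_nat .
  moreover have "fps_const (of_nat q) * fps_section q f \<in> overconvergent nrm"
    by (intro overconvergent_mult[OF overconvergent_polynomial[of 1] fps_section_overconvergent[OF f q]]) auto
  moreover have "fps_nth s m = 0" if "N \<le> m + 1" for m
  proof (rule ccontr)
    assume "fps_nth s m \<noteq> 0"
    then have "fps_nth r (q * (m + 1) - 1) \<noteq> 0"
      by (simp add: s_def)
    then obtain m' where "q * (m + 1) - 1 + 1 = q * (m' + 1)" "m' + 1 < N"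
      using r by blast
    moreover from this have "q * (m + 1) = q * (m' + 1)"
      using q by simp
    ultimately show False
      using q that by simp
  qed
  ultimately have "s = 0"
    by (intro nabla_eq_polynomial)
  have "fps_nth r i = 0" for i
  proof (rule ccontr)
    assume nz: "fps_nth r i \<noteq> 0"
    then obtain m where "i + 1 = q * (m + 1)"
      using r by blast
    then have "i = q * (m + 1) - 1"
      by simp
    then have "fps_nth s m = fps_nth r i"
      by (simp add: s_def)
    with \<open>s = 0\<close> nz show False
      by simp
  qed
  then show ?thesis
    by (simp add: fps_eq_iff)
qed

text \<open>
  On the part of \<open>v\<close> with exponents \<open>M - 1\<close>, \<open>q\<close> not dividing \<open>M\<close>, the Euler operator dominates:
  \<open>1 / M\<close> is at most \<open>1 / (p q)\<close> in norm, while the twist is a multiple of \<open>q\<close>.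
\<close>
lemma nabla_pull_surj_coprime_part:
  assumes v: "v \<in> overconvergent nrm" and q: "q = p ^ j"
    and zero: "\<And>M. M > 0 \<Longrightarrow> q dvd M \<Longrightarrow> fps_nth v (M - 1) = 0"
  obtains f where "f \<in> overconvergent nrm" and "v = nabla_pull q f"
proof -
  have q0: "q > 0"
    using p_ge_2 by (simp add: q)
  define a where "a = of_nat q * pull q (euler P)"
  have a_nth: "fps_nth a i = (if q dvd i then of_nat q * (of_nat (i div q) * fps_nth P (i div q)) else 0)" for i
    by (simp add: a_def fps_of_nat_mult_nth pull_nth)
  define F where "F = euler_solution (fps_nth a) (fps_nth v)"
  define f where "f = Abs_fps F"
  have F_rec: "of_nat M * F M = fps_nth v (M - 1) + (\<Sum>l<M. fps_nth a (M - l) * F l)" if "M > 0" for M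
    using that unfolding F_def by (subst euler_solution.simps) simp
  \<comment> \<open>All exponents of a are divisible by q, so the recursion respects classes modulo
    q and F stays on the exponents where |1/M| is under control.\<close>
  have F_zero: "F M = 0" if "q dvd M" for M
    using that
  proof (induction M rule: less_induct)
    case (less M)
    show ?case
    proof (cases "M = 0")
      case True
      then show ?thesis
        unfolding F_def by (subst euler_solution.simps) simp
    next
      case False
      have "fps_nth a (M - l) * F l = 0" if "l < M" for l
      proof (cases "q dvd l")
        case True
        then show ?thesis
          using less.IH that by simp
      next
        case False
        then have "\<not> q dvd M - l"
          using less.prems that dvd_diffD1[of q M "l"] by (metis dvd_diff_nat diff_diff_cancel less_imp_le)
        then show ?thesis
          by (simp add: a_nth)
      qed
      then have "(\<Sum>l<M. fps_nth a (M - l) * F l) = 0"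
        by (intro sum.neutral) auto
      then have "of_nat M * F M = 0"
        using F_rec[of M] zero[of M] False less.prems by simp
      then show ?thesis
        using False by simp
    qed
  qed
  have "fps_X * v = euler f - a * f"
  proof (rule fps_ext)
    fix M
    show "fps_nth (fps_X * v) M = fps_nth (euler f - a * f) M"
    proof (cases "M = 0")
      case True
      then show ?thesis
        by (simp add: a_nth)
    next
      case False
      have "fps_nth (a * f) M = (\<Sum>l\<le>M. fps_nth a (M - l) * F l)"
        unfolding mult.commute[of a f] fps_mult_nth
        by (simp add: f_def atMost_atLeast0 mult.commute)
      also have "\<dots> = (\<Sum>l<M. fps_nth a (M - l) * F l)"
        by (simp add: lessThan_Suc_atMost[symmetric] a_nth)
      finally show ?thesis
        using False F_rec[of M] by (simp add: f_def)
    qed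
  qed
  also have "\<dots> = fps_X * nabla_pull q f"
    unfolding fps_X_nabla_pull[OF q0] a_def by (simp add: mult.assoc)
  finally have "v = nabla_pull q f"
    by simp
  obtain \<sigma>0 B0 where \<sigma>0: "\<sigma>0 > 1" and B0: "\<And>i. nrm (fps_nth v i) * \<sigma>0 ^ i \<le> B0"
    using v unfolding overconvergent_iff bounded_at_def by blast
  \<comment> \<open>The twist a has degree at most q N, so with \<sigma>^(q N) <= p its growth on
    the circle is paid for by the factor p that q / M gains when q does not divide M.\<close>
  define \<sigma> where "\<sigma> = min \<sigma>0 (root (q * N) p)"
  have qN: "q * N > 0"
    using q0 N_pos by simp
  have \<sigma>: "1 < \<sigma>" "\<sigma> \<le> \<sigma>0"
    using \<sigma>0 qN p_ge_2 by (auto simp: \<sigma>_def)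
  have "\<sigma> ^ (q * N) \<le> root (q * N) p ^ (q * N)"
    using \<sigma> by (intro power_mono) (auto simp: \<sigma>_def)
  then have \<sigma>_pow: "\<sigma> ^ (q * N) \<le> p"
    using qN by (simp add: real_root_pow_pos2 del: power_mult)
  have "bounded_at \<sigma> v"
    using B0 bounded_at_mono[of \<sigma>0 v \<sigma>] \<sigma> unfolding bounded_at_def by force
  then obtain B where B: "\<And>i. nrm (fps_nth v i) * \<sigma> ^ i \<le> B"
    unfolding bounded_at_def by blast
  have Bpos: "0 \<le> B"
    using B[of 0] nrm_nonneg[of "fps_nth v 0"] by simp
  define C where "C = B * \<sigma> * real p ^ j"
  have C: "0 \<le> C"
    using Bpos \<sigma> by (simp add: C_def)
  have nrm_q: "nrm (of_nat q) = 1 / real p ^ j"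
    by (simp add: q nrm_power nrm_p power_divide)
  have nrm_M: "1 / real p ^ j * real p \<le> nrm (of_nat M)" if "\<not> q dvd M" for M
  proof -
    have M0: "M \<noteq> 0"
    proof
      assume "M = 0"
      with that show False
        by simp
    qed
    have "\<not> int p ^ j dvd int M"
      using that by (simp add: q flip: of_nat_power)
    then have "multiplicity (int p) (int M) < j"
      using multiplicity_dvd'[of j "int p" "int M"] by (meson not_le)
    then have "real p ^ Suc (multiplicity (int p) (int M)) \<le> real p ^ j"
      using p_ge_2 by (intro power_increasing) auto
    then have "1 / real p ^ j * real p \<le> 1 / real p ^ multiplicity (int p) (int M)"
      using p_ge_2 by (simp add: divide_simps mult.commute)
    also have "\<dots> = nrm (of_nat M)"
      using nrm_of_int[of "int M"] M0 by simp
    finally show ?thesis .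
  qed
  have "nrm (F M) * \<sigma> ^ M \<le> C" for M
  proof (induction M rule: less_induct)
    case (less M)
    show ?case
    proof (cases "q dvd M")
      case True
      then show ?thesis
        using F_zero C by simp
    next
      case False
      then have M0: "M > 0"
        by (metis dvd_0_right gr0I)
      define A where "A = C * nrm (of_nat M) / \<sigma> ^ M"
      have A0: "0 \<le> A"
        using C \<sigma> by (simp add: A_def nrm_nonneg)
      have nM: "1 / real p ^ j * real p \<le> nrm (of_nat M)"
        using False by (rule nrm_M)
      have "nrm (fps_nth v (M - 1)) * \<sigma> ^ M \<le> C * nrm (of_nat M)"
      proof -
        have "\<sigma> ^ M = \<sigma> * \<sigma> ^ (M - 1)"
          using M0 by (simp flip: power_Suc)
        then have "nrm (fps_nth v (M - 1)) * \<sigma> ^ M \<le> B * \<sigma>"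
          using mult_right_mono[OF B[of "M - 1"], of \<sigma>] \<sigma> by (simp add: mult_ac)
        also have "\<dots> \<le> B * \<sigma> * (real p ^ j * (1 / real p ^ j * real p))"
          using p_ge_2 mult_nonneg_nonneg[of B \<sigma>] Bpos \<sigma> by (simp add: mult_le_cancel_left1 not_less)
        also have "\<dots> \<le> C * nrm (of_nat M)"
          unfolding C_def mult.assoc using nM Bpos \<sigma> by (intro mult_left_mono) auto
        finally show ?thesis .
      qed
      then have 1: "nrm (fps_nth v (M - 1)) \<le> A"
        using \<sigma> by (simp add: A_def field_simps)
      have 2: "nrm (\<Sum>l<M. fps_nth a (M - l) * F l) \<le> A"
      proof (rule nrm_sum_le[OF A0])
        fix l
        assume l: "l \<in> {..<M}"
        show "nrm (fps_nth a (M - l) * F l) \<le> A"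
        proof (cases "q dvd M - l \<and> M - l \<le> q * N")
          case True
          have P_le: "nrm (of_nat i * fps_nth P i) \<le> 1" for i
            using deriv_P_integral[of "i - 1"] by (cases i) auto
          have "nrm (fps_nth a (M - l)) \<le> 1 / real p ^ j * 1"
            using True unfolding a_nth nrm_q[symmetric] by (simp add: nrm_mult_le P_le del: mult_1_right)
          then have "nrm (fps_nth a (M - l)) * real p \<le> nrm (of_nat M)"
            using nM mult_right_mono[of "nrm (fps_nth a (M - l))" "1 / real p ^ j" "real p"] by simp
          moreover have "\<sigma> ^ (M - l) \<le> real p"
            using \<sigma>_pow power_increasing[of "M - l" "q * N" \<sigma>] True \<sigma> by linarith
          ultimately have "nrm (fps_nth a (M - l)) * \<sigma> ^ (M - l) \<le> nrm (of_nat M)"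
            using mult_left_mono[of "\<sigma> ^ (M - l)" "real p" "nrm (fps_nth a (M - l))"] nrm_nonneg
            by (meson order_trans)
          then have "nrm (fps_nth a (M - l)) * \<sigma> ^ (M - l) * (nrm (F l) * \<sigma> ^ l) \<le> nrm (of_nat M) * C"
            using less.IH l \<sigma> by (intro mult_mono) (auto simp: nrm_nonneg)
          moreover have "\<sigma> ^ M = \<sigma> ^ (M - l) * \<sigma> ^ l"
            using l by (simp flip: power_add)
          ultimately show ?thesis
            using \<sigma> by (simp add: A_def nrm_mult field_simps)
        next
          case False
          then have "fps_nth a (M - l) = 0"
            using P_above q0 by (auto simp: a_nth elim!: dvdE)
          then show ?thesis
            using A0 by simp
        qed
      qed
      have "nrm (of_nat M * F M) \<le> A"
        unfolding F_rec[OF M0] using 1 2 by (rule nrm_add_le)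
      moreover have "0 < nrm (of_nat M)"
        using M0 by (intro nrm_pos) simp
      ultimately show ?thesis
        using \<sigma> by (simp add: A_def nrm_mult field_simps)
    qed
  qed
  then have "f \<in> overconvergent nrm"
    unfolding overconvergent_iff bounded_at_def f_def using \<sigma>(1) by auto
  then show thesis
    using \<open>v = nabla_pull q f\<close> that by blast
qed

lemma nabla_pull_surj:
  assumes v: "v \<in> overconvergent nrm" and q: "q = p ^ j"
  obtains f r where "f \<in> overconvergent nrm" and "v = nabla_pull q f + r"
    and "\<And>i. fps_nth r i \<noteq> 0 \<Longrightarrow> \<exists>m. i + 1 = q * (m + 1) \<and> m + 1 < N"
proof -
  have q0: "q > 0"
    using p_ge_2 by (simp add: q)
  define u where "u = Abs_fps (\<lambda>m. fps_nth v (q * (m + 1) - 1))"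
  have u_section: "fps_section q (fps_X * v) = fps_X * u"
  proof (rule fps_ext)
    fix m
    show "fps_nth (fps_section q (fps_X * v)) m = fps_nth (fps_X * u) m"
      using q0 by (cases m) (auto simp: u_def)
  qed
  have "fps_X * u \<in> overconvergent nrm"
    unfolding u_section[symmetric] using q0
    by (intro fps_section_overconvergent overconvergent_mult[OF overconvergent_polynomial[of 2] v]) auto
  then obtain \<sigma> B where \<sigma>: "\<sigma> > 1" and B: "\<And>i. nrm (fps_nth (fps_X * u) i) * \<sigma> ^ i \<le> B"
    unfolding overconvergent_iff bounded_at_def by blast
  have "nrm (fps_nth u i) * \<sigma> ^ i \<le> B" for i
  proof -
    have "nrm (fps_nth u i) * \<sigma> ^ i \<le> nrm (fps_nth u i) * \<sigma> ^ Suc i"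
      using \<sigma> by (intro mult_left_mono power_increasing) (auto simp: nrm_nonneg)
    with B[of "Suc i"] show ?thesis
      by simp
  qed
  then have "u \<in> overconvergent nrm"
    unfolding overconvergent_iff bounded_at_def using \<sigma> by blast
  then obtain g R where g: "g \<in> overconvergent nrm" and u: "u = nabla g + R"
    and R: "\<And>i. N \<le> i + 1 \<Longrightarrow> fps_nth R i = 0"
    using nabla_surj_mod_polynomials by metis
  \<comment> \<open>The factor 1/q undoes the q that the Euler operator produces under T -> T^q, so
    that T times the image of f1 is the pullback of T \<nabla> g.\<close>
  define f1 where "f1 = fps_const (1 / of_nat q) * pull q g"
  define r where "r = Abs_fps (\<lambda>i. fps_nth (pull q (fps_X * R)) (i + 1))"
  have r: "fps_X * r = pull q (fps_X * R)"
  proof (rule fps_ext)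
    fix i
    show "fps_nth (fps_X * r) i = fps_nth (pull q (fps_X * R)) i"
      by (cases i) (auto simp: r_def)
  qed
  have r_supp: "\<exists>m. i + 1 = q * (m + 1) \<and> m + 1 < N" if "fps_nth r i \<noteq> 0" for i
  proof -
    have "q dvd i + 1" and nz: "fps_nth (fps_X * R) ((i + 1) div q) \<noteq> 0"
      using that by (auto simp: r_def pull_nth split: if_splits)
    then obtain l where l: "i + 1 = q * l"
      by blast
    then have "fps_nth (fps_X * R) l \<noteq> 0"
      using nz q0 by simp
    then obtain m where "l = m + 1" "fps_nth R m \<noteq> 0"
      by (cases l) auto
    with R[of m] l show ?thesis
      by (intro exI[of _ m]) (auto simp: not_le[symmetric])
  qed
  have f1: "f1 \<in> overconvergent nrm"
    unfolding f1_def
    by (intro overconvergent_mult[OF overconvergent_polynomial[of 1] pull_overconvergent[OF g q0]]) auto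
  have q_inv: "of_nat q * fps_const (1 / of_nat q) = (1 :: 'a fps)"
    using q0 by (simp add: fps_of_nat[symmetric] del: fps_of_nat)
  have "fps_X * nabla_pull q f1 = pull q (fps_X * nabla g)"
  proof -
    have "euler f1 = pull q (euler g)"
      using q0 by (auto simp: fps_eq_iff f1_def pull_nth elim!: dvdE)
    moreover have "of_nat q * (pull q (euler P) * f1) = (of_nat q * fps_const (1 / of_nat q)) * (pull q (euler P) * pull q g)"
      unfolding f1_def by (simp only: mult_ac)
    ultimately show ?thesis
      using q0 unfolding fps_X_nabla_pull[OF q0] fps_X_diff_op q_inv
      by (simp add: id_map.subst_monom_mult id_map.subst_monom_add id_map.subst_monom_minus
          diff_conv_add_uminus del: add_uminus_conv_diff)
  qed
  then have main: "fps_X * (nabla_pull q f1 + r) = pull q (fps_X * u)"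
    by (simp add: distrib_left r u id_map.subst_monom_add)
  define v' where "v' = v - (nabla_pull q f1 + r)"
  have zero: "fps_nth v' (M - 1) = 0" if M: "M > 0" "q dvd M" for M
  proof -
    obtain m where m: "M = q * m"
      using M(2) by blast
    have "fps_nth v' (M - 1) = fps_nth (fps_X * v') M"
      using M(1) by simp
    also have "fps_X * v' = fps_X * v - pull q (fps_X * u)"
      by (simp add: v'_def right_diff_distrib main)
    also have "fps_nth \<dots> M = fps_nth (fps_section q (fps_X * v)) m - fps_nth (fps_X * u) m"
      using q0 by (simp add: m pull_nth)
    also have "\<dots> = 0"
      by (simp add: u_section)
    finally show ?thesis .
  qed
  \<comment> \<open>By \<open>main\<close>, T times \<open>nabla_pull q f1 + r\<close> is the
    pullback of an overconvergent series. Hence \<open>v'\<close> is overconvergent even though r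
    comes from an abstract remainder, and by \<open>zero\<close> the recursive solution applies to
    it.\<close>
  have "pull q (fps_X * u) \<in> overconvergent nrm"
    using \<open>fps_X * u \<in> overconvergent nrm\<close> q0 by (rule pull_overconvergent)
  then obtain \<sigma>' B' where \<sigma>': "\<sigma>' > 1" and B': "\<And>i. nrm (fps_nth (pull q (fps_X * u)) i) * \<sigma>' ^ i \<le> B'"
    unfolding overconvergent_iff bounded_at_def by blast
  have "nrm (fps_nth (nabla_pull q f1 + r) i) * \<sigma>' ^ i \<le> B'" for i
  proof -
    have "fps_nth (nabla_pull q f1 + r) i = fps_nth (pull q (fps_X * u)) (Suc i)"
      unfolding main[symmetric] by (simp del: fps_add_nth)
    moreover have "nrm (fps_nth (pull q (fps_X * u)) (Suc i)) * \<sigma>' ^ i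
        \<le> nrm (fps_nth (pull q (fps_X * u)) (Suc i)) * \<sigma>' ^ Suc i"
      using \<sigma>' by (intro mult_left_mono power_increasing) (auto simp: nrm_nonneg)
    ultimately show ?thesis
      using B'[of "Suc i"] by simp
  qed
  then have "nabla_pull q f1 + r \<in> overconvergent nrm"
    unfolding overconvergent_iff bounded_at_def using \<sigma>' by blast
  then have "fps_const (-1) * (nabla_pull q f1 + r) \<in> overconvergent nrm"
    by (intro overconvergent_mult[OF overconvergent_polynomial[of 1]]) auto
  then have "v + fps_const (-1) * (nabla_pull q f1 + r) \<in> overconvergent nrm"
    using v by (rule overconvergent_add[rotated])
  moreover have "v + fps_const (-1) * (nabla_pull q f1 + r) = v'"
    by (simp add: v'_def fps_eq_iff)
  ultimately obtain f2 where f2: "f2 \<in> overconvergent nrm" "v' = nabla_pull q f2"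
    using nabla_pull_surj_coprime_part[OF _ q zero] by auto
  have "v = nabla_pull q (f1 + f2) + r"
    using f2(2) unfolding v'_def nabla_pull_def diff_op_add by (simp add: algebra_simps)
  then show thesis
    using that overconvergent_add[OF f1 f2(1)] r_supp by blast
qed

end

section \<open>The quotient by the boundaries\<close>

text \<open>Expressing B1 modulo W through B2 maps it into the span of B2; independence modulo W
  makes the map injective with independent image, and the exchange bound applies. This makes the
  definite description in \<open>quotient_dim\<close> meaningful.\<close>

lemma quotient_basis_card_le:
  assumes B1: "quotient_basis V W B1" and B2: "quotient_basis V W B2"
    and W_add: "\<And>x y. x \<in> W \<Longrightarrow> y \<in> W \<Longrightarrow> x + y \<in> W"
    and W_scale: "\<And>c x. x \<in> W \<Longrightarrow> fps_scale c x \<in> W" and W_0: "0 \<in> W"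
  shows "card B1 \<le> card B2"
proof -
  have fin: "finite B1" "finite B2"
    using B1 B2 by (auto simp: quotient_basis_def)
  have W_sum: "sum h A \<in> W" if "\<And>i. i \<in> A \<Longrightarrow> h i \<in> W" for h :: "'a fps \<Rightarrow> 'a fps" and A
    using that by (induction A rule: infinite_finite_induct) (auto intro: W_add W_0)
  have "\<forall>v\<in>V. \<exists>c. v - (\<Sum>b\<in>B2. fps_scale (c b) b) \<in> W"
    using B2 by (auto simp: quotient_basis_def)
  then obtain c where c: "\<And>v. v \<in> V \<Longrightarrow> v - (\<Sum>b\<in>B2. fps_scale (c v b) b) \<in> W"
    by metis
  define \<phi> where "\<phi> v = (\<Sum>b\<in>B2. fps_scale (c v b) b)" for v
  have zero: "k b = 0" if sum0: "(\<Sum>b\<in>B1. fps_scale (k b) (\<phi> b)) = 0" and b: "b \<in> B1" for k b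
  proof -
    have "(\<Sum>b\<in>B1. fps_scale (k b) (b - \<phi> b)) \<in> W"
      using B1 c by (intro W_sum W_scale) (auto simp: \<phi>_def quotient_basis_def)
    then have "(\<Sum>b\<in>B1. fps_scale (k b) b) \<in> W"
      using sum0 by (simp add: fps_vs.scale_right_diff_distrib sum_subtractf)
    with B1 b show ?thesis
      by (auto simp: quotient_basis_def)
  qed
  have inj: "inj_on \<phi> B1"
  proof (rule inj_onI, rule ccontr)
    fix x y
    assume xy: "x \<in> B1" "y \<in> B1" "\<phi> x = \<phi> y" "x \<noteq> y"
    define k where "k b = (if b = x then 1 else if b = y then - 1 else 0 :: 'a)" for b
    have "(\<Sum>b\<in>B1. fps_scale (k b) (\<phi> b)) = (\<Sum>b\<in>{x, y}. fps_scale (k b) (\<phi> b))"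
      using fin xy by (intro sum.mono_neutral_right) (auto simp: k_def fps_scale_def)
    also have "\<dots> = fps_scale 1 (\<phi> x) + fps_scale (- 1) (\<phi> y)"
      using xy(4) by (auto simp: k_def)
    also have "\<dots> = 0"
      unfolding xy(3) by (simp add: fps_scale_def fps_eq_iff)
    finally have "k x = 0"
      using xy(1) by (rule zero)
    then show False
      by (simp add: k_def)
  qed
  have indep: "fps_vs.independent (\<phi> ` B1)"
  proof (rule fps_vs.independent_if_scalars_zero)
    fix f x
    assume sum0: "(\<Sum>x\<in>\<phi> ` B1. fps_scale (f x) x) = 0" and x: "x \<in> \<phi> ` B1"
    then obtain b where b: "b \<in> B1" "x = \<phi> b"
      by blast
    have "(\<Sum>b\<in>B1. fps_scale (f (\<phi> b)) (\<phi> b)) = 0"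
      using sum0 by (simp add: sum.reindex[OF inj])
    then have "f (\<phi> b) = 0"
      using b(1) by (rule zero)
    then show "f x = 0"
      by (simp add: b)
  qed (use fin in simp)
  have "\<phi> ` B1 \<subseteq> fps_vs.span B2"
    unfolding \<phi>_def by (rule image_subsetI) (intro fps_vs.span_sum fps_vs.span_scale fps_vs.span_base)
  then have "card (\<phi> ` B1) \<le> card B2"
    using fps_vs.independent_span_bound[OF fin(2) indep] by blast
  then show ?thesis
    by (simp add: card_image[OF inj])
qed

lemma (in padic_extension) boundaries_subspace:
  shows "x \<in> boundaries nrm L \<Longrightarrow> y \<in> boundaries nrm L \<Longrightarrow> x + y \<in> boundaries nrm L"
    and "x \<in> boundaries nrm L \<Longrightarrow> fps_scale c x \<in> boundaries nrm L"
    and "0 \<in> boundaries nrm L"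
proof -
  show "x + y \<in> boundaries nrm L" if "x \<in> boundaries nrm L" "y \<in> boundaries nrm L"
    using that unfolding boundaries_def by (auto simp: diff_op_add[symmetric] intro!: imageI overconvergent_add)
  show "fps_scale c x \<in> boundaries nrm L" if "x \<in> boundaries nrm L"
  proof -
    have "fps_const c * f \<in> overconvergent nrm" if "f \<in> overconvergent nrm" for f
      by (rule overconvergent_mult[OF overconvergent_polynomial[of 1] that]) auto
    with that show ?thesis
      unfolding boundaries_def fps_scale_def by (auto simp: diff_op_const_mult[symmetric])
  qed
  have "0 = diff_op L 0" "(0 :: 'a fps) \<in> overconvergent nrm"
    by (auto simp: diff_op_0 intro: overconvergent_polynomial[of 0])
  then show "0 \<in> boundaries nrm L"
    unfolding boundaries_def by blast
qed

lemma (in padic_extension) quotient_dim_boundaries: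
  assumes "quotient_basis V (boundaries nrm L) B"
  shows "quotient_dim V (boundaries nrm L) = card B"
  unfolding quotient_dim_def
proof (rule the_equality)
  show "\<exists>B'. quotient_basis V (boundaries nrm L) B' \<and> card B' = card B"
    using assms by blast
  fix m
  assume "\<exists>B'. quotient_basis V (boundaries nrm L) B' \<and> card B' = m"
  then show "m = card B"
    using assms quotient_basis_card_le[OF _ _ boundaries_subspace] by (metis le_antisym)
qed

text \<open>A solution f satisfies (f / e)' = 0, so a nonzero overconvergent one would make e
  overconvergent.\<close>

lemma (in padic_extension) H0_trivial:
  assumes e: "is_exp e P" and e': "is_exp e' (- P)" and "e \<notin> overconvergent nrm"
  shows "H0 nrm (fps_deriv P) = {0}"
proof -
  have "f = 0" if f: "f \<in> overconvergent nrm" and eq: "diff_op (fps_deriv P) f = 0" for f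
  proof (rule ccontr)
    assume nz: "f \<noteq> 0"
    have ee': "e * e' = 1"
      using e e' by (rule is_exp_minus)
    then have f_eq: "f = e * (e' * f)"
      by (simp add: mult.assoc[symmetric])
    have "e * fps_deriv (e' * f) = 0"
      unfolding diff_op_exp[OF e, symmetric] f_eq[symmetric] by (rule eq)
    then have "fps_deriv (e' * f) = 0"
      using ee' by auto
    then obtain c where c: "e' * f = fps_const c"
      unfolding fps_deriv_eq_0_iff by blast
    then have "f = e * fps_const c"
      using f_eq by simp
    with nz have "c \<noteq> 0"
      by auto
    then have "e = fps_const (1 / c) * f"
      using \<open>f = e * fps_const c\<close> by (simp add: fps_eq_iff)
    moreover have "fps_const (1 / c) * f \<in> overconvergent nrm"
      by (rule overconvergent_mult[OF overconvergent_polynomial[of 1] f]) auto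
    ultimately show False
      using assms(3) by simp
  qed
  moreover have "(0 :: 'a fps) \<in> overconvergent nrm"
    by (rule overconvergent_polynomial[of 0]) simp
  ultimately show ?thesis
    unfolding H0_def by (auto simp: diff_op_0)
qed

text \<open>Conjugation by the overconvergent unit u = exp S removes S from the exponent.
  Accordingly the representatives T^(q(m+1)-1), m < N - 1, of the pulled-back cokernel are
  multiplied by u.\<close>

lemma (in reducing_exponent) quotient_basis_twisted_pull:
  assumes q: "q = p ^ j" and u: "is_exp u S" "u \<in> overconvergent nrm"
    and u': "is_exp u' (- S)" "u' \<in> overconvergent nrm"
  defines "b \<equiv> \<lambda>m. u * fps_X ^ (q * (m + 1) - 1)"
  shows "quotient_basis (overconvergent nrm) (boundaries nrm (fps_deriv (S + pull q P))) (b ` {..<N - 1})"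
    and "card (b ` {..<N - 1}) = N - 1"
proof -
  define L where "L = fps_deriv (S + pull q P)"
  have q0: "q > 0"
    using p_ge_2 by (simp add: q)
  have uu': "u * u' = 1"
    using u(1) u'(1) by (rule is_exp_minus)
  have twist: "diff_op L (u * f) = u * nabla_pull q f" for f
    using is_exp_fps_deriv[OF u(1)]
    by (simp add: L_def nabla_pull_def diff_op_def algebra_simps)
  have exponents: "q * (m + 1) - 1 = q * (m' + 1) - 1 \<longleftrightarrow> m = m'" for m m'
  proof
    assume eq: "q * (m + 1) - 1 = q * (m' + 1) - 1"
    have "q * (m + 1) > 0" "q * (m' + 1) > 0"
      using q0 by auto
    with eq have "q * (m + 1) = q * (m' + 1)"
      by linarith
    with q0 show "m = m'"
      by simp
  qed simp
  have inj: "inj_on b {..<N - 1}"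
  proof (rule inj_onI)
    fix m m'
    assume "b m = b m'"
    then have "u' * b m = u' * b m'"
      by simp
    then have "(u * u') * fps_X ^ (q * (m + 1) - 1) = (u * u') * fps_X ^ (q * (m' + 1) - 1)"
      unfolding b_def by (simp only: mult_ac)
    then have "(fps_X :: 'a fps) ^ (q * (m + 1) - 1) = fps_X ^ (q * (m' + 1) - 1)"
      by (simp add: uu')
    then have "fps_nth ((fps_X :: 'a fps) ^ (q * (m + 1) - 1)) (q * (m + 1) - 1)
        = fps_nth (fps_X ^ (q * (m' + 1) - 1)) (q * (m + 1) - 1)"
      by simp
    then show "m = m'"
      using exponents[of m m'] by (auto simp: fps_X_power_nth split: if_splits)
  qed
  show "card (b ` {..<N - 1}) = N - 1"
    by (simp only: card_image[OF inj] card_lessThan)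
  define r where "r c = (\<Sum>m<N - 1. fps_const (c m) * fps_X ^ (q * (m + 1) - 1))" for c :: "nat \<Rightarrow> 'a"
  have sum_b: "(\<Sum>x\<in>b ` {..<N - 1}. fps_scale (k x) x) = u * r (\<lambda>m. k (b m))" for k
    unfolding sum.reindex[OF inj] r_def sum_distrib_left
    by (intro sum.cong refl) (simp add: fps_scale_def b_def mult_ac)
  have r_nth: "fps_nth (r c) (q * (m + 1) - 1) = c m" if "m < N - 1" for c m
  proof -
    have "fps_nth (r c) (q * (m + 1) - 1) = (\<Sum>m'<N - 1. if m' = m then c m else 0)"
      unfolding r_def fps_sum_nth
      by (intro sum.cong refl) (simp only: fps_mult_left_const_nth fps_X_power_nth exponents, auto)
    also have "\<dots> = c m"
      using that by simp
    finally show ?thesis .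
  qed
  have r_supp: "\<exists>m. i + 1 = q * (m + 1) \<and> m + 1 < N" if nz: "fps_nth (r c) i \<noteq> 0" for c i
  proof -
    obtain m where "m < N - 1" "i = q * (m + 1) - 1"
      using nz unfolding r_def fps_sum_nth by (auto simp: fps_X_power_nth elim!: sum.not_neutral_contains_not_neutral split: if_splits)
    with q0 show ?thesis
      by (intro exI[of _ m]) auto
  qed
  show "quotient_basis (overconvergent nrm) (boundaries nrm (fps_deriv (S + pull q P))) (b ` {..<N - 1})"
    unfolding quotient_basis_def L_def[symmetric]
  proof (intro conjI ballI allI impI)
    show "b ` {..<N - 1} \<subseteq> overconvergent nrm"
    proof (rule image_subsetI)
      fix m
      show "b m \<in> overconvergent nrm"
        unfolding b_def
        by (rule overconvergent_mult[OF u(2)], rule overconvergent_polynomial[of "Suc (q * (m + 1) - 1)"])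
          (simp add: fps_X_power_nth)
    qed
  next
    fix v
    assume v: "v \<in> overconvergent nrm"
    obtain f s where f: "f \<in> overconvergent nrm" and eq: "u' * v = nabla_pull q f + s"
      and s: "\<And>i. fps_nth s i \<noteq> 0 \<Longrightarrow> \<exists>m. i + 1 = q * (m + 1) \<and> m + 1 < N"
      using nabla_pull_surj[OF overconvergent_mult[OF u'(2) v] q] by metis
    have s_r: "s = r (\<lambda>m. fps_nth s (q * (m + 1) - 1))"
    proof (rule fps_ext)
      fix i
      show "fps_nth s i = fps_nth (r (\<lambda>m. fps_nth s (q * (m + 1) - 1))) i"
      proof (cases "\<exists>m. i + 1 = q * (m + 1) \<and> m + 1 < N")
        case True
        then obtain m where m: "i + 1 = q * (m + 1)" "m + 1 < N"
          by blast
        then have "i = q * (m + 1) - 1" "m < N - 1"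
          by auto
        then show ?thesis
          using r_nth[of m "\<lambda>m. fps_nth s (q * (m + 1) - 1)"] by simp
      next
        case False
        then have "fps_nth s i = 0" "fps_nth (r (\<lambda>m. fps_nth s (q * (m + 1) - 1))) i = 0"
          using s r_supp by blast+
        then show ?thesis
          by simp
      qed
    qed
    \<comment> \<open>The coefficients are indexed by the basis vectors themselves, so m is
      recovered from b m by injectivity.\<close>
    define k where "k x = fps_nth s (q * (inv_into {..<N - 1} b x + 1) - 1)" for x
    have "r (\<lambda>m. k (b m)) = r (\<lambda>m. fps_nth s (q * (m + 1) - 1))"
      unfolding r_def
    proof (intro sum.cong refl)
      fix m
      assume "m \<in> {..<N - 1}"
      then show "fps_const (k (b m)) * fps_X ^ (q * (m + 1) - 1)
          = fps_const (fps_nth s (q * (m + 1) - 1)) * fps_X ^ (q * (m + 1) - 1)"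
        by (simp only: k_def inv_into_f_f[OF inj])
    qed
    then have "r (\<lambda>m. k (b m)) = s"
      unfolding s_r[symmetric] .
    then have "v - (\<Sum>x\<in>b ` {..<N - 1}. fps_scale (k x) x) = (u * u') * v - u * s"
      unfolding sum_b by (simp add: uu')
    also have "\<dots> = u * (u' * v - s)"
      by (simp add: algebra_simps)
    also have "\<dots> = diff_op L (u * f)"
      unfolding twist eq by simp
    finally have "v - (\<Sum>x\<in>b ` {..<N - 1}. fps_scale (k x) x) \<in> boundaries nrm L"
      unfolding boundaries_def using overconvergent_mult[OF u(2) f] by blast
    then show "\<exists>c. v - (\<Sum>x\<in>b ` {..<N - 1}. fps_scale (c x) x) \<in> boundaries nrm L"
      by blast
  next
    fix k x
    assume "(\<Sum>x\<in>b ` {..<N - 1}. fps_scale (k x) x) \<in> boundaries nrm L" and x: "x \<in> b ` {..<N - 1}"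
    then obtain f where f: "f \<in> overconvergent nrm" and eq: "u * r (\<lambda>m. k (b m)) = diff_op L f"
      unfolding boundaries_def sum_b by blast
    have "f = u * (u' * f)"
      using uu' by (simp add: mult.assoc[symmetric])
    then have "u * r (\<lambda>m. k (b m)) = u * nabla_pull q (u' * f)"
      using eq twist by metis
    then have "nabla_pull q (u' * f) = r (\<lambda>m. k (b m))"
      using uu' by auto
    then have "r (\<lambda>m. k (b m)) = 0"
      by (intro nabla_pull_eq_remainder[OF overconvergent_mult[OF u'(2) f] q0 r_supp])
    moreover obtain m where "m < N - 1" "x = b m"
      using x by auto
    ultimately show "k x = 0"
      using r_nth[of m "\<lambda>m. k (b m)"] by simp
  qed simp
qed

section \<open>Solubility\<close>

context padic_root_of_unity
begin

definition low_exponent :: "(nat \<Rightarrow> 'a) \<Rightarrow> nat \<Rightarrow> 'a fps" where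
  "low_exponent \<mu> j = (\<Sum>i<j. subst_monom (\<lambda>x. x) (p ^ i) (\<mu> i) (robba_log (z ^ p ^ i)))"

lemma low_exponent_Suc: "low_exponent \<mu> (Suc n) = exponent \<mu>"
  by (simp add: low_exponent_def exponent_def lessThan_Suc_atMost)

text \<open>The factors with i >= j are those attached to z^(p^j), of order p^(n-j+1), in the
  variable T^(p^j) and with shifted components.\<close>

lemma exponent_split:
  assumes "j \<le> n"
  shows "exponent \<mu> = low_exponent \<mu> j
    + pull (p ^ j) (padic_root_of_unity.exponent p (n - j) (z ^ p ^ j) (\<lambda>i. \<mu> (j + i)))"
proof -
  interpret R: padic_root_of_unity p nrm "n - j" "z ^ p ^ j"
    using assms by (rule padic_root_of_unity_power)
  have "pull (p ^ j) (R.exponent (\<lambda>i. \<mu> (j + i)))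
      = (\<Sum>i\<le>n - j. subst_monom (\<lambda>x. x) (p ^ (j + i)) (\<mu> (j + i)) (robba_log (z ^ p ^ (j + i))))"
    unfolding R.exponent_def id_map.subst_monom_sum
  proof (intro sum.cong refl)
    fix i
    have "(z ^ p ^ j) ^ p ^ i = z ^ p ^ (j + i)"
      by (simp add: power_add power_mult)
    then show "pull (p ^ j) (subst_monom (\<lambda>x. x) (p ^ i) (\<mu> (j + i)) (robba_log ((z ^ p ^ j) ^ p ^ i)))
        = subst_monom (\<lambda>x. x) (p ^ (j + i)) (\<mu> (j + i)) (robba_log (z ^ p ^ (j + i)))"
      using p_ge_2 by (simp add: id_map.subst_monom_subst_monom power_add)
  qed
  also have "\<dots> = (\<Sum>i\<in>{j..n}. subst_monom (\<lambda>x. x) (p ^ i) (\<mu> i) (robba_log (z ^ p ^ i)))"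
    by (rule sum.reindex_bij_witness[of _ "\<lambda>i. i - j" "\<lambda>i. j + i"]) (use assms in auto)
  finally have "low_exponent \<mu> j + pull (p ^ j) (R.exponent (\<lambda>i. \<mu> (j + i)))
      = (\<Sum>i\<in>{..<j} \<union> {j..n}. subst_monom (\<lambda>x. x) (p ^ i) (\<mu> i) (robba_log (z ^ p ^ i)))"
    unfolding low_exponent_def by (subst sum.union_disjoint) auto
  also have "{..<j} \<union> {j..n} = {..n}"
    using assms by auto
  finally show ?thesis
    by (simp add: exponent_def)
qed

text \<open>Every factor and its inverse is an integral series at \<mu>_i T^(p^i), a quantity of
  norm at most 1 on the circle of radius \<sigma>.\<close>

lemma low_exponent_bounded:
  assumes "0 \<le> \<sigma>" and le: "\<And>i. i < j \<Longrightarrow> nrm (\<mu> i) * \<sigma> ^ p ^ i \<le> 1"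
  obtains F G where "is_exp F (low_exponent \<mu> j)" and "is_exp G (- low_exponent \<mu> j)"
    and "bounded_at \<sigma> F" and "bounded_at \<sigma> G"
proof -
  have "\<exists>F G. is_exp F (robba_log (z ^ p ^ i)) \<and> is_exp G (- robba_log (z ^ p ^ i))
      \<and> integral_fps F \<and> integral_fps G" for i
  proof -
    have int: "integral_fps F"
      if "is_exp F f" and le: "\<And>m. m > 0 \<Longrightarrow> nrm (fps_nth F m) \<le> nrm (z ^ p ^ i - 1)" for F f :: "'a fps"
      unfolding integral_fps_def
    proof
      fix m
      show "nrm (fps_nth F m) \<le> 1"
      proof (cases "m = 0")
        case True
        then show ?thesis
          using is_exp_nth_0[OF that(1)] by simp
      next
        case False
        then show ?thesis
          using le[of m] nrm_z_power_diff_le_1[of "p ^ i"] by simp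
      qed
    qed
    show ?thesis
    proof (rule robba_exp_near_one[of "z ^ p ^ i"])
      show "nrm (z ^ p ^ i) = 1"
        by (simp add: nrm_power)
    qed (use int in blast)
  qed
  then obtain F G where F: "\<And>i. is_exp (F i) (robba_log (z ^ p ^ i))" "\<And>i. integral_fps (F i)"
    and G: "\<And>i. is_exp (G i) (- robba_log (z ^ p ^ i))" "\<And>i. integral_fps (G i)"
    by metis
  have bd: "bounded_at \<sigma> (subst_monom (\<lambda>x. x) (p ^ i) (\<mu> i) f)" if f: "integral_fps f" and i: "i < j" for f i
    unfolding bounded_at_def
  proof (intro exI allI)
    fix m
    show "nrm (fps_nth (subst_monom (\<lambda>x. x) (p ^ i) (\<mu> i) f) m) * \<sigma> ^ m \<le> 1"
    proof (cases "p ^ i dvd m")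
      case True
      then obtain l where m: "m = p ^ i * l"
        by blast
      have "nrm (fps_nth f l) * (nrm (\<mu> i) * \<sigma> ^ p ^ i) ^ l \<le> 1 * 1"
        using le[OF i] assms(1) integral_fpsD[OF f]
        by (intro mult_mono power_le_one) (auto simp: nrm_nonneg)
      then show ?thesis
        using p_ge_2 by (simp add: m subst_monom_nth nrm_mult nrm_power power_mult power_mult_distrib mult.assoc)
    qed (simp add: subst_monom_nth)
  qed
  show thesis
  proof
    show "is_exp (\<Prod>i<j. subst_monom (\<lambda>x. x) (p ^ i) (\<mu> i) (F i)) (low_exponent \<mu> j)"
      unfolding low_exponent_def using p_ge_2 by (intro is_exp_sum id_map.is_exp_subst_monom F) auto
    have neg: "- low_exponent \<mu> j = (\<Sum>i<j. subst_monom (\<lambda>x. x) (p ^ i) (\<mu> i) (- robba_log (z ^ p ^ i)))"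
      by (simp add: low_exponent_def sum_negf id_map.subst_monom_minus)
    show "is_exp (\<Prod>i<j. subst_monom (\<lambda>x. x) (p ^ i) (\<mu> i) (G i)) (- low_exponent \<mu> j)"
      unfolding neg using p_ge_2 by (intro is_exp_sum id_map.is_exp_subst_monom G) auto
    show "bounded_at \<sigma> (\<Prod>i<j. subst_monom (\<lambda>x. x) (p ^ i) (\<mu> i) (F i))"
      "bounded_at \<sigma> (\<Prod>i<j. subst_monom (\<lambda>x. x) (p ^ i) (\<mu> i) (G i))"
      using assms(1) F(2) G(2) by (auto intro!: bounded_at_prod bd)
  qed
qed

text \<open>Finitely many strict inequalities at 1/r persist slightly beyond it by continuity. The
  cap B serves to keep the circle inside the unit disc when r > 1.\<close>

lemma radius_gap:
  fixes B :: real
  assumes r: "r > 0" and less: "\<And>i. i < j \<Longrightarrow> nrm (\<mu> i) < r ^ p ^ i" and B: "1 / r < B"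
  obtains \<sigma> where "1 / r < \<sigma>" and "\<sigma> < B" and "\<And>i. i < j \<Longrightarrow> nrm (\<mu> i) * \<sigma> ^ p ^ i \<le> 1"
proof -
  have "eventually (\<lambda>\<sigma>. nrm (\<mu> i) * \<sigma> ^ p ^ i < 1) (at_right (1 / r))" if "i < j" for i
  proof (rule order_tendstoD(2))
    show "((\<lambda>\<sigma>. nrm (\<mu> i) * \<sigma> ^ p ^ i) \<longlongrightarrow> nrm (\<mu> i) * (1 / r) ^ p ^ i) (at_right (1 / r))"
      by (intro tendsto_intros)
    show "nrm (\<mu> i) * (1 / r) ^ p ^ i < 1"
      using less[OF that] r by (simp add: power_divide)
  qed
  then have "eventually (\<lambda>\<sigma>. \<forall>i\<in>{..<j}. nrm (\<mu> i) * \<sigma> ^ p ^ i < 1) (at_right (1 / r))"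
    by (intro eventually_ball_finite) auto
  moreover have "eventually (\<lambda>\<sigma>. \<sigma> \<in> {1 / r<..<B}) (at_right (1 / r))"
    using B by (rule eventually_at_right_real)
  ultimately have "eventually (\<lambda>\<sigma>. (\<forall>i\<in>{..<j}. nrm (\<mu> i) * \<sigma> ^ p ^ i < 1) \<and> \<sigma> \<in> {1 / r<..<B}) (at_right (1 / r))"
    by (rule eventually_conj)
  then obtain \<sigma> where "\<forall>i\<in>{..<j}. nrm (\<mu> i) * \<sigma> ^ p ^ i < 1" "\<sigma> \<in> {1 / r<..<B}"
    using eventually_happens[of _ "at_right (1 / r)"] by (auto simp: trivial_limit_at_right_real)
  then show thesis
    by (intro that[of \<sigma>]) (auto intro: less_imp_le)
qed

text \<open>Let r be the maximum of |\<mu>_i|^(1/p^i), first attained at j. If r > 1, the factors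
  before j and their inverses are bounded on a circle with 1/r < \<sigma> < 1. Dividing them out of
  e leaves a series in T^(p^j) with dominant first component, and
  \<open>radius_exp_exponent_le\<close> contradicts r \<sigma> > 1.\<close>

lemma soluble_imp_integral:
  assumes e: "is_exp e (exponent \<mu>)" and sol: "radius nrm e \<ge> 1"
  shows "i \<le> n \<Longrightarrow> nrm (\<mu> i) \<le> 1"
proof (rule ccontr)
  assume i: "i \<le> n" "\<not> nrm (\<mu> i) \<le> 1"
  define s where "s i = root (p ^ i) (nrm (\<mu> i))" for i
  have s_pow: "s i ^ p ^ i = nrm (\<mu> i)" for i
    using p_ge_2 by (simp add: s_def nrm_nonneg)
  have s0: "0 \<le> s i" for i
    using p_ge_2 by (simp add: s_def nrm_nonneg)
  define r where "r = Max (s ` {..n})"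
  have r: "r \<in> s ` {..n}" and s_le: "\<And>i. i \<le> n \<Longrightarrow> s i \<le> r"
    unfolding r_def by (auto intro!: Max_in Max_ge)
  have "s i > 1"
    using i(2) p_ge_2 by (simp add: s_def)
  then have r1: "r > 1"
    using s_le[OF i(1)] by simp
  define j where "j = (LEAST i. i \<le> n \<and> s i = r)"
  have "\<exists>i. i \<le> n \<and> s i = r"
    using r by auto
  then have j: "j \<le> n" "s j = r"
    unfolding j_def by (metis (mono_tags, lifting) LeastI_ex)+
  have less_j: "s i < r" if "i < j" for i
    using not_less_Least[of i "\<lambda>i. i \<le> n \<and> s i = r"] that s_le[of i] j(1) unfolding j_def[symmetric]
    by (auto simp: less_le)
  have less: "nrm (\<mu> i) < r ^ p ^ i" if "i < j" for i
    unfolding s_pow[symmetric] using less_j[OF that] s0 p_ge_2 by (intro power_strict_mono) auto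
  have "1 / r < 1"
    using r1 by simp
  then obtain \<sigma> where \<sigma>: "1 / r < \<sigma>" "\<sigma> < 1" "\<And>i. i < j \<Longrightarrow> nrm (\<mu> i) * \<sigma> ^ p ^ i \<le> 1"
    using radius_gap[of r j \<mu> 1] less r1 by auto
  have \<sigma>0: "0 < \<sigma>"
    using \<sigma>(1) r1 by (smt (verit) divide_pos_pos)
  obtain F G where FG: "is_exp F (low_exponent \<mu> j)" "is_exp G (- low_exponent \<mu> j)"
    "bounded_at \<sigma> F" "bounded_at \<sigma> G"
    using low_exponent_bounded[of \<sigma> j \<mu>] \<sigma>(3) \<sigma>0 by (metis less_imp_le)
  have "ereal \<sigma> < 1"
    using \<sigma>(2) by simp
  then have "ereal \<sigma> < radius nrm e"
    using sol by (rule less_le_trans)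
  then have bd_e: "bounded_at \<sigma> e"
    using \<sigma>0 by (intro bounded_at_if_radius_gt) auto
  interpret R: padic_root_of_unity p nrm "n - j" "z ^ p ^ j"
    using j(1) by (rule padic_root_of_unity_power)
  define \<nu> where "\<nu> i = \<mu> (j + i)" for i
  obtain g g' where g: "is_exp g (R.exponent \<nu>)" "is_exp g' (- R.exponent \<nu>)"
    by (rule R.exp_exponent)
  have "exponent \<mu> + (- low_exponent \<mu> j) = pull (p ^ j) (R.exponent \<nu>)"
    unfolding exponent_split[OF j(1), of \<mu>] \<nu>_def by simp
  then have "is_exp (e * G) (pull (p ^ j) (R.exponent \<nu>))"
    using is_exp_add[OF e FG(2)] by simp
  moreover have "is_exp (pull (p ^ j) g) (pull (p ^ j) (R.exponent \<nu>))"
    using p_ge_2 by (intro id_map.is_exp_subst_monom g) auto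
  ultimately have eq: "e * G = pull (p ^ j) g"
    by (rule is_exp_unique)
  have "bounded_at \<sigma> (e * G)"
    using \<sigma>0 by (intro bounded_at_mult bd_e FG) auto
  then obtain B where B: "\<And>m. nrm (fps_nth (pull (p ^ j) g) m) * \<sigma> ^ m \<le> B"
    unfolding eq bounded_at_def by blast
  have "nrm (fps_nth g m) * (\<sigma> ^ p ^ j) ^ m \<le> B" for m
    using B[of "p ^ j * m"] p_ge_2 by (simp add: pull_nth power_mult)
  then have "bounded_at (\<sigma> ^ p ^ j) g"
    unfolding bounded_at_def by blast
  moreover have "nrm (\<nu> 0) = r ^ p ^ j"
    using s_pow[of j] j(2) by (simp add: \<nu>_def)
  moreover have "nrm (\<nu> i) \<le> (r ^ p ^ j) ^ p ^ i" if "i \<le> n - j" for i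
  proof -
    have "nrm (\<mu> (j + i)) \<le> r ^ p ^ (j + i)"
      unfolding s_pow[symmetric] using s_le[of "j + i"] s0 that j(1) by (intro power_mono) auto
    then show ?thesis
      by (simp add: \<nu>_def power_add power_mult)
  qed
  ultimately have "r ^ p ^ j * \<sigma> ^ p ^ j \<le> 1"
    using \<sigma>0 r1 by (intro R.radius_exp_exponent_le[OF g]) auto
  moreover have "1 < r * \<sigma>"
    using \<sigma>(1) r1 by (simp add: field_simps)
  then have "1 < (r * \<sigma>) ^ p ^ j"
    using p_ge_2 by (intro one_less_power) auto
  ultimately show False
    by (simp add: power_mult_distrib)
qed

lemma small_imp_overconvergent:
  assumes "is_exp e (exponent \<mu>)" and "\<And>i. i \<le> n \<Longrightarrow> nrm (\<mu> i) < 1"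
  shows "e \<in> overconvergent nrm"
proof -
  obtain \<sigma> where \<sigma>: "1 / 1 < \<sigma>" "\<sigma> < 2" "\<And>i. i < Suc n \<Longrightarrow> nrm (\<mu> i) * \<sigma> ^ p ^ i \<le> 1"
    using radius_gap[of 1 "Suc n" \<mu> 2] assms(2) by (auto simp: less_Suc_eq_le)
  obtain F G where "is_exp F (low_exponent \<mu> (Suc n))" "bounded_at \<sigma> F"
    using low_exponent_bounded[of \<sigma> "Suc n" \<mu>] \<sigma> by (metis less_imp_le div_by_1 zero_less_one less_trans)
  then have "bounded_at \<sigma> e"
    using assms(1) is_exp_unique unfolding low_exponent_Suc by metis
  with \<sigma>(1) show ?thesis
    unfolding overconvergent_iff by auto
qed

end

section \<open>The index\<close>

lemma order_0_eqI:
  fixes f :: "'k::field poly"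
  assumes "\<And>i. i < q \<Longrightarrow> coeff f i = 0" and "coeff f q \<noteq> 0"
  shows "order 0 f = q"
proof -
  have f0: "f \<noteq> 0"
    using assms(2) by auto
  have X: "[:- 0, 1:] ^ m = monom (1::'k) m" for m
    by (simp add: monom_altdef)
  have "monom 1 q dvd f"
    using assms(1) by (simp add: monom_1_dvd_iff')
  then have "q \<le> order 0 f"
    using f0 unfolding X[symmetric] order_divides by blast
  moreover have "\<not> monom 1 (Suc q) dvd f"
    using assms(2) by (auto simp: monom_1_dvd_iff')
  then have "\<not> Suc q \<le> order 0 f"
    using f0 unfolding X[symmetric] order_divides by blast
  ultimately show ?thesis
    by simp
qed

text \<open>The last claim gives d - m as the index attached to the exponent p^m, so that
  \<open>pi_elt\<close> there is \<zeta>^(p^m) - 1.\<close>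

lemma floor_log_bounds:
  assumes "p \<ge> 2" and "D \<ge> 1" and d: "d = nat \<lfloor>log (real p) (real D)\<rfloor>"
  shows "p ^ d \<le> D" and "D < p ^ Suc d"
    and "i \<le> d \<Longrightarrow> floor_log_div p D (p ^ i) = d - i"
proof -
  have log0: "0 \<le> log (real p) (real D)"
    using assms by (simp add: zero_le_log_cancel_iff)
  then have fl: "\<lfloor>log (real p) (real D)\<rfloor> = int d"
    by (simp add: d)
  then have le: "real d \<le> log (real p) (real D)" and less: "log (real p) (real D) < real d + 1"
    by linarith+
  have "real p powr real d \<le> real D"
    using le_log_iff[of "real p" "real D" "real d"] le assms(1,2) by simp
  then have "real (p ^ d) \<le> real D"
    using powr_realpow[of "real p" d] assms(1) by simp
  then show "p ^ d \<le> D"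
    by linarith
  have "real D < real p powr (real d + 1)"
    using log_less_iff[of "real p" "real D" "real d + 1"] less assms(1,2) by simp
  also have "real p powr (real d + 1) = real (p ^ Suc d)"
    using assms powr_realpow[of "real p" "Suc d"] by (simp add: add.commute)
  finally show "D < p ^ Suc d"
    by linarith
  assume i: "i \<le> d"
  have "log (real p) (real D / real (p ^ i)) = log (real p) (real D) - real i"
    using assms by (simp add: log_divide log_nat_power)
  then have "\<lfloor>log (real p) (real D / real (p ^ i))\<rfloor> = int d - int i"
    using floor_diff_of_int[of "log (real p) (real D)" "int i"] fl by simp
  then show "floor_log_div p D (p ^ i) = d - i"
    using i by (simp add: floor_log_div_def)
qed

context padic_extension
begin

text \<open>Modulo the maximal ideal the factors with i < j become 1, factor j begins with 1 +
  \<mu>_j T^(p^j), and the later ones differ from 1 only in higher degree.\<close>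

lemma nrm_prod_AH:
  assumes "j \<le> n" and le: "\<And>i. i \<le> n \<Longrightarrow> nrm (\<mu> i) \<le> 1" and less: "\<And>i. i < j \<Longrightarrow> nrm (\<mu> i) < 1"
  defines "A \<equiv> \<Prod>i\<le>n. subst_monom (\<lambda>x. x) (p ^ i) (\<mu> i) AH"
  shows "fps_nth A 0 = 1" and "nrm (fps_nth A i) \<le> 1"
    and "0 < i \<Longrightarrow> i < p ^ j \<Longrightarrow> nrm (fps_nth A i) < 1"
    and "nrm (fps_nth A (p ^ j) - \<mu> j) < 1"
proof -
  \<comment> \<open>Congruence to 1 + c T^(p^j) modulo the maximal ideal and T^(p^j + 1). It is
    multiplicative with c additive, as all mixed terms are small.\<close>
  define near where "near F c \<longleftrightarrow> fps_nth F 0 = 1 \<and> integral_fps F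
    \<and> (\<forall>i. 0 < i \<longrightarrow> i < p ^ j \<longrightarrow> nrm (fps_nth F i) < 1) \<and> nrm (fps_nth F (p ^ j) - c) < 1" for F c
  have q0: "0 < p ^ j"
    using p_ge_2 by simp
  have near_mult: "near (F * G) (c + c')" if F: "near F c" and G: "near G c'" for F G c c'
  proof -
    have low: "nrm (fps_nth F l * fps_nth G (i - l)) < 1" if "0 < l" "l < i" "i \<le> p ^ j" for l i
    proof -
      have "nrm (fps_nth F l) < 1" "nrm (fps_nth G (i - l)) \<le> 1"
        using F G that by (auto simp: near_def integral_fpsD)
      then have "nrm (fps_nth F l) * nrm (fps_nth G (i - l)) \<le> nrm (fps_nth F l) * 1"
        by (intro mult_left_mono nrm_nonneg)
      with \<open>nrm (fps_nth F l) < 1\<close> show ?thesis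
        by (simp add: nrm_mult)
    qed
    have split: "fps_nth (F * G) i = fps_nth F i + fps_nth G i + (\<Sum>l\<in>{0<..<i}. fps_nth F l * fps_nth G (i - l))"
      if "i > 0" for i
    proof -
      have "{0..i} = insert 0 (insert i {0<..<i})"
        using that by auto
      with that F G show ?thesis
        by (simp add: fps_mult_nth near_def)
    qed
    have "nrm (fps_nth (F * G) i) < 1" if "0 < i" "i < p ^ j" for i
      unfolding split[OF that(1)] using that F G low
      by (intro nrm_add_less nrm_sum_less) (auto simp: near_def)
    moreover have "nrm (fps_nth (F * G) (p ^ j) - (c + c')) < 1"
    proof -
      have "fps_nth (F * G) (p ^ j) - (c + c') = (fps_nth F (p ^ j) - c) + (fps_nth G (p ^ j) - c')
          + (\<Sum>l\<in>{0<..<p ^ j}. fps_nth F l * fps_nth G (p ^ j - l))"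
        unfolding split[OF q0] by simp
      then show ?thesis
        using F G low by (simp only:) (intro nrm_add_less nrm_sum_less, auto simp: near_def)
    qed
    ultimately show ?thesis
      using F G by (auto simp: near_def intro: integral_fps_mult)
  qed
  have near_factor: "near (subst_monom (\<lambda>x. x) (p ^ i) (\<mu> i) AH) (if i = j then \<mu> j else 0)"
    if i: "i \<le> n" for i
    unfolding near_def
  proof (intro conjI allI impI)
    show "integral_fps (subst_monom (\<lambda>x. x) (p ^ i) (\<mu> i) AH)"
      using le[OF i] integral_AH
      by (auto simp: integral_fps_def subst_monom_nth intro!: nrm_mult_le_one nrm_power_le_one)
    have small: "nrm (fps_nth (subst_monom (\<lambda>x. x) (p ^ i) (\<mu> i) AH) m) < 1" if m: "0 < m" "m < p ^ j \<or> m = p ^ j \<and> i \<noteq> j" for m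
    proof (cases "p ^ i dvd m")
      case True
      then obtain l where l: "m = p ^ i * l"
        by blast
      have "i < j"
      proof (rule ccontr)
        assume "\<not> i < j"
        then have "p ^ j \<le> p ^ i"
          using p_ge_2 by (intro power_increasing) auto
        moreover have "p ^ i \<le> m"
          using True m(1) by (rule dvd_imp_le)
        ultimately have "m = p ^ j" "p ^ i = p ^ j"
          using m(2) by linarith+
        then show False
          using m(2) p_ge_2 by simp
      qed
      have "l > 0"
        using m(1) l by (cases l) auto
      then have "nrm (\<mu> i) ^ l \<le> nrm (\<mu> i)"
        using le[OF i] power_decreasing[of 1 l "nrm (\<mu> i)"] by (simp add: nrm_nonneg)
      then have "nrm (fps_nth AH l * \<mu> i ^ l) \<le> 1 * nrm (\<mu> i)"
        by (intro nrm_mult_le integral_fpsD integral_AH) (simp add: nrm_power)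
      with less[OF \<open>i < j\<close>] p_ge_2 show ?thesis
        by (simp add: l subst_monom_nth)
    qed (simp add: subst_monom_nth)
    show "nrm (fps_nth (subst_monom (\<lambda>x. x) (p ^ i) (\<mu> i) AH) m) < 1" if "0 < m" "m < p ^ j" for m
      using small that by blast
    show "nrm (fps_nth (subst_monom (\<lambda>x. x) (p ^ i) (\<mu> i) AH) (p ^ j) - (if i = j then \<mu> j else 0)) < 1"
    proof (cases "i = j")
      case True
      have "fps_nth (subst_monom (\<lambda>x. x) (p ^ j) (\<mu> j) AH) (p ^ j) = \<mu> j"
        using AH_nth_1 q0 by (simp add: subst_monom_nth)
      with True show ?thesis
        by simp
    next
      case False
      then show ?thesis
        using small[of "p ^ j"] q0 by simp
    qed
  qed simp
  have near_one: "near 1 0"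
    using q0 by (auto simp: near_def fps_one_nth)
  have "near (\<Prod>i\<in>S. subst_monom (\<lambda>x. x) (p ^ i) (\<mu> i) AH) (\<Sum>i\<in>S. if i = j then \<mu> j else 0)"
    if "finite S" "S \<subseteq> {..n}" for S
    using that
  proof (induction S rule: finite_induct)
    case (insert i S)
    then show ?case
      unfolding prod.insert[OF insert.hyps] sum.insert[OF insert.hyps]
      by (intro near_mult near_factor) auto
  qed (simp add: near_one)
  from this[of "{..n}"] have near: "near A (\<mu> j)"
    unfolding A_def using assms(1) by simp
  then show "fps_nth A 0 = 1" "nrm (fps_nth A i) \<le> 1" "0 < i \<Longrightarrow> i < p ^ j \<Longrightarrow> nrm (fps_nth A i) < 1"
    "nrm (fps_nth A (p ^ j) - \<mu> j) < 1"
    by (auto simp: near_def integral_fpsD)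
qed

end

theorem mainTheorem2:
  fixes p D d :: nat
    and nrm :: "'a::field_char_0 \<Rightarrow> real"
    and red :: "'a \<Rightarrow> 'k::field"
    and \<zeta> :: 'a
    and P :: "'a poly"
  assumes "padic_extension p nrm"
    and "residue_field nrm red"
    and "D \<ge> 1"
    and "d = nat \<lfloor>log (real p) (real D)\<rfloor>"
    and "primitive_root_of_unity (p ^ (d + 1)) \<zeta>"
    and "poly P 0 = 0"
    and "degree P \<le> D"
    and "p_typical p P"
    and "soluble nrm P"
    and "\<not> trivial_eq nrm P"
  shows "has_index nrm (fps_of_poly (pderiv P))
    \<and> e_hat p D \<zeta> red P \<noteq> 1
    \<and> real_of_int (index nrm (fps_of_poly (pderiv P)))
        = 1 - real (p ^ d) / real (order 0 (e_hat p D \<zeta> red P - 1))"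
proof -
  interpret K: padic_extension p nrm
    by (rule assms(1))
  interpret red: residue_field nrm red
    by (rule assms(2))
  note p_ge_2 = K.p_ge_2
  note D = floor_log_bounds[OF p_ge_2 assms(3,4)]
  have \<zeta>: "\<zeta> ^ p ^ Suc d = 1" "\<And>m. m \<le> d \<Longrightarrow> \<zeta> ^ p ^ m \<noteq> 1"
  proof -
    show "\<zeta> ^ p ^ Suc d = 1"
      using assms(5) by (simp add: primitive_root_of_unity_def)
    fix m
    assume "m \<le> d"
    then have "p ^ m < p ^ (d + 1)" "0 < p ^ m"
      using p_ge_2 power_strict_increasing[of m "d + 1" p] by simp_all
    then show "\<zeta> ^ p ^ m \<noteq> 1"
      using assms(5) unfolding primitive_root_of_unity_def by blast
  qed
  interpret R: padic_root_of_unity p nrm d \<zeta>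
    by unfold_locales (use \<zeta> in auto)
  \<comment> \<open>The ghost data are the coefficients of \<open>P_tilde\<close> at the powers of
    p. For m > d the divisor is 0 and the quotient is 0 by convention.\<close>
  define \<mu> where "\<mu> = witt (\<lambda>x::'a. x) p (\<lambda>m. coeff P (p ^ m) / (\<zeta> ^ p ^ m - 1))"
  have ghost: "coeff P (p ^ m) / (\<zeta> ^ p ^ m - 1)
      = (\<Sum>t\<le>m. 1 / of_nat (p ^ (m - t)) * \<mu> t ^ p ^ (m - t))" for m
    unfolding \<mu>_def by (rule id_map.witt_ghost)
  have restrict: "(\<Sum>i\<le>d. if i \<le> m then h i else 0) = (\<Sum>i\<le>m. h i)" if "m \<le> d" for m and h :: "nat \<Rightarrow> 'a"
  proof -
    have "(\<Sum>i\<le>d. if i \<le> m then h i else 0) = (\<Sum>i\<in>{..d} \<inter> {..m}. h i)"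
      by (simp add: sum.If_cases Int_def)
    also have "{..d} \<inter> {..m} = {..m}"
      using that by auto
    finally show ?thesis .
  qed
  have big: "D < p ^ m" if "m > d" for m
    using D(2) power_increasing[of "Suc d" m p] that p_ge_2 by simp
  have exponent: "fps_of_poly P = R.exponent \<mu>"
  proof (rule K.p_supported_eqI)
    show "K.p_supported (fps_of_poly P)"
      using assms(8) by (auto simp: K.p_supported_def p_typical_def)
    fix m
    show "fps_nth (fps_of_poly P) (p ^ m) = fps_nth (R.exponent \<mu>) (p ^ m)"
    proof (cases "m \<le> d")
      case True
      have "fps_nth (R.exponent \<mu>) (p ^ m)
          = (\<Sum>i\<le>m. (\<zeta> ^ p ^ m - 1) * (1 / of_nat (p ^ (m - i)) * \<mu> i ^ p ^ (m - i)))"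
        unfolding R.exponent_nth_power restrict[OF True] by simp
      also have "\<dots> = (\<zeta> ^ p ^ m - 1) * (coeff P (p ^ m) / (\<zeta> ^ p ^ m - 1))"
        unfolding ghost sum_distrib_left ..
      also have "\<dots> = coeff P (p ^ m)"
        using \<zeta>(2)[OF True] by simp
      finally show ?thesis
        by simp
    next
      case False
      then have "coeff P (p ^ m) = 0"
        using big[of m] assms(7) by (intro coeff_eq_0) simp
      with False show ?thesis
        by (simp add: R.exponent_nth_power R.z_power_eq_1)
    qed
  qed (rule R.p_supported_exponent)
  define e where "e = exp_poly P"
  define e' where "e' = fps_exp 1 oo (- fps_of_poly P)"
  have P0: "coeff P 0 = 0"
    using assms(6) by (simp add: poly_0_coeff_0)
  have e: "is_exp e (R.exponent \<mu>)" "is_exp e' (- R.exponent \<mu>)"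
    unfolding exponent[symmetric] e_def e'_def exp_poly_def
    using P0 by (auto intro!: is_exp_fps_exp_compose)
  have "radius nrm e \<ge> 1"
    using assms(9) by (simp add: soluble_def e_def)
  then have \<mu>_le: "\<And>i. i \<le> d \<Longrightarrow> nrm (\<mu> i) \<le> 1"
    using R.soluble_imp_integral[OF e(1)] by blast
  have not_oc: "e \<notin> overconvergent nrm"
    using assms(10) by (simp add: trivial_eq_def overconvergent_def e_def)
  define j where "j = (LEAST i. i \<le> d \<and> nrm (\<mu> i) = 1)"
  have "\<exists>i. i \<le> d \<and> nrm (\<mu> i) = 1"
    using R.small_imp_overconvergent[OF e(1)] not_oc \<mu>_le by (meson less_le)
  then have j: "j \<le> d" "nrm (\<mu> j) = 1"
    unfolding j_def by (metis (mono_tags, lifting) LeastI_ex)+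
  have less: "nrm (\<mu> i) < 1" if "i < j" for i
    using not_less_Least[of i "\<lambda>i. i \<le> d \<and> nrm (\<mu> i) = 1"] that \<mu>_le[of i] j(1) unfolding j_def[symmetric]
    by (auto simp: less_le)

  \<comment> \<open>Finite-dimensionality and the dimension of the cokernel\<close>
  define N where "N = p ^ (d - j)"
  define L where "L = fps_of_poly (pderiv P)"
  have L: "L = fps_deriv (R.exponent \<mu>)"
    by (simp add: L_def exponent[symmetric] fps_of_poly_pderiv)
  have "\<exists>B. quotient_basis (overconvergent nrm) (boundaries nrm L) B \<and> card B = N - 1"
  proof -
    interpret S: padic_root_of_unity p nrm "d - j" "\<zeta> ^ p ^ j"
      using j(1) by (rule R.padic_root_of_unity_power)
    define \<nu> where "\<nu> i = \<mu> (j + i)" for i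
    obtain g g' where g: "is_exp g (S.exponent \<nu>)" "is_exp g' (- S.exponent \<nu>)"
      by (rule S.exp_exponent)
    interpret E: reducing_exponent p nrm "S.exponent \<nu>" g g' N
      unfolding N_def using g
      by (rule S.reducing_exponent) (use j \<mu>_le in \<open>auto simp: \<nu>_def\<close>)
    obtain \<sigma> where \<sigma>: "1 / 1 < \<sigma>" "\<sigma> < 2" "\<And>i. i < j \<Longrightarrow> nrm (\<mu> i) * \<sigma> ^ p ^ i \<le> 1"
      using R.radius_gap[of 1 j \<mu> 2] less by auto
    obtain u u' where u: "is_exp u (R.low_exponent \<mu> j)" "is_exp u' (- R.low_exponent \<mu> j)"
      "K.bounded_at \<sigma> u" "K.bounded_at \<sigma> u'"
    proof (rule R.low_exponent_bounded[of \<sigma> j \<mu>])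
      show "0 \<le> \<sigma>"
        using \<sigma>(1) by simp
      show "nrm (\<mu> i) * \<sigma> ^ p ^ i \<le> 1" if "i < j" for i
        using that by (rule \<sigma>(3))
    qed (rule that)
    have oc: "u \<in> overconvergent nrm" "u' \<in> overconvergent nrm"
      unfolding K.overconvergent_iff using u \<sigma>(1) by auto
    have "L = fps_deriv (R.low_exponent \<mu> j + K.pull (p ^ j) (S.exponent \<nu>))"
      unfolding L R.exponent_split[OF j(1)] \<nu>_def ..
    then show ?thesis
      using E.quotient_basis_twisted_pull[OF refl u(1) oc(1) u(2) oc(2), of j] by metis
  qed
  then obtain B where B: "quotient_basis (overconvergent nrm) (boundaries nrm L) B" "card B = N - 1"
    by blast
  have H0: "H0 nrm L = {0}"
    unfolding L using e not_oc by (rule K.H0_trivial)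
  have "has_index nrm L"
    unfolding has_index_def H0
  proof (intro conjI)
    show "\<exists>B. finite B \<and> {0} \<subseteq> fps_vs.span B"
      by (intro exI[of _ "{}"]) simp
    show "\<exists>B. quotient_basis (overconvergent nrm) (boundaries nrm L) B"
      using B(1) by blast
  qed
  have "fps_vs.dim (H0 nrm L) = card ({} :: 'a fps set)"
    unfolding H0 by (rule fps_vs.dim_unique) (auto simp: fps_vs.independent_empty)
  then have index: "index nrm L = - int (N - 1)"
    unfolding index_def using K.quotient_dim_boundaries[OF B(1)] B(2) by simp
  have N: "N \<ge> 1" "real (p ^ d) / real (p ^ j) = real N"
  proof -
    show "N \<ge> 1"
      using p_ge_2 by (simp add: N_def)
    have "p ^ d = p ^ j * N"
      using j(1) by (simp add: N_def flip: power_add)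
    then show "real (p ^ d) / real (p ^ j) = real N"
      using p_ge_2 by simp
  qed

  \<comment> \<open>The order at 0 of the reduced truncated exponential\<close>
  define A where "A = (\<Prod>i\<le>d. subst_monom (\<lambda>x. x) (p ^ i) (\<mu> i) K.AH)"
  have A_exp: "is_exp A (\<Sum>i\<le>d. subst_monom (\<lambda>x. x) (p ^ i) (\<mu> i) (ah_log p))"
    unfolding A_def using p_ge_2 by (intro is_exp_sum id_map.is_exp_subst_monom K.is_exp_AH) auto
  note A = K.nrm_prod_AH[of j d \<mu>, OF j(1) \<mu>_le less, folded A_def]
  have tilde_coeff: "coeff (P_tilde p D \<zeta> P) i
      = (if 1 \<le> i \<and> i \<le> D then coeff P i / pi_elt p D \<zeta> (floor_log_div p D i) else 0)" for i
    by (auto simp: P_tilde_def coeff_sum)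
  have tilde_exp: "is_exp (exp_poly (P_tilde p D \<zeta> P)) (fps_of_poly (P_tilde p D \<zeta> P))"
    unfolding exp_poly_def by (rule is_exp_fps_exp_compose) (simp add: tilde_coeff)
  \<comment> \<open>The comparison stops at D: the right side consists of infinite Artin-Hasse
    logarithms, while the powers of p up to D are exactly the p^m with m <= d.\<close>
  have tilde_eq: "fps_nth (fps_of_poly (P_tilde p D \<zeta> P)) i
      = fps_nth (\<Sum>i\<le>d. subst_monom (\<lambda>x. x) (p ^ i) (\<mu> i) (ah_log p)) i" if i: "i \<le> D" for i
  proof (cases "\<exists>m. i = p ^ m")
    case True
    then obtain m where m: "i = p ^ m"
      by blast
    then have md: "m \<le> d"
      using big[of m] i by (cases "m \<le> d") auto
    have "pi_elt p D \<zeta> (floor_log_div p D i) = \<zeta> ^ p ^ m - 1"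
      using D(3)[of m] D(3)[of 0] md unfolding m pi_elt_def by simp
    moreover have "1 \<le> i"
      using p_ge_2 by (simp add: m)
    ultimately have "fps_nth (fps_of_poly (P_tilde p D \<zeta> P)) i = coeff P (p ^ m) / (\<zeta> ^ p ^ m - 1)"
      using i by (simp add: tilde_coeff m)
    also have "\<dots> = (\<Sum>t\<le>d. if t \<le> m then 1 / of_nat (p ^ (m - t)) * \<mu> t ^ p ^ (m - t) else 0)"
      unfolding ghost restrict[OF md] ..
    also have "\<dots> = fps_nth (\<Sum>i\<le>d. subst_monom (\<lambda>x. x) (p ^ i) (\<mu> i) (ah_log p)) i"
      unfolding m fps_sum_nth K.subst_monom_nth_power K.ah_log_power ..
    finally show ?thesis .
  next
    case False
    have "K.p_supported (\<Sum>i\<le>d. subst_monom (\<lambda>x. x) (p ^ i) (\<mu> i) (ah_log p))"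
      by (intro K.p_supported_sum K.p_supported_subst_monom ring_map_id K.p_supported_ah_log)
    then have "fps_nth (\<Sum>i\<le>d. subst_monom (\<lambda>x. x) (p ^ i) (\<mu> i) (ah_log p)) i = 0"
      using False unfolding K.p_supported_def by blast
    moreover have "coeff P i = 0"
      using False assms(8) unfolding p_typical_def by blast
    ultimately show ?thesis
      by (simp add: tilde_coeff)
  qed
  \<comment> \<open>Needed for \<open>map_poly\<close> to act coefficientwise, also on the zero
    coefficients.\<close>
  have red_0: "red 0 = 0"
    using red.red_eq_0_iff[of 0] by (simp add: integer_ring_def)
  have hat_coeff: "coeff (e_hat p D \<zeta> red P) i = red (fps_nth A i)" if "i \<le> D" for i
  proof -
    have "fps_nth (exp_poly (P_tilde p D \<zeta> P)) i = fps_nth A i"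
      by (rule is_exp_nth_cong[OF tilde_exp A_exp tilde_eq that])
    with that show ?thesis
      by (simp add: e_hat_def e_tilde_def coeff_map_poly red_0 coeff_truncate_fps')
  qed
  have q_le: "p ^ j \<le> D"
    using D(1) power_increasing[OF j(1), of p] p_ge_2 by linarith
  have red_nz: "red (fps_nth A (p ^ j)) \<noteq> 0"
  proof -
    have "nrm (\<mu> j + (fps_nth A (p ^ j) - \<mu> j)) = nrm (\<mu> j)"
      using A(4) j(2) by (intro K.nrm_add_dominant) simp
    then have "nrm (fps_nth A (p ^ j)) = 1"
      using j(2) by simp
    then show ?thesis
      using red.red_eq_0_iff by (simp add: integer_ring_def)
  qed
  have hat_top: "coeff (e_hat p D \<zeta> red P - 1) (p ^ j) \<noteq> 0"
    using hat_coeff[OF q_le] red_nz p_ge_2 by simp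
  have "coeff (e_hat p D \<zeta> red P - 1) i = 0" if "i < p ^ j" for i
  proof (cases "i = 0")
    case True
    then show ?thesis
      using hat_coeff[of 0] A(1) red.red_one by simp
  next
    case False
    have "nrm (fps_nth A i) < 1"
      using A(3) False that by simp
    then have "red (fps_nth A i) = 0"
      using red.red_eq_0_iff by (simp add: integer_ring_def)
    with False that q_le hat_coeff[of i] show ?thesis
      by simp
  qed
  then have order: "order 0 (e_hat p D \<zeta> red P - 1) = p ^ j"
    using hat_top by (rule order_0_eqI)
  have "e_hat p D \<zeta> red P \<noteq> 1"
    using hat_top by auto
  moreover have "real_of_int (index nrm L) = 1 - real (p ^ d) / real (order 0 (e_hat p D \<zeta> red P - 1))"
    unfolding order N(2) index using N(1) by (simp add: of_nat_diff)
  ultimately show ?thesis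
    using \<open>has_index nrm L\<close> unfolding L_def by blast
qed

end
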